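(* Let $v\in V$ and $\varkappa(t)=4\sqrt{v(t)\ln v(t)}$. Suppose that $f$ is an entire function, $|z_0|=r$, and $$|f(z_0)|\ge M(r,f)\,v^{-2}(\nu(r,f))$$ holds. Then there exists a set $E\subset\mathbb R_+$ of finite logarithmic measure such that if $$r\left(1-\frac{1}{40\varkappa(\nu)}\right)<\rho<r\left(1+\frac{1}{40\varkappa(\nu)}\right),\qquad r\notin E,\quad \nu=\nu(r,f),$$ $\alpha>0$ and $j\in\mathbb N$, then we have for $|z|=\rho$ $$\mathcal D_\alpha^{j}f(z)=(\nu\alpha)^{j\alpha}\left(\frac{f(z)}{z^{j}}+O\left(\frac{\varkappa(\nu)}{\nu}\right)\frac{M(\rho,f)}{\rho^{j}}\right).$$ In particular, if $\ln\rho-\ln r=o\left(\frac1{\varkappa(\nu)}\right)$, then $$M(\rho,\mathcal D_\alpha^{j}f)=\frac{(\nu\alpha)^{j\alpha}}{\rho^{j}}\left\{1+O\left(\frac{\varkappa(\nu)}{\nu}\right)\right\}M(\rho,f)=(1+o(1))\frac{(\nu\alpha)^{j\alpha}}{r^{j}}M(r,f)$$ as $r\to+\infty$, $r\notin E$.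
   Context: For an entire function $f(z)=\sum_{n=0}^\infty a_nz^n$ and $r\ge 0$: $M(r,f)=\max\{|f(z)|:|z|=r\}$; the maximal term is $\mu(r,f)=\max\{|a_n|r^n:n\ge0\}$; the central index is $\nu(r,f)=\max\{n\ge0:|a_n|r^n=\mu(r,f)\}$. $V$ is the class of positive continuous nondecreasing functions $v$ on $[0,+\infty)$ such that $\frac{x^2}{v(x)\ln v(x)}$ increases to $+\infty$ on $[x_0,+\infty)$, $x_0>0$, and $\int_0^{+\infty}\frac{dx}{v(x)}<+\infty$. A measurable set $E\subset[0,\infty)$ is of finite logarithmic measure if $\int_{E\cap[1,\infty)}\frac{dt}{t}<\infty$. For $\alpha>0$ the Djrbashian-Gelfond-Leontiev operator $\mathcal D_\alpha$ acts on entire functions $f(z)=\sum_{n=0}^\infty a_nz^n$ by $$(\mathcal D_\alpha f)(z)=\sum_{n=1}^\infty a_n\frac{\Gamma(n\alpha+1)}{\Gamma(n\alpha+1-\alpha)}z^{n-1},$$ where $\Gamma$ is the Gamma function, and $\mathcal D_\alpha^{j}$ is its $j$-th iterate, so $(\mathcal D_\alpha^{j} f)(z)=\sum_{n=j}^\infty a_n\frac{\Gamma(n\alpha+1)}{\Gamma((n-j)\alpha+1)}z^{n-j}$.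
   Formalization: The last equality is false as printed (f = exp, ρ = r+1) and is given for transcendental f only, with M(r,f) multiplied by (ρ/r)^ν; the printed form is given when in addition ln ρ − ln r = o(1/ν). *)

theory Defs
  imports "HOL-Complex_Analysis.Complex_Analysis" "HOL-Library.Landau_Symbols"
begin

definition taylor_coeff :: "(complex \<Rightarrow> complex) \<Rightarrow> nat \<Rightarrow> complex" where
  "taylor_coeff f n = fps_nth (fps_expansion f 0) n"

text \<open>Suprema stand for maxima below: for entire \<open>f\<close> and \<open>r \<ge> 0\<close> both are attained.\<close>

definition max_modulus :: "real \<Rightarrow> (complex \<Rightarrow> complex) \<Rightarrow> real" where
  "max_modulus r f = (SUP z\<in>sphere 0 r. norm (f z))"

definition max_term :: "real \<Rightarrow> (complex \<Rightarrow> complex) \<Rightarrow> real" where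
  "max_term r f = (SUP n. norm (taylor_coeff f n) * r ^ n)"

text \<open>The set below is finite and nonempty whenever \<open>r > 0\<close> and \<open>f\<close> is entire and not
  identically zero.\<close>

definition central_index :: "real \<Rightarrow> (complex \<Rightarrow> complex) \<Rightarrow> nat" where
  "central_index r f = Max {n. norm (taylor_coeff f n) * r ^ n = max_term r f}"

text \<open>Since \<open>v\<close> is positive and continuous, the monotonicity and divergence of the quotient
  force \<open>v x > 1\<close> for \<open>x \<ge> x0\<close>, so that division by zero plays no role there.\<close>

definition class_V :: "(real \<Rightarrow> real) set" where
  "class_V = {v. (\<forall>x\<ge>0. v x > 0) \<and> continuous_on {0..} v \<and> mono_on {0..} v \<and>
     (\<exists>x0>0. mono_on {x0..} (\<lambda>x. x\<^sup>2 / (v x * ln (v x)))) \<and>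
     filterlim (\<lambda>x. x\<^sup>2 / (v x * ln (v x))) at_top at_top \<and>
     set_integrable lborel {0..} (\<lambda>x. 1 / v x)}"

definition kappa :: "(real \<Rightarrow> real) \<Rightarrow> real \<Rightarrow> real" where
  "kappa v t = 4 * sqrt (v t * ln (v t))"

definition finite_log_measure :: "real set \<Rightarrow> bool" where
  "finite_log_measure E \<longleftrightarrow> E \<subseteq> {0..} \<and> E \<in> sets lebesgue \<and>
     (\<integral>\<^sup>+t\<in>E \<inter> {1..}. ennreal (1 / t) \<partial>lebesgue) < \<infinity>"

text \<open>The series runs over \<open>n \<ge> 1\<close> in the usual notation; here it is shifted by one.\<close>

definition dgl_op :: "real \<Rightarrow> (complex \<Rightarrow> complex) \<Rightarrow> complex \<Rightarrow> complex" where
  "dgl_op \<alpha> f z = (\<Sum>n. taylor_coeff f (Suc n) *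
     of_real (Gamma (real (Suc n) * \<alpha> + 1) / Gamma (real (Suc n) * \<alpha> + 1 - \<alpha>)) * z ^ n)"

end

theory Submission
  imports Defs "HOL-Real_Asymp.Real_Asymp"
begin

text \<open>
  Put \<open>l n = (\<Sum>i<n. 1 / v i)\<close>, a bounded sequence. Comparing the Taylor coefficients \<open>a n\<close> of \<open>f\<close> with
  \<open>exp (- (\<Sum>i\<le>n. l i))\<close> shows that outside a set of finite logarithmic measure
  \<open>|a n| r^n\<close> is at most \<open>|a \<nu>| r^\<nu> exp (- (\<Sum>i. l i - l \<nu>))\<close>, the sum being over \<open>\<nu> < i \<le> n\<close> (and similarly for
  \<open>n < \<nu>\<close>), where \<open>\<nu>\<close> is the central index. As \<open>x^2 / (v x ln (v x))\<close> tends monotonically to infinity,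
  the terms with \<open>|n - \<nu>|\<close> beyond a fixed multiple of \<open>\<kappa>\<close> sum up to \<open>O(\<kappa>/\<nu>)\<close> times the maximal term,
  even after multiplication by powers of \<open>n / \<nu>\<close> and after a change of radius.

  On the remaining window the operator multiplies \<open>a n z^n\<close> by \<open>\<Gamma>(n\<alpha>+1) / \<Gamma>((n-j)\<alpha>+1)\<close>, which differs from
  \<open>(\<nu>\<alpha>)^(j\<alpha>)\<close> by a relative error \<open>O(\<kappa>/\<nu>)\<close> with relative increments \<open>O(1/\<nu>)\<close>. A multiplier on a window of
  length \<open>m\<close> with values at most \<open>A\<close> and increments at most \<open>D\<close> increases the maximum modulus by a factor
  at most \<open>2 (A + m D)\<close>. The same bound for the multiplier \<open>(\<rho>/r)^(n-\<nu>) - 1\<close> compares the maxima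
  of \<open>|f|\<close> on the circles of radii \<open>r\<close> and \<open>\<rho>\<close>.
\<close>

section \<open>Multipliers of trigonometric polynomials\<close>

text \<open>Summing absolute values over the window would cost a factor of order \<kappa>, and
  \<kappa>^2 / \<nu> does not tend to 0, because v grows at least linearly. Cancellation must
  therefore be kept: the bound \<open>2 * (A + m * D)\<close> sees the window length only through
  total increments, and O(\<kappa>) increments of size O(1/\<nu>) are again O(\<kappa>/\<nu>). All
  errors are measured against the maximum modulus. It dominates every term of the series by Cauchy's
  inequality, so tails need only be small relative to the maximal term. A second obstacle sits in
  the comparison of M(\<rho>,f) with M(r,f): their ratio behaves like (\<rho>/r)^\<nu>, and \<nu>
  (ln \<rho> - ln r) need not tend to 0 when ln \<rho> - ln r is merely o(1/\<kappa>), since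
  \<nu>/\<kappa> tends to infinity. This power stays in the formula and disappears under o(1/\<nu>).
  For polynomials \<nu> is eventually constant, so \<kappa>/\<nu> does not tend to 0 and the
  O-statements only express boundedness.\<close>

lemma sin_ge_linear:
  assumes "0 \<le> t" "t \<le> 1"
  shows "sin (t * (pi / 2)) \<ge> t"
proof -
  have "convex_on {0..pi/2} (\<lambda>x. - sin x)"
  proof (rule convex_on_realI)
    show "((\<lambda>x. - sin x) has_real_derivative - cos x) (at x)" for x
      by (auto intro!: derivative_eq_intros)
    show "- cos x \<le> - cos y" if "x \<in> {0..pi/2}" "y \<in> {0..pi/2}" "x \<le> y" for x y :: real
      using that cos_mono_le_eq[of y x] by auto
  qed auto
  from convex_onD[OF this, of t 0 "pi/2"] assms show ?thesis by simp
qed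

text \<open>A chord of the unit circle is at least 2/pi times its arc. The arc from the node to 1 is
  pi min(l, 2m - l) / m, so pi cancels.\<close>

lemma norm_cis_minus_one_ge:
  fixes l m :: nat
  assumes "l < 2 * m"
  shows "norm (cis (2 * pi * real l / real (2 * m)) - 1) \<ge> 2 * min (real l) (real (2 * m) - real l) / real m"
proof -
  have m: "m > 0" using assms by auto
  have eq: "norm (cis x - 1) = 2 * \<bar>sin (x / 2)\<bar>" for x :: real
    using dist_exp_i_1[of x] by (simp add: cis_conv_exp)
  have "min (real l) (real (2*m) - real l) / real m \<le> sin (pi * real l / real (2 * m))"
  proof (cases "l \<le> m")
    case True
    have "sin (real l / real m * (pi / 2)) \<ge> real l / real m"
      by (rule sin_ge_linear) (use True m in auto)
    also have "real l / real m * (pi / 2) = pi * real l / real (2 * m)" by (simp add: mult.commute)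
    finally show ?thesis using True by (simp add: min_def mult.commute[of pi] mult.commute[of 2])
  next
    case False
    have "sin ((2 * real m - real l) / real m * (pi / 2)) \<ge> (2 * real m - real l) / real m"
      by (rule sin_ge_linear) (use False m assms in auto)
    also have "(2 * real m - real l) / real m * (pi / 2) = pi - pi * real l / real (2 * m)"
      using m by (simp add: field_simps)
    also have "sin \<dots> = sin (pi * real l / real (2 * m))" by simp
    finally show ?thesis using False by (simp add: min_def mult.commute)
  qed
  moreover have "2 * pi * real l / real (2 * m) / 2 = pi * real l / real (2 * m)" by simp
  ultimately show ?thesis unfolding eq by (simp only: times_divide_eq_right[symmetric])
qed

text \<open>The subtracted term carries the induction: its decrement 1 / (4n^2 + 8n + 3) exceeds the
  next summand 1 / (4n^2 + 8n + 5). At n = 0 there is equality; later only the uniform bound 3/2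
  matters.\<close>

lemma sum_inverse_quadratic_le: "(\<Sum>l\<le>n. 1 / (1 + 4 * (real l)\<^sup>2)) \<le> 3 / 2 - 1 / (4 * real n + 2)"
proof (induction n)
  case (Suc n)
  have "1 / (1 + 4 * (real (Suc n))\<^sup>2) \<le> 1 / (4 * real n + 2) - 1 / (4 * real (Suc n) + 2)"
  proof -
    have "1 / (4 * real n + 2) - 1 / (4 * real (Suc n) + 2) = 1 / (4 * (real n)\<^sup>2 + 8 * real n + 3)"
    proof -
      have "4 * real n + 2 \<noteq> 0" "4 * real (Suc n) + 2 \<noteq> 0" "4 * (real n)\<^sup>2 + 8 * real n + 3 \<noteq> 0"
        by (smt (verit) of_nat_0_le_iff zero_le_power2)+
      then show ?thesis by (simp add: field_simps power2_eq_square)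
    qed
    moreover have "4 * (real n)\<^sup>2 + 8 * real n + 3 \<le> 1 + 4 * (real (Suc n))\<^sup>2"
      by (simp add: power2_eq_square algebra_simps)
    moreover have "4 * (real n)\<^sup>2 + 8 * real n + 3 > 0" by (simp add: add_pos_nonneg add_nonneg_pos)
    ultimately show ?thesis by (simp add: frac_le)
  qed
  with Suc show ?case by simp
qed simp

section \<open>Discrete Fourier transform and the size of kernels\<close>

lemma dft_orthogonality:
  fixes L i n :: nat
  assumes "i < L" "n < L"
  shows "(\<Sum>l<L. cis (2 * pi * real l * real n / real L) * cis (- (2 * pi * real l * real i / real L)))
    = (if i = n then of_nat L else 0)"
proof (cases "i = n")
  case False
  define q where "q = cis (2 * pi * (real n - real i) / real L)"
  have eq: "cis (2 * pi * real l * real n / real L) * cis (- (2 * pi * real l * real i / real L)) = q ^ l" for l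
  proof -
    have "2 * pi * real l * real n / real L - 2 * pi * real l * real i / real L
      = real l * (2 * pi * (real n - real i) / real L)"
      by (simp add: diff_divide_distrib[symmetric] algebra_simps)
    then show ?thesis unfolding q_def Complex.DeMoivre cis_mult by simp
  qed
  have qL: "q ^ L = 1"
  proof -
    have "real L * (2 * pi * (real n - real i) / real L) = 2 * pi * of_int (int n - int i)"
      using assms by simp
    then have "q ^ L = cis (2 * pi * of_int (int n - int i))"
      unfolding q_def Complex.DeMoivre by (metis)
    also have "\<dots> = 1" by (rule cis_multiple_2pi) auto
    finally show ?thesis .
  qed
  have "q \<noteq> 1"
  proof
    assume "q = 1"
    then have "cos (2 * pi * (real n - real i) / real L) = 1" by (simp add: q_def complex_eq_iff)
    then obtain k :: int where "2 * pi * (real n - real i) / real L = of_int k * 2 * pi"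
      using cos_one_2pi_int by auto
    then have "2 * pi * (real n - real i) = 2 * pi * (of_int k * real L)"
      using assms by (simp add: field_simps)
    then have "real n - real i = of_int k * real L" by (subst (asm) mult_left_cancel) auto
    then have k: "int n - int i = k * int L"
      by (metis (mono_tags, lifting) of_int_diff of_int_eq_iff of_int_mult of_int_of_nat_eq)
    have "\<bar>k * int L\<bar> < int L" using k assms by auto
    then have "\<bar>k\<bar> * int L < 1 * int L" by (simp add: abs_mult)
    then have "k = 0" using assms by (simp add: mult_less_cancel_right)
    then show False using k False by simp
  qed
  then show ?thesis unfolding eq using geometric_sum[of q L] qL False by simp
qed (simp add: cis_mult)

lemma dft_parseval:
  fixes h :: "nat \<Rightarrow> real"
  shows "(\<Sum>l<L. (norm (\<Sum>n<L. of_real (h n) * cis (2 * pi * real l * real n / real L)))\<^sup>2)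
    = real L * (\<Sum>n<L. (h n)\<^sup>2)"
proof -
  let ?e = "\<lambda>l n. cis (2 * pi * real l * real n / real L)"
  have "complex_of_real (\<Sum>l<L. (norm (\<Sum>n<L. of_real (h n) * ?e l n))\<^sup>2)
      = (\<Sum>l<L. (\<Sum>n<L. of_real (h n) * ?e l n) * cnj (\<Sum>i<L. of_real (h i) * ?e l i))"
    unfolding of_real_sum complex_norm_square ..
  also have "\<dots> = (\<Sum>l<L. \<Sum>n<L. \<Sum>i<L. of_real (h n * h i) * (?e l n * cis (- (2 * pi * real l * real i / real L))))"
    by (simp add: sum_product cis_cnj algebra_simps)
  also have "\<dots> = (\<Sum>n<L. \<Sum>l<L. \<Sum>i<L. of_real (h n * h i) * (?e l n * cis (- (2 * pi * real l * real i / real L))))"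
    by (rule sum.swap)
  also have "\<dots> = (\<Sum>n<L. \<Sum>i<L. \<Sum>l<L. of_real (h n * h i) * (?e l n * cis (- (2 * pi * real l * real i / real L))))"
    by (intro sum.cong refl sum.swap)
  also have "\<dots> = (\<Sum>n<L. \<Sum>i<L. of_real (h n * h i) * (if i = n then of_nat L else 0))"
    by (intro sum.cong refl) (simp add: sum_distrib_left[symmetric] dft_orthogonality)
  also have "\<dots> = (\<Sum>n<L. of_real (h n * h n) * of_nat L)"
  proof (intro sum.cong refl)
    fix n assume n: "n \<in> {..<L}"
    have "(\<Sum>i<L. complex_of_real (h n * h i) * (if i = n then of_nat L else 0))
      = (\<Sum>i<L. if i = n then complex_of_real (h n * h i) * of_nat L else 0)"
      by (intro sum.cong) auto
    then show "(\<Sum>i<L. complex_of_real (h n * h i) * (if i = n then of_nat L else 0)) = of_real (h n * h n) * of_nat L"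
      using n by simp
  qed
  also have "\<dots> = complex_of_real (real L * (\<Sum>n<L. (h n)\<^sup>2))"
    by (simp add: sum_distrib_left power2_eq_square algebra_simps)
  finally show ?thesis using of_real_eq_iff by blast
qed

text \<open>Summation by parts, where periodicity cancels the boundary terms. Together with Parseval
  it turns a bound on the increments of h into an L2 bound on the transform weighted by |e^{it} -
  1|^2.\<close>

lemma dft_difference:
  fixes h :: "nat \<Rightarrow> real"
  assumes "h L = h 0"
  shows "(\<Sum>n<L. of_real (h (Suc n) - h n) * cis (2 * pi * real l * real n / real L))
    = (cis (- (2 * pi * real l / real L)) - 1) * (\<Sum>n<L. of_real (h n) * cis (2 * pi * real l * real n / real L))"
proof (cases "L = 0")
  case False
  let ?e = "\<lambda>n. cis (2 * pi * real l * real n / real L)"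
  have e: "?e n = cis (- (2 * pi * real l / real L)) * ?e (Suc n)" for n
    by (simp add: cis_mult algebra_simps add_divide_distrib)
  have eL: "?e L = 1"
  proof -
    have "2 * pi * real l * real L / real L = 2 * pi * of_int (int l)" using False by simp
    then show ?thesis using cis_multiple_2pi[of "of_int (int l)"] by simp
  qed
  have "(\<Sum>n<L. of_real (h (Suc n)) * ?e n) = cis (- (2 * pi * real l / real L)) * (\<Sum>n<L. of_real (h (Suc n)) * ?e (Suc n))"
    by (subst e, simp only: sum_distrib_left) (intro sum.cong refl, simp)
  also have "(\<Sum>n<L. of_real (h (Suc n)) * ?e (Suc n)) = (\<Sum>n<L. of_real (h n) * ?e n)"
  proof -
    have "(\<Sum>n<Suc L. of_real (h n) * ?e n) = of_real (h 0) * ?e 0 + (\<Sum>n<L. of_real (h (Suc n)) * ?e (Suc n))"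
      by (rule sum.lessThan_Suc_shift)
    moreover have "(\<Sum>n<Suc L. of_real (h n) * ?e n) = (\<Sum>n<L. of_real (h n) * ?e n) + of_real (h L) * ?e L"
      by (rule sum.lessThan_Suc)
    ultimately show ?thesis using assms eL by simp
  qed
  finally show ?thesis by (simp add: algebra_simps sum_subtractf)
qed simp

text \<open>A discrete form of the Bernstein--Carlson bound: the $L^1$ norm of a kernel is estimated by
  Cauchy--Schwarz against the weight $1 + m^2 |e^{it} - 1|^2$.\<close>

lemma dft_l1_bound:
  fixes h :: "nat \<Rightarrow> real"
  assumes m: "m > 0" and per: "h (2 * m) = h 0"
    and A: "\<And>n. n < 2 * m \<Longrightarrow> \<bar>h n\<bar> \<le> A" and D: "\<And>n. n < 2 * m \<Longrightarrow> \<bar>h (Suc n) - h n\<bar> \<le> D"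
  shows "(\<Sum>l<2*m. norm (\<Sum>n<2*m. of_real (h n) * cis (2 * pi * real l * real n / real (2*m))))
    \<le> 2 * real (2 * m) * (A + real m * D)"
proof -
  define L where "L = 2 * m"
  have L: "L > 0" using m by (simp add: L_def)
  define K where "K l = (\<Sum>n<L. of_real (h n) * cis (2 * pi * real l * real n / real L))" for l
  define d where "d l = norm (cis (- (2 * pi * real l / real L)) - 1)" for l :: nat
  define W where "W l = 1 + (real m)\<^sup>2 * (d l)\<^sup>2" for l
  have A0: "A \<ge> 0" and D0: "D \<ge> 0" using A[of 0] D[of 0] m by auto
  have W1: "W l \<ge> 1" for l by (simp add: W_def)
  have K1: "(\<Sum>l<L. (norm (K l))\<^sup>2) \<le> real L * (real L * A\<^sup>2)"
  proof -
    have "(\<Sum>n<L. (h n)\<^sup>2) \<le> (\<Sum>n<L. A\<^sup>2)"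
      using A by (intro sum_mono) (metis L_def A0 abs_le_square_iff abs_of_nonneg lessThan_iff)
    then show ?thesis unfolding K_def dft_parseval by (intro mult_left_mono) auto
  qed
  have K2: "(\<Sum>l<L. (d l)\<^sup>2 * (norm (K l))\<^sup>2) \<le> real L * (real L * D\<^sup>2)"
  proof -
    have "(d l)\<^sup>2 * (norm (K l))\<^sup>2 = (norm (\<Sum>n<L. of_real (h (Suc n) - h n) * cis (2 * pi * real l * real n / real L)))\<^sup>2" for l
      using dft_difference[of h L l] per unfolding K_def d_def L_def[symmetric]
      by (simp only: norm_mult power_mult_distrib)
    then have "(\<Sum>l<L. (d l)\<^sup>2 * (norm (K l))\<^sup>2) = real L * (\<Sum>n<L. (h (Suc n) - h n)\<^sup>2)"
      using dft_parseval[where h="\<lambda>n. h (Suc n) - h n" and L=L] by simp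
    also have "(\<Sum>n<L. (h (Suc n) - h n)\<^sup>2) \<le> (\<Sum>n<L. D\<^sup>2)"
      using D by (intro sum_mono) (metis L_def D0 abs_le_square_iff abs_of_nonneg lessThan_iff)
    finally show ?thesis by (simp add: mult_left_mono)
  qed
  \<comment> \<open>At node l the weight is at least 1 + 4 min(l, L - l)^2. Replacing the minimum by
    the sum over both alternatives leaves two one-sided series, each at most 3/2 for every
    L.\<close>
  have Wsum: "(\<Sum>l<L. 1 / W l) \<le> 3"
  proof -
    have "1 / W l \<le> 1 / (1 + 4 * (real l)\<^sup>2) + 1 / (1 + 4 * (real (L - l))\<^sup>2)" if l: "l < L" for l
    proof -
      have dl: "d l = norm (cis (2 * pi * real l / real (2*m)) - 1)"
        by (metis cis_cnj complex_cnj_diff complex_cnj_one complex_mod_cnj d_def L_def)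
      have "2 * min (real l) (real (L - l)) / real m \<le> d l"
        using norm_cis_minus_one_ge[of l m] l unfolding dl by (simp add: L_def of_nat_diff)
      then have "2 * min (real l) (real (L - l)) \<le> real m * d l" using m by (simp add: field_simps)
      then have "(2 * min (real l) (real (L - l)))\<^sup>2 \<le> (real m * d l)\<^sup>2" by (intro power_mono) auto
      then have "1 + 4 * (min (real l) (real (L - l)))\<^sup>2 \<le> W l"
        by (simp add: W_def power_mult_distrib)
      then have "1 / W l \<le> 1 / (1 + 4 * (min (real l) (real (L - l)))\<^sup>2)"
        using W1[of l] by (intro divide_left_mono mult_pos_pos) (auto simp: add_pos_nonneg)
      also have "\<dots> \<le> 1 / (1 + 4 * (real l)\<^sup>2) + 1 / (1 + 4 * (real (L - l))\<^sup>2)"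
        by (simp add: min_def)
      finally show ?thesis .
    qed
    then have "(\<Sum>l<L. 1 / W l) \<le> (\<Sum>l<L. 1 / (1 + 4 * (real l)\<^sup>2)) + (\<Sum>l<L. 1 / (1 + 4 * (real (L - l))\<^sup>2))"
      by (subst sum.distrib[symmetric]) (intro sum_mono, simp)
    also have "(\<Sum>l<L. 1 / (1 + 4 * (real (L - l))\<^sup>2)) \<le> 3/2"
    proof -
      have "(\<Sum>l<L. 1 / (1 + 4 * (real (L - l))\<^sup>2)) = (\<Sum>l<L. 1 / (1 + 4 * (real (Suc l))\<^sup>2))"
        by (subst sum.nat_diff_reindex[symmetric]) (auto intro!: sum.cong simp: of_nat_diff)
      also have "\<dots> \<le> (\<Sum>l<Suc L. 1 / (1 + 4 * (real l)\<^sup>2))"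
        by (subst sum.lessThan_Suc_shift) simp
      also have "\<dots> \<le> 3/2" using sum_inverse_quadratic_le[of L] unfolding lessThan_Suc_atMost
        by (rule order_trans) simp
      finally show ?thesis .
    qed
    also have "(\<Sum>l<L. 1 / (1 + 4 * (real l)\<^sup>2)) \<le> (\<Sum>l\<le>L. 1 / (1 + 4 * (real l)\<^sup>2))"
      by (intro sum_mono2) auto
    also have "\<dots> \<le> 3/2" using sum_inverse_quadratic_le[of L] by (rule order_trans) simp
    finally show ?thesis by simp
  qed
  have "(\<Sum>l<L. norm (K l)) = (\<Sum>l<L. (norm (K l) * sqrt (W l)) * (1 / sqrt (W l)))"
  proof (intro sum.cong refl)
    fix l have "sqrt (W l) \<noteq> 0" using W1[of l] by auto
    then show "norm (K l) = norm (K l) * sqrt (W l) * (1 / sqrt (W l))" by simp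
  qed
  then have "(\<Sum>l<L. norm (K l))\<^sup>2 \<le> (\<Sum>l<L. (norm (K l) * sqrt (W l))\<^sup>2) * (\<Sum>l<L. (1 / sqrt (W l))\<^sup>2)"
    using Cauchy_Schwarz_ineq_sum by metis
  also have "(\<Sum>l<L. (1 / sqrt (W l))\<^sup>2) = (\<Sum>l<L. 1 / W l)"
    using W1 by (intro sum.cong refl) (simp add: power_divide order_trans[OF zero_le_one])
  also have "(\<Sum>l<L. (norm (K l) * sqrt (W l))\<^sup>2) = (\<Sum>l<L. (norm (K l))\<^sup>2) + (real m)\<^sup>2 * (\<Sum>l<L. (d l)\<^sup>2 * (norm (K l))\<^sup>2)"
  proof -
    have "(norm (K l) * sqrt (W l))\<^sup>2 = (norm (K l))\<^sup>2 + (real m)\<^sup>2 * ((d l)\<^sup>2 * (norm (K l))\<^sup>2)" for l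
      using W1[of l] by (simp add: power_mult_distrib) (simp add: W_def algebra_simps)
    then show ?thesis by (simp add: sum.distrib sum_distrib_left)
  qed
  also have "\<dots> * (\<Sum>l<L. 1 / W l) \<le> (real L * (real L * A\<^sup>2) + (real m)\<^sup>2 * (real L * (real L * D\<^sup>2))) * 3"
  proof (rule mult_mono)
    show "(\<Sum>l<L. (norm (K l))\<^sup>2) + (real m)\<^sup>2 * (\<Sum>l<L. (d l)\<^sup>2 * (norm (K l))\<^sup>2)
      \<le> real L * (real L * A\<^sup>2) + (real m)\<^sup>2 * (real L * (real L * D\<^sup>2))"
      by (intro add_mono K1 mult_left_mono K2) auto
    show "0 \<le> (\<Sum>l<L. 1 / W l)" using W1 by (intro sum_nonneg) (metis divide_nonneg_nonneg order_trans zero_le_one)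
  qed (use Wsum in auto)
  also have "\<dots> = 3 * (real L)\<^sup>2 * (A\<^sup>2 + (real m)\<^sup>2 * D\<^sup>2)" by (simp add: algebra_simps power2_eq_square)
  also have "\<dots> \<le> (2 * real L * (A + real m * D))\<^sup>2"
  proof -
    have "0 \<le> A * (real m * D)" using A0 D0 by simp
    then have "A\<^sup>2 + (real m)\<^sup>2 * D\<^sup>2 \<le> (A + real m * D)\<^sup>2" by (simp add: power2_eq_square algebra_simps)
    then have "3 * (real L)\<^sup>2 * (A\<^sup>2 + (real m)\<^sup>2 * D\<^sup>2) \<le> 4 * (real L)\<^sup>2 * (A + real m * D)\<^sup>2"
      by (intro mult_mono) auto
    then show ?thesis by (simp add: power_mult_distrib)
  qed
  finally have "(\<Sum>l<L. norm (K l)) \<le> 2 * real L * (A + real m * D)"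
    by (rule power2_le_imp_le) (use A0 D0 in auto)
  then show ?thesis unfolding K_def L_def .
qed

text \<open>The multiplied polynomial is a weighted average of the original one over 2m rotations of
  z, with the transform of the multiplier as weights; only the normalised sum of their absolute
  values enters. There is no aliasing, as the degree m lies below the period 2m.\<close>

lemma multiplier_bound:
  fixes h :: "nat \<Rightarrow> real" and b :: "nat \<Rightarrow> complex" and z :: complex
  assumes m: "m > 0"
    and A: "\<And>n. n \<le> m \<Longrightarrow> \<bar>h n\<bar> \<le> A" and D: "\<And>n. n < m \<Longrightarrow> \<bar>h (Suc n) - h n\<bar> \<le> D"
    and M: "\<And>u. norm u = norm z \<Longrightarrow> norm (\<Sum>n\<le>m. b n * u ^ n) \<le> M"
  shows "norm (\<Sum>n\<le>m. of_real (h n) * b n * z ^ n) \<le> 2 * (A + real m * D) * M"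
proof -
  \<comment> \<open>Reflecting \<open>h\<close> makes it periodic with period \<open>2 m\<close> without increasing its increments.\<close>
  define H where "H n = h (if n \<le> m then n else 2 * m - n)" for n
  define L where "L = 2 * m"
  have L: "L > 0" using m by (simp add: L_def)
  let ?e = "\<lambda>l n. cis (2 * pi * real l * real n / real L)"
  define K where "K l = (\<Sum>n<L. of_real (H n) * ?e l n)" for l
  have M0: "M \<ge> 0" using M[of z] norm_ge_zero order_trans by blast
  have Kb: "(\<Sum>l<L. norm (K l)) \<le> 2 * real L * (A + real m * D)"
    unfolding K_def L_def
  proof (rule dft_l1_bound[OF m])
    show "\<bar>H (Suc n) - H n\<bar> \<le> D" if "n < 2 * m" for n
    proof (cases "n < m")
      case False
      then have "H (Suc n) = h (2 * m - Suc n)" "H n = h (Suc (2 * m - Suc n))"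
        using that by (auto simp: H_def Suc_diff_Suc intro!: arg_cong[where f=h])
      then show ?thesis using D[of "2 * m - Suc n"] False that by (simp add: abs_minus_commute)
    qed (use D in \<open>auto simp: H_def\<close>)
  qed (use A in \<open>auto simp: H_def\<close>)
  have "(\<Sum>l<L. K l * (\<Sum>i\<le>m. b i * (z * cis (- (2 * pi * real l / real L))) ^ i))
    = of_nat L * (\<Sum>n\<le>m. of_real (h n) * b n * z ^ n)"
  proof -
    have "(\<Sum>l<L. K l * (\<Sum>i\<le>m. b i * (z * cis (- (2 * pi * real l / real L))) ^ i))
      = (\<Sum>l<L. \<Sum>n<L. \<Sum>i\<le>m. of_real (H n) * b i * z ^ i * (?e l n * cis (- (2 * pi * real l * real i / real L))))"
      unfolding K_def sum_product
    proof (intro sum.cong refl)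
      fix l i n :: nat
      have "cis (- (2 * pi * real l / real L)) ^ i = cis (- (2 * pi * real l * real i / real L))"
        unfolding Complex.DeMoivre by (rule arg_cong[where f=cis]) simp
      then show "complex_of_real (H n) * ?e l n * (b i * (z * cis (- (2 * pi * real l / real L))) ^ i)
        = of_real (H n) * b i * z ^ i * (?e l n * cis (- (2 * pi * real l * real i / real L)))"
        by (simp only: power_mult_distrib mult_ac)
    qed
    also have "\<dots> = (\<Sum>n<L. \<Sum>l<L. \<Sum>i\<le>m. of_real (H n) * b i * z ^ i * (?e l n * cis (- (2 * pi * real l * real i / real L))))"
      by (rule sum.swap)
    also have "\<dots> = (\<Sum>n<L. \<Sum>i\<le>m. \<Sum>l<L. of_real (H n) * b i * z ^ i * (?e l n * cis (- (2 * pi * real l * real i / real L))))"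
      by (intro sum.cong refl sum.swap)
    also have "\<dots> = (\<Sum>n<L. \<Sum>i\<le>m. of_real (H n) * b i * z ^ i * (if i = n then of_nat L else 0))"
      unfolding sum_distrib_left[symmetric]
      by (intro sum.cong refl, subst dft_orthogonality) (use m in \<open>auto simp: L_def\<close>)
    also have "\<dots> = (\<Sum>i\<le>m. \<Sum>n<L. of_real (H n) * b i * z ^ i * (if i = n then of_nat L else 0))"
      by (rule sum.swap)
    also have "\<dots> = (\<Sum>i\<le>m. of_nat L * (of_real (h i) * b i * z ^ i))"
    proof (intro sum.cong refl)
      fix i assume i: "i \<in> {..m}"
      have "(\<Sum>n<L. of_real (H n) * b i * z ^ i * (if i = n then of_nat L else 0))
        = (\<Sum>n<L. if i = n then of_real (H n) * b i * z ^ i * of_nat L else 0)"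
        by (intro sum.cong) auto
      also have "\<dots> = of_real (H i) * b i * z ^ i * of_nat L"
        using i m by (simp add: L_def)
      finally show "(\<Sum>n<L. of_real (H n) * b i * z ^ i * (if i = n then of_nat L else 0))
        = of_nat L * (of_real (h i) * b i * z ^ i)" using i by (simp add: H_def mult_ac)
    qed
    finally show ?thesis by (simp add: sum_distrib_left)
  qed
  then have "real L * norm (\<Sum>n\<le>m. of_real (h n) * b n * z ^ n)
    = norm (\<Sum>l<L. K l * (\<Sum>i\<le>m. b i * (z * cis (- (2 * pi * real l / real L))) ^ i))"
    by (simp add: norm_mult)
  also have "\<dots> \<le> (\<Sum>l<L. norm (K l) * M)"
    by (rule sum_norm_le) (auto simp: norm_mult intro!: mult_left_mono M)
  also have "\<dots> = (\<Sum>l<L. norm (K l)) * M" by (simp add: sum_distrib_right)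
  also have "\<dots> \<le> 2 * real L * (A + real m * D) * M" by (intro mult_right_mono Kb M0)
  finally have "real L * norm (\<Sum>n\<le>m. of_real (h n) * b n * z ^ n) \<le> real L * (2 * (A + real m * D) * M)"
    by (simp add: mult_ac)
  then show ?thesis using L by simp
qed

section \<open>The Djrbashian--Gelfond--Leontiev operator on power series\<close>

text \<open>Log-convexity between x and x + 1, where the value at x + 1 is x Gamma(x).\<close>

lemma Gamma_add_le:
  fixes x s :: real
  assumes "x > 0" "0 \<le> s" "s \<le> 1"
  shows "Gamma (x + s) \<le> x powr s * Gamma x"
proof -
  have "(ln \<circ> Gamma) ((1 - s) *\<^sub>R x + s *\<^sub>R (x + 1)) \<le> (1 - s) * (ln \<circ> Gamma) x + s * (ln \<circ> Gamma) (x + 1)"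
    by (rule convex_onD[OF log_convex_Gamma_real]) (use assms in auto)
  moreover have "(1 - s) *\<^sub>R x + s *\<^sub>R (x + 1) = x + s" by (simp add: algebra_simps)
  moreover have "Gamma (x + 1) = x * Gamma x" using assms by (intro Gamma_plus1) (auto elim!: nonpos_Ints_cases')
  ultimately have "ln (Gamma (x + s)) \<le> ln (Gamma x) + s * ln x"
    using assms Gamma_real_pos[of x] less_imp_neq[OF Gamma_real_pos[of x]] by (simp add: ln_mult algebra_simps)
  also have "\<dots> = ln (x powr s * Gamma x)"
    using assms less_imp_neq[OF Gamma_real_pos[of x]] by (simp add: ln_mult ln_powr)
  finally show ?thesis using assms by (subst (asm) ln_le_cancel_iff) auto
qed

text \<open>For a in [0,1) the quotient is squeezed by two uses of \<open>Gamma_add_le\<close>: one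
  from x to x + a, and one from x + a by the complementary step 1 - a to x + 1, where the functional
  equation applies. The integer part of a is then added by induction, each unit contributing a
  factor 1 + O(1/x).\<close>

lemma Gamma_ratio_asymp:
  fixes a :: real
  assumes "a \<ge> 0"
  shows "\<exists>C. \<forall>x\<ge>1. \<bar>Gamma (x + a) / (Gamma x * x powr a) - 1\<bar> \<le> C / x"
proof -
  have "\<exists>C. \<forall>x\<ge>1. \<bar>Gamma (x + (s + real k)) / (Gamma x * x powr (s + real k)) - 1\<bar> \<le> C / x"
    if s: "0 \<le> s" "s < 1" for s k
  proof (induction k)
    case 0
    show ?case
    proof (intro exI[of _ 1] allI impI)
      fix x :: real assume x: "x \<ge> 1"
      have le: "Gamma (x + s) \<le> x powr s * Gamma x" using x s by (intro Gamma_add_le) auto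
      have "x * Gamma x = Gamma (x + 1)"
        using x by (intro Gamma_plus1[symmetric]) (auto elim!: nonpos_Ints_cases')
      also have "\<dots> = Gamma ((x + s) + (1 - s))" by simp
      also have "\<dots> \<le> (x + s) powr (1 - s) * Gamma (x + s)" using x s by (intro Gamma_add_le) auto
      finally have "x * Gamma x / ((x + s) powr (1 - s) * (Gamma x * x powr s)) \<le> Gamma (x + s) / (Gamma x * x powr s)"
        using x s by (simp add: field_simps)
      moreover have "x * Gamma x / ((x + s) powr (1 - s) * (Gamma x * x powr s)) = (x / (x + s)) powr (1 - s)"
      proof -
        have "x powr (1 - s) = x / x powr s" using x by (simp add: powr_diff)
        then show ?thesis using x s less_imp_neq[OF Gamma_real_pos[of x]] by (simp add: powr_divide)
      qed
      moreover have "(x / (x + s)) powr (1 - s) \<ge> (x / (x + s)) powr 1"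
        using x s by (intro powr_mono') auto
      moreover have "(x / (x + s)) powr 1 \<ge> 1 - 1 / x"
      proof -
        have "s * x \<le> 1 * x" using x s by (intro mult_right_mono) auto
        then have "s * x \<le> s + x" using s by linarith
        then show ?thesis using x s by (simp add: field_simps)
      qed
      moreover have "Gamma (x + s) / (Gamma x * x powr s) \<le> 1"
        using le x Gamma_real_pos[of x] by (simp add: field_simps)
      ultimately show "\<bar>Gamma (x + (s + real 0)) / (Gamma x * x powr (s + real 0)) - 1\<bar> \<le> 1 / x"
        by (simp only: of_nat_0 add_0_right)
    qed
  next
    case (Suc k)
    then obtain C where C: "\<And>x. x \<ge> 1 \<Longrightarrow> \<bar>Gamma (x + (s + real k)) / (Gamma x * x powr (s + real k)) - 1\<bar> \<le> C / x"
      by blast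
    define a where "a = s + real k"
    have a0: "a \<ge> 0" using s by (simp add: a_def)
    show ?case
    proof (intro exI[of _ "a + (1 + a) * C"] allI impI)
      fix x :: real assume x: "x \<ge> 1"
      define e where "e = Gamma (x + a) / (Gamma x * x powr a) - 1"
      have e: "\<bar>e\<bar> \<le> C / x" using C[OF x] by (simp add: e_def a_def)
      have "Gamma (x + (s + real (Suc k))) = Gamma ((x + a) + 1)" by (simp add: a_def algebra_simps)
      also have "\<dots> = (x + a) * Gamma (x + a)"
        using x a0 by (intro Gamma_plus1) (auto elim!: nonpos_Ints_cases')
      finally have "Gamma (x + (s + real (Suc k))) / (Gamma x * x powr (s + real (Suc k))) = (1 + a / x) * (1 + e)"
        using x Gamma_real_pos[of x] by (simp add: e_def a_def powr_add field_simps)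
      then have "\<bar>Gamma (x + (s + real (Suc k))) / (Gamma x * x powr (s + real (Suc k))) - 1\<bar> = \<bar>a / x + (1 + a / x) * e\<bar>"
        by (simp only:) (simp only: ring_distribs mult_1_left mult_1_right add_diff_cancel_left' add.assoc)
      also have "\<dots> \<le> a / x + (1 + a / x) * \<bar>e\<bar>"
        using a0 x by (simp add: abs_mult order_trans[OF abs_triangle_ineq])
      also have "\<dots> \<le> a / x + (1 + a) * (C / x)"
      proof (intro add_mono mult_mono order_refl)
        show "a / x \<le> a" using a0 x mult_left_mono[of 1 x a] by (simp add: field_simps)
      qed (use a0 e in auto)
      finally show "\<bar>Gamma (x + (s + real (Suc k))) / (Gamma x * x powr (s + real (Suc k))) - 1\<bar> \<le> (a + (1 + a) * C) / x"
        by (simp add: add_divide_distrib)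
    qed
  qed
  from this[of "frac a" "nat \<lfloor>a\<rfloor>"] assms show ?thesis
    using frac_lt_1[of a] by (simp add: frac_def)
qed

text \<open>With the value 0 for n < j, multiplying the j-th iterate by z^j gives a diagonal
  operator on power series: the n-th coefficient is multiplied by this factor and no index is
  shifted.\<close>

definition dgl_factor :: "real \<Rightarrow> nat \<Rightarrow> nat \<Rightarrow> real" where
  "dgl_factor \<alpha> j n = (if n < j then 0 else Gamma (real n * \<alpha> + 1) / Gamma ((real n - real j) * \<alpha> + 1))"

lemma dgl_factor_nonneg: "\<alpha> > 0 \<Longrightarrow> dgl_factor \<alpha> j n \<ge> 0"
  by (auto simp: dgl_factor_def intro!: divide_nonneg_nonneg less_imp_le[OF Gamma_real_pos] add_nonneg_pos)

context
  fixes \<alpha> :: real and j :: nat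
  assumes alpha: "\<alpha> > 0" and j: "j \<ge> 1"
begin

lemma dgl_factor_asymp:
  "(\<lambda>n. dgl_factor \<alpha> j n - (real n * \<alpha>) powr (real j * \<alpha>)) \<in> O(\<lambda>n. real n powr (real j * \<alpha> - 1))"
proof -
  define \<beta> where "\<beta> = real j * \<alpha>"
  \<comment> \<open>In this variable the factor is exactly Gamma(x + \<beta>) / Gamma(x). Moving the
    base point of the power from x to n \<alpha> costs another O(n^(\<beta> - 1)).\<close>
  define x where "x n = (real n - real j) * \<alpha> + 1" for n
  have \<beta>: "\<beta> > 0" using alpha j by (simp add: \<beta>_def)
  obtain C where C: "\<And>x. x \<ge> 1 \<Longrightarrow> \<bar>Gamma (x + \<beta>) / (Gamma x * x powr \<beta>) - 1\<bar> \<le> C / x"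
    using Gamma_ratio_asymp[of \<beta>] \<beta> by auto
  have 1: "(\<lambda>n. dgl_factor \<alpha> j n - x n powr \<beta>) \<in> O(\<lambda>n. x n powr (\<beta> - 1))"
  proof (rule bigoI[where c=C])
    show "\<forall>\<^sub>F n in sequentially. norm (dgl_factor \<alpha> j n - x n powr \<beta>) \<le> C * norm (x n powr (\<beta> - 1))"
      using eventually_ge_at_top[of j]
    proof eventually_elim
      case (elim n)
      have x1: "x n \<ge> 1" using elim alpha by (simp add: x_def)
      have "dgl_factor \<alpha> j n = Gamma (x n + \<beta>) / Gamma (x n)"
        using elim by (simp add: dgl_factor_def x_def \<beta>_def algebra_simps)
      then have "dgl_factor \<alpha> j n - x n powr \<beta> = x n powr \<beta> * (Gamma (x n + \<beta>) / (Gamma (x n) * x n powr \<beta>) - 1)"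
        using x1 by (simp add: field_simps)
      then have "\<bar>dgl_factor \<alpha> j n - x n powr \<beta>\<bar> \<le> x n powr \<beta> * (C / x n)"
        using C[OF x1] by (simp only: abs_mult abs_of_nonneg[OF powr_ge_zero]) (intro mult_left_mono, auto)
      also have "\<dots> = C * x n powr (\<beta> - 1)" using x1 by (simp add: powr_diff)
      finally show ?case by simp
    qed
  qed
  have 2: "(\<lambda>n. x n powr (\<beta> - 1)) \<in> O(\<lambda>n. real n powr (\<beta> - 1))"
    unfolding x_def using alpha \<beta> by real_asymp
  have 3: "(\<lambda>n. x n powr \<beta> - (real n * \<alpha>) powr \<beta>) \<in> O(\<lambda>n. real n powr (\<beta> - 1))"
    unfolding x_def using alpha \<beta> by real_asymp
  show ?thesis
    using sum_in_bigo(1)[OF landau_o.big_trans[OF 1 2] 3] by (simp add: \<beta>_def)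
qed

lemma dgl_factor_bigo: "dgl_factor \<alpha> j \<in> O(\<lambda>n. real n powr (real j * \<alpha>))"
proof -
  have "(\<lambda>n. (real n * \<alpha>) powr (real j * \<alpha>)) \<in> O(\<lambda>n. real n powr (real j * \<alpha>))"
    using alpha by (simp add: powr_mult)
  moreover have "(\<lambda>n. real n powr (real j * \<alpha> - 1)) \<in> O(\<lambda>n. real n powr (real j * \<alpha>))"
    by real_asymp
  ultimately show ?thesis
    using sum_in_bigo(1)[OF landau_o.big_trans[OF dgl_factor_asymp]] by fastforce
qed

text \<open>No finer expansion of Gamma is required: the error of \<open>dgl_factor_asymp\<close>,
  taken at n and at n + 1, already has the order of the increment of the power.\<close>

lemma dgl_factor_diff:
  "(\<lambda>n. dgl_factor \<alpha> j (Suc n) - dgl_factor \<alpha> j n) \<in> O(\<lambda>n. real n powr (real j * \<alpha> - 1))"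
proof -
  let ?p = "\<lambda>n. (real n * \<alpha>) powr (real j * \<alpha>)"
  have "(\<lambda>n. dgl_factor \<alpha> j (Suc n) - ?p (Suc n)) \<in> O(\<lambda>n. real (Suc n) powr (real j * \<alpha> - 1))"
    using landau_o.big.compose[OF dgl_factor_asymp filterlim_Suc] by simp
  moreover have "(\<lambda>n. real (Suc n) powr (real j * \<alpha> - 1)) \<in> O(\<lambda>n. real n powr (real j * \<alpha> - 1))"
    by real_asymp
  ultimately have 1: "(\<lambda>n. dgl_factor \<alpha> j (Suc n) - ?p (Suc n)) \<in> O(\<lambda>n. real n powr (real j * \<alpha> - 1))"
    by (rule landau_o.big_trans)
  have "real j * \<alpha> > 0" using alpha j by simp
  then have 2: "(\<lambda>n. ?p (Suc n) - ?p n) \<in> O(\<lambda>n. real n powr (real j * \<alpha> - 1))"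
    using alpha by real_asymp
  from sum_in_bigo(1)[OF sum_in_bigo(2)[OF 1 dgl_factor_asymp] 2] show ?thesis by (simp add: algebra_simps)
qed

end

section \<open>Power series of the iterated operator\<close>

lemma sums_taylor_coeff:
  assumes "f holomorphic_on UNIV"
  shows "(\<lambda>n. taylor_coeff f n * z ^ n) sums f z"
proof -
  have "f holomorphic_on ball 0 (norm z + 1)" using assms holomorphic_on_subset by blast
  then show ?thesis
    using holomorphic_power_series[of f 0 "norm z + 1" z] by (simp add: taylor_coeff_def fps_expansion_def)
qed

text \<open>The operator reads the Taylor coefficients of its argument, so iterating it requires
  recovering them from the power series of the previous iterate.\<close>

lemma taylor_coeff_sums:
  assumes "\<And>z. (\<lambda>n. c n * z ^ n) sums g z"
  shows "taylor_coeff g n = c n"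
proof -
  define F where "F = Abs_fps c"
  have "fps_conv_radius F = \<infinity>"
    unfolding fps_conv_radius_def F_def
    by (rule conv_radius_inftyI'') (use assms in \<open>auto simp: sums_iff\<close>)
  then have "eval_fps F has_fps_expansion F" by (intro eval_fps_has_fps_expansion) auto
  moreover have "eval_fps F = g" using assms by (auto simp: eval_fps_def F_def sums_iff)
  ultimately show ?thesis by (simp add: taylor_coeff_def fps_expansion_eqI F_def)
qed

lemma summable_norm_power_series:
  fixes c :: "nat \<Rightarrow> complex"
  assumes "\<And>z. summable (\<lambda>n. c n * z ^ n)" "r \<ge> 0"
  shows "summable (\<lambda>n. norm (c n) * r ^ n)"
proof -
  have "summable (\<lambda>n. norm (c n * of_real r ^ n))"
    by (rule powser_insidea[of _ "of_real (r + 1)"]) (use assms in auto)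
  then show ?thesis using assms(2) by (simp add: norm_mult norm_power)
qed

text \<open>The multiplier grows polynomially and is absorbed by doubling the radius, where the
  series of an entire function still converges absolutely.\<close>

lemma summable_dgl_series:
  fixes c :: "nat \<Rightarrow> complex"
  assumes "\<alpha> > 0" "j \<ge> 1" "\<And>z. summable (\<lambda>n. c n * z ^ n)" "r \<ge> 0"
  shows "summable (\<lambda>n. norm (c n) * dgl_factor \<alpha> j n * r ^ n)"
proof (rule summable_comparison_test_bigo)
  show "summable (\<lambda>n. norm (norm (c n) * (2 * r) ^ n))"
    using summable_norm_power_series[OF assms(3), of "2 * r"] assms(4) by (simp add: abs_mult)
  have "(\<lambda>n::nat. real n powr (real j * \<alpha>)) \<in> O(\<lambda>n. 2 ^ n)" by real_asymp
  then have "dgl_factor \<alpha> j \<in> O(\<lambda>n. 2 ^ n)"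
    using dgl_factor_bigo[OF assms(1,2)] landau_o.big_trans by blast
  then have "(\<lambda>n. (norm (c n) * r ^ n) * dgl_factor \<alpha> j n) \<in> O(\<lambda>n. (norm (c n) * r ^ n) * 2 ^ n)"
    by (intro landau_o.big.mult) auto
  then show "(\<lambda>n. norm (c n) * dgl_factor \<alpha> j n * r ^ n) \<in> O(\<lambda>n. norm (c n) * (2 * r) ^ n)"
    by (simp add: power_mult_distrib mult_ac)
qed

lemma sums_dgl_op_iterate:
  assumes alpha: "\<alpha> > 0" and f: "\<And>z. (\<lambda>n. c n * z ^ n) sums f z"
  shows "(\<lambda>n. c (n + j) * of_real (dgl_factor \<alpha> j (n + j)) * z ^ n) sums (dgl_op \<alpha> ^^ j) f z"
proof (induction j arbitrary: z)
  case 0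
  have "dgl_factor \<alpha> 0 n = 1" for n
    using alpha less_imp_neq[OF Gamma_real_pos[of "real n * \<alpha> + 1"]] by (simp add: dgl_factor_def add_nonneg_pos)
  then show ?case using f by simp
next
  case (Suc j)
  define d where "d n = c (n + j) * of_real (dgl_factor \<alpha> j (n + j))" for n
  have d: "(\<lambda>n. d n * z ^ n) sums (dgl_op \<alpha> ^^ j) f z" for z using Suc by (simp add: d_def)
  \<comment> \<open>The quotients telescope: Gamma((n+1)\<alpha> + 1) is the denominator of the
    first factor and the numerator of the second.\<close>
  have fac: "dgl_factor \<alpha> j (Suc n + j) * dgl_factor \<alpha> 1 (Suc n) = dgl_factor \<alpha> (Suc j) (n + Suc j)" for n
  proof -
    have "Gamma (real (Suc n) * \<alpha> + 1) \<noteq> 0"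
      using alpha less_imp_neq[OF Gamma_real_pos[of "real (Suc n) * \<alpha> + 1"]] by (simp add: add_nonneg_pos)
    then show ?thesis by (simp add: dgl_factor_def algebra_simps)
  qed
  have eq: "taylor_coeff ((dgl_op \<alpha> ^^ j) f) (Suc n) * of_real (Gamma (real (Suc n) * \<alpha> + 1) / Gamma (real (Suc n) * \<alpha> + 1 - \<alpha>))
      = c (n + Suc j) * of_real (dgl_factor \<alpha> (Suc j) (n + Suc j))" for n
  proof -
    have "Gamma (real (Suc n) * \<alpha> + 1) / Gamma (real (Suc n) * \<alpha> + 1 - \<alpha>) = dgl_factor \<alpha> 1 (Suc n)"
      by (simp add: dgl_factor_def algebra_simps)
    then show ?thesis
      unfolding taylor_coeff_sums[OF d] fac[symmetric] by (simp add: d_def mult.assoc)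
  qed
  have "summable (\<lambda>n. c (n + Suc j) * of_real (dgl_factor \<alpha> (Suc j) (n + Suc j)) * z ^ n)"
  proof (cases "z = 0")
    case False
    have "summable (\<lambda>n. norm (c n) * dgl_factor \<alpha> (Suc j) n * norm z ^ n)"
      using summable_dgl_series[of \<alpha> "Suc j" c "norm z"] alpha f by (auto simp: sums_iff)
    then have "summable (\<lambda>n. norm (c n * of_real (dgl_factor \<alpha> (Suc j) n) * z ^ n))"
      using dgl_factor_nonneg[OF alpha] by (simp add: norm_mult norm_power)
    then have "summable (\<lambda>n. c n * of_real (dgl_factor \<alpha> (Suc j) n) * z ^ n)" by (rule summable_norm_cancel)
    then have "summable (\<lambda>n. c (n + Suc j) * of_real (dgl_factor \<alpha> (Suc j) (n + Suc j)) * z ^ (n + Suc j))"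
      by (subst summable_iff_shift)
    then have "summable (\<lambda>n. c (n + Suc j) * of_real (dgl_factor \<alpha> (Suc j) (n + Suc j)) * z ^ (n + Suc j) / z ^ Suc j)"
      by (rule summable_divide)
    then show ?thesis using False by (simp add: power_add mult.assoc)
  qed (simp add: powser_zero)
  then have "(\<lambda>n. c (n + Suc j) * of_real (dgl_factor \<alpha> (Suc j) (n + Suc j)) * z ^ n) sums dgl_op \<alpha> ((dgl_op \<alpha> ^^ j) f) z"
    unfolding dgl_op_def eq by (rule summable_sums)
  then show ?case by simp
qed

lemma sums_dgl_op_iterate_shifted:
  assumes "\<alpha> > 0" and f: "\<And>z. (\<lambda>n. c n * z ^ n) sums f z"
  shows "(\<lambda>n. of_real (dgl_factor \<alpha> j n) * c n * z ^ n) sums (z ^ j * (dgl_op \<alpha> ^^ j) f z)"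
proof -
  have "(\<lambda>n. z ^ j * (c (n + j) * of_real (dgl_factor \<alpha> j (n + j)) * z ^ n)) sums (z ^ j * (dgl_op \<alpha> ^^ j) f z)"
    by (intro sums_mult sums_dgl_op_iterate assms)
  then have "(\<lambda>n. of_real (dgl_factor \<alpha> j (n + j)) * c (n + j) * z ^ (n + j)) sums (z ^ j * (dgl_op \<alpha> ^^ j) f z)"
    by (simp add: power_add mult_ac)
  then show ?thesis by (subst (asm) sums_zero_iff_shift) (auto simp: dgl_factor_def)
qed

section \<open>Normal radii\<close>

lemma eventually_power_dominates:
  fixes c :: "nat \<Rightarrow> real"
  assumes "c p > 0"
  shows "\<forall>\<^sub>F s in at_top. \<forall>k<p. c k * s ^ k < c p * s ^ p"
proof -
  have "\<forall>\<^sub>F s in at_top. \<forall>k\<in>{..<p}. c k * s ^ k < c p * s ^ p"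
  proof (intro eventually_ball_finite ballI)
    fix k assume k: "k \<in> {..<p}"
    show "\<forall>\<^sub>F s in at_top. c k * s ^ k < c p * s ^ p"
      using eventually_gt_at_top[of 1] eventually_gt_at_top[of "c k / c p"]
    proof eventually_elim
      case (elim s)
      have "c k < c p * s" using elim assms by (simp add: field_simps)
      then have "c k * s ^ k < c p * s * s ^ k" using elim by (intro mult_strict_right_mono) auto
      also have "\<dots> = c p * s ^ Suc k" by simp
      also have "\<dots> \<le> c p * s ^ p"
        using elim assms k by (intro mult_left_mono power_increasing) auto
      finally show ?case .
    qed
  qed auto
  then show ?thesis by eventually_elim auto
qed

lemma finite_log_measure_empty: "finite_log_measure {}"
  by (simp add: finite_log_measure_def)

lemma nn_integral_inverse_Icc:
  fixes p d :: real
  assumes "p \<ge> 0" "d \<ge> 0"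
  shows "(\<integral>\<^sup>+t. ennreal (1 / t) * indicator ({p..p * exp d} \<inter> {1..}) t \<partial>lebesgue) \<le> ennreal d"
proof (cases "p = 0")
  case True
  then have "{p..p * exp d} \<inter> {1..} = {}" by auto
  then show ?thesis by simp
next
  case False
  with assms have p: "p > 0" by simp
  have le: "p \<le> p * exp d" using assms mult_left_mono[of 1 "exp d" p] by simp
  have "(\<integral>\<^sup>+t. ennreal (1 / t) * indicator ({p..p * exp d} \<inter> {1..}) t \<partial>lebesgue)
      \<le> (\<integral>\<^sup>+t. ennreal (1 / t) * indicator {p..p * exp d} t \<partial>lebesgue)"
    by (intro nn_integral_mono mult_left_mono) (auto simp: indicator_def)
  also have "\<dots> = (\<integral>\<^sup>+t. ennreal (1 / t) * indicator {p..p * exp d} t \<partial>lborel)"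
    by (rule nn_integral_completion)
  also have "\<dots> = ennreal (ln (p * exp d) - ln p)"
  proof (rule nn_integral_FTC_Icc)
    show "(ln has_real_derivative 1 / t) (at t)" if "t \<in> {p..p * exp d}" for t
      using that p by (auto intro!: derivative_eq_intros)
  qed (use p le in auto)
  also have "ln (p * exp d) - ln p = d" using p by (simp add: ln_mult)
  finally show ?thesis .
qed

lemma finite_log_measure_UN:
  fixes p d :: "nat \<Rightarrow> real"
  assumes "\<And>n. p n \<ge> 0" "\<And>n. d n \<ge> 0" "summable d"
  shows "finite_log_measure (\<Union>n. {p n..p n * exp (d n)})"
proof -
  let ?I = "\<lambda>n. {p n..p n * exp (d n)}"
  have "(\<integral>\<^sup>+t. ennreal (1 / t) * indicator ((\<Union>n. ?I n) \<inter> {1..}) t \<partial>lebesgue)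
      \<le> (\<integral>\<^sup>+t. (\<Sum>n. ennreal (1 / t) * indicator (?I n \<inter> {1..}) t) \<partial>lebesgue)"
  proof (rule nn_integral_mono)
    fix t :: real
    show "ennreal (1 / t) * indicator ((\<Union>n. ?I n) \<inter> {1..}) t \<le> (\<Sum>n. ennreal (1 / t) * indicator (?I n \<inter> {1..}) t)"
    proof (cases "t \<in> (\<Union>n. ?I n) \<inter> {1..}")
      case True
      then obtain n where n: "t \<in> ?I n \<inter> {1..}" by auto
      have "ennreal (1 / t) = (\<Sum>k\<in>{n}. ennreal (1 / t) * indicator (?I k \<inter> {1..}) t)"
        using n by simp
      also have "\<dots> \<le> (\<Sum>n. ennreal (1 / t) * indicator (?I n \<inter> {1..}) t)"
        by (rule sum_le_suminf) auto
      finally show ?thesis using True by simp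
    next
      case False
      then have "indicator ((\<Union>n. ?I n) \<inter> {1..}) t = (0 :: ennreal)" by (rule indicator_simps(2))
      then show ?thesis by simp
    qed
  qed
  also have "\<dots> = (\<Sum>n. \<integral>\<^sup>+t. ennreal (1 / t) * indicator (?I n \<inter> {1..}) t \<partial>lebesgue)"
    by (rule nn_integral_suminf) (auto intro!: borel_measurable_times_ennreal measurable_completion)
  also have "\<dots> \<le> (\<Sum>n. ennreal (d n))"
    by (intro suminf_le nn_integral_inverse_Icc assms) auto
  also have "\<dots> < \<infinity>"
    using ennreal_suminf_neq_top[OF assms(3,2)] by (simp only: less_top infinity_ennreal_def)
  finally show ?thesis
    unfolding finite_log_measure_def using order_trans[OF assms(1)] by auto
qed

lemma exists_maximal_term:
  fixes b :: "nat \<Rightarrow> real"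
  assumes "(\<lambda>n. b n * s ^ n) \<longlonglongrightarrow> 0" "b p > 0" "s > 0"
  shows "\<exists>m. \<forall>k. b k * s ^ k \<le> b m * s ^ m" "finite {m. \<forall>k. b k * s ^ k \<le> b m * s ^ m}"
proof -
  let ?t = "\<lambda>n. b n * s ^ n"
  have pos: "?t p > 0" using assms by simp
  have "\<forall>\<^sub>F n in sequentially. ?t n < ?t p" using order_tendstoD(2)[OF assms(1) pos] .
  then obtain n0 where n0: "\<And>n. n \<ge> n0 \<Longrightarrow> ?t n < ?t p" by (auto simp: eventually_sequentially)
  obtain m where m: "m \<le> n0" "\<And>k. k \<le> n0 \<Longrightarrow> ?t k \<le> ?t m"
  proof -
    have "Max (?t ` {..n0}) \<in> ?t ` {..n0}" by (rule Max_in) auto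
    then obtain i where i: "i \<le> n0" "Max (?t ` {..n0}) = ?t i" by (elim imageE) auto
    have "?t k \<le> ?t i" if "k \<le> n0" for k
      unfolding i(2)[symmetric] using that by (intro Max_ge) auto
    then show ?thesis using i(1) by (intro that)
  qed
  have "p < n0" using n0[of p] by (meson less_irrefl not_le)
  then have "?t k \<le> ?t m" for k using m(2)[of k] m(2)[of p] n0[of k] by (cases "k \<le> n0") auto
  then show "\<exists>m. \<forall>k. ?t k \<le> ?t m" by blast
  show "finite {m. \<forall>k. ?t k \<le> ?t m}"
  proof (rule finite_subset)
    show "{m. \<forall>k. ?t k \<le> ?t m} \<subseteq> {..n0}"
    proof
      fix m assume "m \<in> {m. \<forall>k. ?t k \<le> ?t m}"
      then have "\<not> ?t m < ?t p" by (simp add: not_less)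
      then show "m \<in> {..n0}" using n0[of m] by (cases "m \<ge> n0") auto
    qed
  qed simp
qed

text \<open>For \<open>b n = |a n| exp (\<Sum>i\<le>n. l i)\<close> let \<open>t n\<close> be the radius from which on the maximal term of
  \<open>\<Sum>b n s^n\<close> can have index \<open>> n\<close>. A radius \<open>r\<close> is good as soon as \<open>r exp (- l N)\<close> has \<open>N\<close> as an
  index of its maximal term for some \<open>N\<close>; the radii missed by this are the intervals
  \<open>[t n exp (l n), t n exp (l (n+1))]\<close>, whose logarithmic lengths telescope.\<close>

lemma exists_normal_radii:
  fixes a :: "nat \<Rightarrow> complex" and l :: "nat \<Rightarrow> real"
  assumes ent: "\<And>r. r \<ge> 0 \<Longrightarrow> summable (\<lambda>n. norm (a n) * r ^ n)"
    and inf: "infinite {n. a n \<noteq> 0}"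
    and l: "incseq l" "\<And>n. l n \<le> S" "\<And>n. l n \<ge> 0"
  defines "A n \<equiv> \<Sum>i\<in>{0<..n}. l i"
  shows "\<exists>E. finite_log_measure E \<and> (\<forall>r>0. r \<notin> E \<longrightarrow> (\<exists>N. a N \<noteq> 0 \<and>
    (\<forall>n. norm (a n) * r ^ n \<le> norm (a N) * r ^ N * exp (- (A n - A N - (real n - real N) * l N)))))"
proof -
  define b where "b n = norm (a n) * exp (A n)" for n
  define Q where "Q s m \<longleftrightarrow> (\<forall>k. b k * s ^ k \<le> b m * s ^ m)" for s m
  define T where "T n = {s. s > 0 \<and> (\<exists>m>n. Q s m)}" for n
  define t where "t n = Inf (T n)" for n
  define E where "E = (\<Union>n. {t n * exp (l n)..t n * exp (l n) * exp (l (Suc n) - l n)})"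
  have b0: "b n \<ge> 0" for n by (simp add: b_def)
  have bpos: "\<exists>p>n. b p > 0" for n
  proof -
    obtain p where "p > n" "a p \<noteq> 0"
      using inf unfolding infinite_nat_iff_unbounded by auto
    then show ?thesis by (intro exI[of _ p]) (simp add: b_def)
  qed
  then obtain p0 where p0: "b p0 > 0" by blast
  have A_le: "A n \<le> real n * S" for n
  proof -
    have "A n \<le> (\<Sum>i\<in>{0<..n}. S)" unfolding A_def by (intro sum_mono l)
    then show ?thesis by simp
  qed
  \<comment> \<open>As the slopes \<open>l\<close> are bounded by S, passing from |a n| to
    \<open>b n\<close> is no worse than a dilation by exp S, so \<open>b\<close> still belongs to an
    entire function.\<close>
  have lim: "(\<lambda>n. b n * s ^ n) \<longlonglongrightarrow> 0" if "s > 0" for s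
  proof (rule tendsto_sandwich[OF _ _ tendsto_const])
    have "summable (\<lambda>n. norm (a n) * (exp S * s) ^ n)" using that by (intro ent) auto
    then show "(\<lambda>n. norm (a n) * (exp S * s) ^ n) \<longlonglongrightarrow> 0" by (rule summable_LIMSEQ_zero)
    have "b n * s ^ n \<le> norm (a n) * (exp S * s) ^ n" for n
      using A_le[of n] that
      by (auto simp: b_def power_mult_distrib exp_of_nat_mult[symmetric] mult.assoc intro!: mult_left_mono mult_right_mono)
    then show "\<forall>\<^sub>F n in sequentially. b n * s ^ n \<le> norm (a n) * (exp S * s) ^ n" by simp
    show "\<forall>\<^sub>F n in sequentially. 0 \<le> b n * s ^ n" using b0 that by simp
  qed
  have exQ: "\<exists>m. Q s m" and finQ: "finite {m. Q s m}" if "s > 0" for s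
    using exists_maximal_term[OF lim[OF that] p0 that] by (simp_all add: Q_def)
  \<comment> \<open>Enlarging the radius multiplies a term of higher index by at least as much as
    one of lower index, so a maximal index above n is never lost.\<close>
  have T_up: "s' \<in> T n" if s: "s \<in> T n" "s < s'" for s s' n
  proof -
    obtain m where m: "m > n" "Q s m" and s0: "s > 0" using s by (auto simp: T_def)
    obtain m' where m': "Q s' m'" using exQ[of s'] s s0 by auto
    show ?thesis
    proof (cases "m' > n")
      case False
      have "b m' * s' ^ m' = b m' * s ^ m' * (s' / s) ^ m'" using s0 by (simp add: power_divide)
      also have "\<dots> \<le> b m * s ^ m * (s' / s) ^ m'"
        using m(2) s s0 by (intro mult_right_mono) (auto simp: Q_def)
      also have "\<dots> \<le> b m * s ^ m * (s' / s) ^ m"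
        using False m s s0 b0[of m] by (intro mult_left_mono power_increasing) auto
      also have "\<dots> = b m * s' ^ m" using s0 by (simp add: power_divide)
      finally have "Q s' m" using m' unfolding Q_def by (meson order_trans)
      then show ?thesis using m s s0 by (auto simp: T_def)
    qed (use m' s s0 in \<open>auto simp: T_def\<close>)
  qed
  have T_ne: "T n \<noteq> {}" for n
  proof -
    obtain p where p: "p > n" "b p > 0" using bpos by blast
    have "\<forall>\<^sub>F s in at_top. s > 0 \<and> (\<forall>k<p. b k * s ^ k < b p * s ^ p)"
      by (intro eventually_conj eventually_gt_at_top eventually_power_dominates p)
    then obtain s where s: "s > 0" "\<And>k. k < p \<Longrightarrow> b k * s ^ k < b p * s ^ p"
      by (auto simp: eventually_at_top_linorder)
    obtain m where m: "Q s m" using exQ[OF s(1)] by blast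
    then have "b p * s ^ p \<le> b m * s ^ m" by (simp add: Q_def)
    then have "\<not> m < p" using s(2)[of m] by linarith
    then have "m > n" using p(1) by simp
    then have "s \<in> T n" unfolding T_def using m s(1) by blast
    then show ?thesis by blast
  qed
  have bdd: "bdd_below (T n)" for n by (rule bdd_belowI[of _ 0]) (auto simp: T_def)
  have t0: "t n \<ge> 0" for n
    unfolding t_def by (rule cInf_greatest[OF T_ne]) (simp add: T_def)
  have above: "s \<in> T n" if "s > t n" for s n
  proof -
    have "\<exists>s'\<in>T n. s' < s" using that unfolding t_def cInf_less_iff[OF T_ne bdd] .
    then obtain s' where "s' \<in> T n" "s' < s" by auto
    then show ?thesis by (rule T_up)
  qed
  have below: "m \<le> n" if "s < t n" "s > 0" "Q s m" for s n m
  proof (rule ccontr)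
    assume "\<not> m \<le> n"
    then have "m > n" by simp
    then have "s \<in> T n" unfolding T_def using that by blast
    then show False using cInf_lower[OF _ bdd, of s n] that(1) by (simp add: t_def)
  qed
  \<comment> \<open>Only finitely many indices are maximal at s = r + 1. With n the largest of them,
    s lies outside \<open>T n\<close>, which forces t n >= s > r.\<close>
  have t_unbounded: "\<exists>n. r < t n * exp (l n)" if "r > 0" for r
  proof -
    define s where "s = r + 1"
    have s: "s > 0" using that by (simp add: s_def)
    obtain n where n: "\<And>m. Q s m \<Longrightarrow> m \<le> n"
      using finQ[OF s] using Max_ge[OF finQ[OF s]] by (intro that[of "Max {m. Q s m}"]) auto
    then have "s \<notin> T n" by (simp add: T_def) (meson not_le)
    then have "s \<le> t n" using above[of n s] by (cases "s > t n") auto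
    also have "\<dots> \<le> t n * exp (l n)" using t0[of n] l(3)[of n] mult_left_mono[of 1 "exp (l n)" "t n"] by simp
    finally show ?thesis by (intro exI[of _ n]) (simp add: s_def)
  qed
  have "finite_log_measure E"
    unfolding E_def
  proof (rule finite_log_measure_UN)
    show "t n * exp (l n) \<ge> 0" for n using t0 by simp
    show "l (Suc n) - l n \<ge> 0" for n using l(1) by (simp add: incseq_SucD)
    obtain L where "l \<longlonglongrightarrow> L" using incseq_convergent[OF l(1)] l(2) by blast
    then show "summable (\<lambda>n. l (Suc n) - l n)" by (rule telescope_summable)
  qed
  moreover have "\<exists>N. a N \<noteq> 0 \<and>
    (\<forall>n. norm (a n) * r ^ n \<le> norm (a N) * r ^ N * exp (- (A n - A N - (real n - real N) * l N)))"
    if r: "r > 0" "r \<notin> E" for r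
  proof -
    define n where "n = (LEAST n. r < t n * exp (l n))"
    have n: "r < t n * exp (l n)" unfolding n_def using t_unbounded[OF r(1)] by (rule LeastI_ex)
    define s where "s = r * exp (- l n)"
    have s0: "s > 0" using r by (simp add: s_def)
    have st: "s < t n" using n by (simp add: s_def exp_minus field_simps)
    \<comment> \<open>Minimality of n and r \<notin> E place s strictly between t (n - 1) and t n. A
      maximal index at s then exceeds n - 1 and is at most n. For n = 0 the upper bound alone
      suffices.\<close>
    have Qn: "Q s n"
    proof (cases n)
      case 0
      then show ?thesis using exQ[OF s0] below[OF st s0] by auto
    next
      case (Suc p)
      have "\<not> r < t p * exp (l p)" using Suc not_less_Least[of p "\<lambda>n. r < t n * exp (l n)"] by (simp add: n_def)
      moreover have "r \<notin> {t p * exp (l p)..t p * exp (l p) * exp (l (Suc p) - l p)}"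
        using r by (auto simp: E_def)
      ultimately have "r > t p * exp (l n)" by (simp add: Suc mult.assoc exp_add[symmetric])
      then have "s > t p" by (simp add: s_def exp_minus field_simps)
      then obtain m where "m > p" "Q s m" using above by (auto simp: T_def)
      then show ?thesis using below[OF st s0, of m] Suc by (cases "m = n") auto
    qed
    have "b p0 * s ^ p0 > 0" using p0 s0 by simp
    then have "b n * s ^ n > 0" using Qn unfolding Q_def by (meson less_le_trans)
    then have an: "a n \<noteq> 0" by (auto simp: b_def)
    have "norm (a k) * r ^ k \<le> norm (a n) * r ^ n * exp (- (A k - A n - (real k - real n) * l n))" for k
    proof -
      have eq: "b i * s ^ i = norm (a i) * r ^ i * exp (A i - real i * l n)" for i
        by (simp add: b_def s_def power_mult_distrib exp_diff exp_minus exp_of_nat_mult power_inverse field_simps)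
      have "b k * s ^ k \<le> b n * s ^ n" using Qn by (simp add: Q_def)
      then have "norm (a k) * r ^ k * exp (A k - real k * l n) * exp (- (A k - real k * l n))
          \<le> norm (a n) * r ^ n * exp (A n - real n * l n) * exp (- (A k - real k * l n))"
        unfolding eq by (rule mult_right_mono) simp
      then show ?thesis by (simp add: mult.assoc exp_add[symmetric] algebra_simps)
    qed
    then show ?thesis using an by blast
  qed
  ultimately show ?thesis by blast
qed

lemma central_index_eqI:
  assumes "\<And>n. norm (taylor_coeff f n) * r ^ n \<le> norm (taylor_coeff f N) * r ^ N"
    and "\<And>n. n > N \<Longrightarrow> norm (taylor_coeff f n) * r ^ n < norm (taylor_coeff f N) * r ^ N"
  shows "central_index r f = N"
proof -
  have "max_term r f = norm (taylor_coeff f N) * r ^ N"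
    unfolding max_term_def using assms(1) by (intro cSup_eq_maximum) auto
  moreover have le: "n \<le> N" if "norm (taylor_coeff f n) * r ^ n = norm (taylor_coeff f N) * r ^ N" for n
    using that assms(2)[of n] by (cases "n > N") auto
  moreover have "finite {n. norm (taylor_coeff f n) * r ^ n = norm (taylor_coeff f N) * r ^ N}"
    by (rule finite_subset[of _ "{..N}"]) (use le in auto)
  ultimately show ?thesis
    unfolding central_index_def by (intro Max_eqI) auto
qed

section \<open>Decay away from the central index\<close>

text \<open>Integral test for the nonincreasing function 1/v. The values at i + 1 give a step
  function below 1/v; the value at 0 is added separately.\<close>

lemma class_V_sum_bounded:
  assumes "v \<in> class_V"
  shows "\<exists>S. \<forall>n. (\<Sum>i<n. 1 / v (real i)) \<le> S"
proof -
  have pos: "\<And>x. x \<ge> 0 \<Longrightarrow> v x > 0" and mono: "mono_on {0..} v"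
    and int: "set_integrable lborel {0..} (\<lambda>x. 1 / v x)"
    using assms by (auto simp: class_V_def)
  let ?g = "\<lambda>x. indicator {0..} x *\<^sub>R (1 / v x)"
  have ind: "(\<Sum>i<n. indicator {real i..<real (Suc i)} x) = (indicator {0..<real n} x :: real)" for n x
    by (induction n) (auto simp: indicator_def)
  have bound: "(\<Sum>i<n. 1 / v (real (Suc i))) \<le> integral\<^sup>L lborel ?g" for n
  proof -
    have "(\<Sum>i<n. 1 / v (real (Suc i))) = (LINT x|lborel. (\<Sum>i<n. 1 / v (real (Suc i)) * indicator {real i..<real (Suc i)} x))"
      by (subst Bochner_Integration.integral_sum) auto
    also have "\<dots> \<le> integral\<^sup>L lborel ?g"
    proof (rule integral_mono)
      show "integrable lborel ?g" using int by (simp add: set_integrable_def)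
      fix x :: real
      have "(\<Sum>i<n. 1 / v (real (Suc i)) * indicator {real i..<real (Suc i)} x)
          \<le> (\<Sum>i<n. ?g x * indicator {real i..<real (Suc i)} x)"
      proof (rule sum_mono)
        fix i
        show "1 / v (real (Suc i)) * indicator {real i..<real (Suc i)} x \<le> ?g x * indicator {real i..<real (Suc i)} x"
        proof (cases "x \<in> {real i..<real (Suc i)}")
          case True
          then have x0: "x \<ge> 0" by (meson atLeastLessThan_iff of_nat_0_le_iff order_trans)
          have "v x \<le> v (real (Suc i))" using True x0 by (intro mono_onD[OF mono]) auto
          then show ?thesis using True x0 pos[OF x0] by (simp add: frac_le)
        qed auto
      qed
      also have "\<dots> = ?g x * indicator {0..<real n} x" by (simp only: sum_distrib_left[symmetric] ind)
      also have "\<dots> \<le> ?g x" using pos[of x] by (auto simp: indicator_def)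
      finally show "(\<Sum>i<n. 1 / v (real (Suc i)) * indicator {real i..<real (Suc i)} x) \<le> ?g x" .
    qed auto
    finally show ?thesis .
  qed
  show ?thesis
  proof (intro exI allI)
    fix n
    have "(\<Sum>i<n. 1 / v (real i)) \<le> (\<Sum>i<Suc n. 1 / v (real i))" using pos[of "real n"] by simp
    also have "\<dots> = 1 / v 0 + (\<Sum>i<n. 1 / v (real (Suc i)))" by (subst sum.lessThan_Suc_shift) simp
    also have "\<dots> \<le> 1 / v 0 + integral\<^sup>L lborel ?g" using bound by simp
    finally show "(\<Sum>i<n. 1 / v (real i)) \<le> 1 / v 0 + integral\<^sup>L lborel ?g" .
  qed
qed

text \<open>By monotonicity n / v(n) is at most the bounded partial sum of 1/v. This is what later
  turns a tail of size O(1/v(N)) into O(1/N).\<close>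

lemma class_V_ge_linear:
  assumes "v \<in> class_V"
  shows "\<exists>S>0. \<forall>n. real n \<le> S * v (real n)"
proof -
  have pos: "\<And>x. x \<ge> 0 \<Longrightarrow> v x > 0" and mono: "mono_on {0..} v"
    using assms by (auto simp: class_V_def)
  obtain S where S: "\<And>n. (\<Sum>i<n. 1 / v (real i)) \<le> S" using class_V_sum_bounded[OF assms] by blast
  have "real n \<le> (\<bar>S\<bar> + 1) * v (real n)" for n
  proof -
    have "real n * (1 / v (real n)) = (\<Sum>i<n. 1 / v (real n))" by simp
    also have "\<dots> \<le> (\<Sum>i<n. 1 / v (real i))"
      using pos by (intro sum_mono divide_left_mono mono_onD[OF mono] mult_pos_pos) auto
    also have "\<dots> \<le> \<bar>S\<bar> + 1" using S[of n] by simp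
    finally show ?thesis using pos[of "real n"] by (simp add: field_simps)
  qed
  then show ?thesis by (intro exI[of _ "\<bar>S\<bar> + 1"]) auto
qed

lemma class_V_at_top:
  assumes "v \<in> class_V"
  shows "filterlim (\<lambda>n. v (real n)) at_top sequentially"
proof -
  obtain S where S: "S > 0" "\<And>n. real n \<le> S * v (real n)" using class_V_ge_linear[OF assms] by blast
  have "filterlim (\<lambda>n. inverse S * real n) at_top sequentially"
    using S(1) by (intro filterlim_tendsto_pos_mult_at_top[OF tendsto_const]) (auto intro: filterlim_real_sequentially)
  then show ?thesis
    by (rule filterlim_at_top_mono) (use S in \<open>simp add: field_simps\<close>)
qed

text \<open>Monotonicity of x^2 / (v ln v) between n and 2n lets v ln v grow by a factor of at most
  4. The logarithm at n can be replaced by the larger one at 2n, which then cancels.\<close>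

lemma class_V_doubling:
  assumes "v \<in> class_V"
  shows "\<forall>\<^sub>F n in sequentially. v (real (2 * n)) \<le> 4 * v (real n)"
proof -
  have mono: "mono_on {0..} v" using assms by (auto simp: class_V_def)
  obtain x0 where x0: "mono_on {x0..} (\<lambda>x. x\<^sup>2 / (v x * ln (v x)))"
    using assms by (auto simp: class_V_def)
  show ?thesis
    using filterlim_at_top_dense[THEN iffD1, OF class_V_at_top[OF assms], rule_format, of 1]
      eventually_ge_at_top[of "nat \<lceil>x0\<rceil>"] eventually_gt_at_top[of 0]
  proof eventually_elim
    case (elim n)
    let ?V = "v (real n)" and ?V2 = "v (real (2 * n))"
    have V2: "?V \<le> ?V2" by (intro mono_onD[OF mono]) auto
    have lnpos: "0 < ln ?V" "ln ?V \<le> ln ?V2" "0 < ?V" "0 < ?V2" using elim V2 by auto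
    have "(real n)\<^sup>2 / (?V * ln ?V) \<le> (real (2 * n))\<^sup>2 / (?V2 * ln ?V2)"
      using elim by (intro mono_onD[OF x0]) (auto simp: nat_ceiling_le_eq)
    moreover have "?V * ln ?V > 0" "?V2 * ln ?V2 > 0" using lnpos by auto
    ultimately have "(real n)\<^sup>2 * (?V2 * ln ?V2) \<le> (real n)\<^sup>2 * (4 * (?V * ln ?V))"
      by (simp add: field_simps power2_eq_square)
    then have "?V2 * ln ?V2 \<le> 4 * (?V * ln ?V)" using elim by (simp add: mult_le_cancel_left)
    also have "\<dots> \<le> 4 * (?V * ln ?V2)" using lnpos by simp
    finally have "?V2 * ln ?V2 \<le> (4 * ?V) * ln ?V2" by simp
    then show ?case using lnpos by (simp add: mult_le_cancel_right)
  qed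
qed

lemma class_V_kappa_at_top:
  assumes "v \<in> class_V"
  shows "filterlim (\<lambda>n. kappa v (real n)) at_top sequentially"
proof -
  have "filterlim (\<lambda>x::real. 4 * sqrt (x * ln x)) at_top at_top" by real_asymp
  from filterlim_compose[OF this class_V_at_top[OF assms]] show ?thesis by (simp add: kappa_def)
qed

lemma class_V_kappa_small:
  assumes "v \<in> class_V"
  shows "(\<lambda>n. kappa v (real n) / real n) \<longlonglongrightarrow> 0"
proof -
  have lim: "filterlim (\<lambda>x. x\<^sup>2 / (v x * ln (v x))) at_top at_top"
    using assms by (auto simp: class_V_def)
  have "((\<lambda>y::real. 4 * sqrt (1 / y)) \<longlongrightarrow> 0) at_top" by real_asymp
  from filterlim_compose[OF this filterlim_compose[OF lim filterlim_real_sequentially]]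
  have "(\<lambda>n. 4 * sqrt (1 / ((real n)\<^sup>2 / (v (real n) * ln (v (real n)))))) \<longlonglongrightarrow> 0" .
  moreover have "4 * sqrt (1 / ((real n)\<^sup>2 / (v (real n) * ln (v (real n))))) = kappa v (real n) / real n" for n
    by (simp add: kappa_def real_sqrt_divide)
  ultimately show ?thesis by (simp only:)
qed

text \<open>\<open>A\<close> is a convex sequence with slopes \<open>l\<close>, and the left side is
  its height above the tangent at N. At distance K the slope has changed by at least K / (4 u(N)):
  to the right this uses doubling, to the left u is at most u(N). Since |n - N| >= 2K, at least half
  of the steps between N and n profit, which turns 4 into 8.\<close>

lemma convex_exponent_bound:
  fixes u :: "nat \<Rightarrow> real" and N K n :: nat
  assumes pos: "\<And>i. u i > 0" and mono: "mono u"
    and dbl: "u (2 * N) \<le> 4 * u N" and K: "K \<le> N" and n: "\<bar>real n - real N\<bar> \<ge> real (2 * K)"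
  defines "l i \<equiv> \<Sum>j<i. 1 / u j"
  defines "A i \<equiv> \<Sum>j\<in>{0<..i}. l j"
  shows "A n - A N - (real n - real N) * l N \<ge> \<bar>real n - real N\<bar> * (real K / (8 * u N))"
proof -
  have ldiff: "l j - l i = (\<Sum>k\<in>{i..<j}. 1 / u k)" if "i \<le> j" for i j
    unfolding l_def using that by (simp add: sum_diff_nat_ivl lessThan_atLeast0)
  have lmono: "l i \<le> l j" if "i \<le> j" for i j
    using ldiff[OF that] sum_nonneg[of "{i..<j}" "\<lambda>k. 1 / u k"] pos less_imp_le by (smt (verit) divide_nonneg_nonneg)
  have lge: "l j - l i \<ge> real (j - i) / u j" if "i \<le> j" for i j
  proof -
    have "real (j - i) / u j = (\<Sum>k\<in>{i..<j}. 1 / u j)" by simp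
    also have "\<dots> \<le> (\<Sum>k\<in>{i..<j}. 1 / u k)"
      using pos by (intro sum_mono divide_left_mono monoD[OF mono] mult_pos_pos) auto
    finally show ?thesis using ldiff[OF that] by simp
  qed
  have Adiff: "A j - A i = (\<Sum>k\<in>{i<..j}. l k)" if "i \<le> j" for i j
  proof -
    have "{0<..j} = {0<..i} \<union> {i<..j}" using that by auto
    then have "A j = A i + (\<Sum>k\<in>{i<..j}. l k)" unfolding A_def by (simp add: sum.union_disjoint)
    then show ?thesis by simp
  qed
  show ?thesis
  proof (cases "N \<le> n")
    case True
    then have n2: "n \<ge> N + 2 * K" using n by linarith
    have step: "real K / (4 * u N) \<le> l k - l N" if "k \<ge> N + K" for k
    proof -
      have "u (N + K) \<le> u (2 * N)" using K by (intro monoD[OF mono]) auto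
      then have "real K / (4 * u N) \<le> real (N + K - N) / u (N + K)"
        using dbl pos by (intro frac_le) (auto intro: order_trans)
      also have "\<dots> \<le> l (N + K) - l N" by (rule lge) simp
      also have "\<dots> \<le> l k - l N" using lmono[OF that] by simp
      finally show ?thesis .
    qed
    have "\<bar>real n - real N\<bar> * (real K / (8 * u N)) = (real n - real N) / 2 * (real K / (4 * u N))"
      using True by simp
    also have "\<dots> \<le> real (n - (N + K)) * (real K / (4 * u N))"
      using n2 pos[of N] by (intro mult_right_mono) (auto simp: of_nat_diff)
    also have "\<dots> = (\<Sum>k\<in>{N + K<..n}. real K / (4 * u N))" by simp
    also have "\<dots> \<le> (\<Sum>k\<in>{N + K<..n}. l k - l N)" by (intro sum_mono step) auto
    also have "\<dots> \<le> (\<Sum>k\<in>{N<..n}. l k - l N)" by (intro sum_mono2) (auto intro: lmono)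
    also have "\<dots> = A n - A N - (real n - real N) * l N"
      using True by (simp add: Adiff sum_subtractf of_nat_diff)
    finally show ?thesis .
  next
    case False
    then have n2: "n + 2 * K \<le> N" using n by linarith
    have step: "real K / u N \<le> l N - l k" if "k \<le> N - K" for k
    proof -
      have "real K / u N = real (N - (N - K)) / u N" using K by simp
      also have "\<dots> \<le> l N - l (N - K)" by (rule lge) simp
      also have "\<dots> \<le> l N - l k" using lmono[OF that] by simp
      finally show ?thesis .
    qed
    have "\<bar>real n - real N\<bar> * (real K / (8 * u N)) = (real N - real n) / 8 * (real K / u N)"
      using False by (simp add: field_simps)
    also have "\<dots> \<le> real (N - K - n) * (real K / u N)"
      using n2 pos[of N] by (intro mult_right_mono) (auto simp: of_nat_diff)
    also have "\<dots> = (\<Sum>k\<in>{n<..N - K}. real K / u N)" by simp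
    also have "\<dots> \<le> (\<Sum>k\<in>{n<..N - K}. l N - l k)" by (intro sum_mono step) auto
    also have "\<dots> \<le> (\<Sum>k\<in>{n<..N}. l N - l k)" by (intro sum_mono2) (auto intro: lmono)
    also have "\<dots> = (real N - real n) * l N - (A N - A n)"
      using False by (simp add: Adiff sum_subtractf of_nat_diff)
    also have "\<dots> = A n - A N - (real n - real N) * l N" by (simp add: algebra_simps)
    finally show ?thesis .
  qed
qed

text \<open>Majorant of the sum of exp(-w |n - N|) over all n with |n - N| >= K: two geometric
  series of ratio exp(-w), each started at exponent K.\<close>

definition tail_bound :: "real \<Rightarrow> nat \<Rightarrow> real" where
  "tail_bound w K = 2 * exp (- real K * w) / (1 - exp (- w))"

text \<open>The factor \<open>4\<close> leaves room for a change of radius and for a multiplier of the coefficients,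
  each of which may cost a factor \<open>exp (w * \<bar>n - N\<bar>)\<close>.\<close>

definition dominated :: "(nat \<Rightarrow> complex) \<Rightarrow> real \<Rightarrow> nat \<Rightarrow> nat \<Rightarrow> real \<Rightarrow> bool" where
  "dominated a r N K w \<longleftrightarrow> 0 < r \<and> 0 < w \<and> 1 \<le> K \<and> K \<le> N \<and> a N \<noteq> 0 \<and>
    (\<forall>n. \<bar>real n - real N\<bar> \<ge> real K \<longrightarrow>
      norm (a n) * r ^ n \<le> norm (a N) * r ^ N * exp (- 4 * w * \<bar>real n - real N\<bar>))"

lemma two_sided_geometric:
  fixes t :: "nat \<Rightarrow> complex"
  assumes w: "w > 0" and t: "\<And>n. norm (t n) \<le> c * exp (- w * \<bar>real n - real N\<bar>)"
  shows "summable t" "norm (suminf t) \<le> c * (2 / (1 - exp (- w)))"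
proof -
  define q where "q = exp (- w)"
  have q: "0 < q" "q < 1" using w by (auto simp: q_def)
  have c: "c \<ge> 0" using t[of 0] norm_ge_zero[of "t 0"] by (smt (verit) exp_gt_zero mult_neg_pos)
  let ?e = "\<lambda>n. c * exp (- w * \<bar>real n - real N\<bar>)"
  have e1: "?e (n + N) = c * q ^ n" for n by (simp add: q_def exp_of_nat_mult[symmetric] mult.commute)
  have geo: "(\<lambda>n. c * q ^ n) sums (c * (1 / (1 - q)))"
    using q by (intro sums_mult geometric_sums) auto
  have sum_e: "summable ?e"
    using sums_summable[OF geo] summable_iff_shift[of ?e N] by (simp only: e1)
  have "suminf ?e = (\<Sum>n. ?e (n + N)) + (\<Sum>n<N. ?e n)" by (rule suminf_split_initial_segment[OF sum_e])
  also have "(\<Sum>n. ?e (n + N)) = c * (1 / (1 - q))" using geo by (simp only: e1 sums_iff)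
  also have "(\<Sum>n<N. ?e n) \<le> (\<Sum>n<N. c * q ^ n)"
  proof -
    have "(\<Sum>n<N. ?e n) = (\<Sum>n<N. c * q ^ Suc n)"
      by (subst sum.nat_diff_reindex[symmetric])
        (auto intro!: sum.cong simp: q_def exp_of_nat_mult[symmetric] exp_add[symmetric] of_nat_diff algebra_simps)
    also have "\<dots> \<le> (\<Sum>n<N. c * q ^ n)" using c q by (intro sum_mono mult_left_mono power_decreasing) auto
    finally show ?thesis .
  qed
  also have "(\<Sum>n<N. c * q ^ n) \<le> c * (1 / (1 - q))"
    using geo c q by (intro sum_le_suminf[of "\<lambda>n. c * q ^ n", simplified sums_unique[OF geo, symmetric]]) (auto simp: sums_iff)
  finally have le: "suminf ?e \<le> c * (2 / (1 - exp (- w)))" by (simp add: q_def mult.commute)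
  have sn: "summable (\<lambda>n. norm (t n))"
    by (rule summable_comparison_test'[OF sum_e, of 0]) (use t in auto)
  then show "summable t" by (rule summable_norm_cancel)
  have "norm (suminf t) \<le> (\<Sum>n. norm (t n))" by (rule summable_norm[OF sn])
  also have "\<dots> \<le> suminf ?e" by (intro suminf_le sn sum_e t)
  finally show "norm (suminf t) \<le> c * (2 / (1 - exp (- w)))" using le by simp
qed

lemma dominated_tail:
  assumes dom: "dominated a r N K w" and rho: "\<rho> > 0" "\<bar>ln \<rho> - ln r\<bar> \<le> w" "norm z = \<rho>"
    and g: "\<And>n. \<bar>g n\<bar> \<le> B * exp (w * \<bar>real n - real N\<bar>)"
    and s: "(\<lambda>n. of_real (g n) * a n * z ^ n) sums s"
  shows "norm (s - (\<Sum>n\<in>{N - K..N + K}. of_real (g n) * a n * z ^ n))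
    \<le> B * tail_bound w K * (norm (a N) * \<rho> ^ N)"
proof -
  have dr: "r > 0" "w > 0" "K \<le> N"
    and dec: "\<And>n. \<bar>real n - real N\<bar> \<ge> real K \<Longrightarrow>
      norm (a n) * r ^ n \<le> norm (a N) * r ^ N * exp (- 4 * w * \<bar>real n - real N\<bar>)"
    using dom by (auto simp: dominated_def)
  have B: "B \<ge> 0" using g[of 0] by (smt (verit) abs_ge_zero exp_gt_zero mult_neg_pos)
  define t where "t n = (if n \<in> {N - K..N + K} then 0 else of_real (g n) * a n * z ^ n)" for n
  define x where "x = ln \<rho> - ln r"
  have pow: "\<rho> ^ n = r ^ n * exp (x * real n)" for n
  proof -
    have "\<rho> = r * exp x" using rho dr by (simp add: x_def exp_diff)
    then show ?thesis by (simp add: power_mult_distrib exp_of_nat2_mult)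
  qed
  have tb: "norm (t n) \<le> (B * exp (- real K * w) * (norm (a N) * \<rho> ^ N)) * exp (- w * \<bar>real n - real N\<bar>)" for n
  proof (cases "n \<in> {N - K..N + K}")
    case False
    let ?d = "\<bar>real n - real N\<bar>"
    have d: "?d \<ge> real K" using False dr(3) by auto
    have "norm (t n) = \<bar>g n\<bar> * (norm (a n) * r ^ n) * exp (x * real n)"
      using False rho by (simp only: t_def if_False norm_mult norm_power norm_of_real pow mult_ac)
    also have "\<dots> \<le> (B * exp (w * ?d)) * (norm (a N) * r ^ N * exp (- 4 * w * ?d)) * exp (x * real n)"
      using B dr by (intro mult_mono mult_nonneg_nonneg g dec d) auto
    also have "\<dots> = B * (norm (a N) * \<rho> ^ N) * exp (w * ?d + - 4 * w * ?d + x * (real n - real N))"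
    proof -
      have "exp (x * real n) = exp (x * real N) * exp (x * (real n - real N))"
        by (simp add: exp_add[symmetric] algebra_simps)
      then show ?thesis unfolding pow by (simp only: exp_add mult_ac)
    qed
    \<comment> \<open>Of the exponent 4 w |n - N| one share pays for g and one for the change of
      radius. The third yields exp(-K w), as |n - N| >= K, and the fourth keeps the series
      summable.\<close>
    also have "\<dots> \<le> B * (norm (a N) * \<rho> ^ N) * exp (- real K * w + - w * ?d)"
    proof -
      have "x * (real n - real N) \<le> \<bar>x\<bar> * ?d" by (metis abs_ge_self abs_mult)
      also have "\<dots> \<le> w * ?d" using rho(2) by (intro mult_right_mono) (auto simp: x_def)
      finally have "x * (real n - real N) \<le> w * ?d" .
      moreover have "real K * w \<le> ?d * w" using d dr by (intro mult_right_mono) auto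
      ultimately have "w * ?d + - 4 * w * ?d + x * (real n - real N) \<le> - real K * w + - w * ?d"
        by (simp add: algebra_simps)
      then show ?thesis using B rho by (intro mult_left_mono) auto
    qed
    also have "\<dots> = (B * exp (- real K * w) * (norm (a N) * \<rho> ^ N)) * exp (- w * ?d)" by (simp only: exp_add mult_ac)
    finally show ?thesis .
  qed (use B rho in \<open>auto simp: t_def\<close>)
  have "(\<lambda>n. if n \<in> {N - K..N + K} then of_real (g n) * a n * z ^ n else 0) sums
    (\<Sum>n\<in>{N - K..N + K}. of_real (g n) * a n * z ^ n)"
    by (rule sums_If_finite_set) simp
  from sums_diff[OF s this]
  have "(\<lambda>n. t n) sums (s - (\<Sum>n\<in>{N - K..N + K}. of_real (g n) * a n * z ^ n))"
    by (rule sums_cong[THEN iffD1, rotated]) (auto simp: t_def)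
  then have "s - (\<Sum>n\<in>{N - K..N + K}. of_real (g n) * a n * z ^ n) = suminf t" by (simp add: sums_iff)
  then show ?thesis
    using two_sided_geometric(2)[OF dr(2) tb] by (simp add: tail_bound_def mult_ac)
qed

text \<open>The tail estimate enters twice: with the constant multiplier 1 it bounds the window
  polynomial of f by (1 + tail) M, and with g it removes the terms outside the window. M has to
  dominate |f| on the whole circle, because the multiplier bound averages over rotations.\<close>

lemma multiplier_estimate:
  assumes dom: "dominated a r N K w" and rho: "\<rho> > 0" "\<bar>ln \<rho> - ln r\<bar> \<le> w" "norm z = \<rho>"
    and f: "\<And>z. (\<lambda>n. a n * z ^ n) sums f z"
    and M: "\<And>u. norm u = \<rho> \<Longrightarrow> norm (f u) \<le> M" "norm (a N) * \<rho> ^ N \<le> M"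
    and g: "\<And>n. \<bar>g n\<bar> \<le> B * exp (w * \<bar>real n - real N\<bar>)"
    and A: "\<And>n. \<bar>real n - real N\<bar> \<le> real K \<Longrightarrow> \<bar>g n\<bar> \<le> A"
    and D: "\<And>n. \<bar>real n - real N\<bar> \<le> real K \<Longrightarrow> \<bar>g (Suc n) - g n\<bar> \<le> D"
    and s: "(\<lambda>n. of_real (g n) * a n * z ^ n) sums s"
  shows "norm s \<le> (2 * (A + real (2 * K) * D) * (1 + tail_bound w K) + B * tail_bound w K) * M"
proof -
  let ?\<tau> = "tail_bound w K" and ?W = "{N - K..N + K}"
  have dr: "w > 0" "K \<le> N" "K \<ge> 1" using dom by (auto simp: dominated_def)
  have B: "B \<ge> 0" using g[of 0] by (smt (verit) abs_ge_zero exp_gt_zero mult_neg_pos)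
  have \<tau>: "?\<tau> \<ge> 0" using dr by (simp add: tail_bound_def)
  \<comment> \<open>Taking out the lowest power leaves a polynomial of degree 2K with indices
    starting at 0, the setting of \<open>multiplier_bound\<close>.\<close>
  have window: "(\<Sum>n\<in>?W. c n * u ^ n) = u ^ (N - K) * (\<Sum>i\<le>2 * K. c (N - K + i) * u ^ i)" for c :: "nat \<Rightarrow> complex" and u
  proof -
    have "(\<Sum>n\<in>?W. c n * u ^ n) = (\<Sum>i\<in>{0..2 * K}. c (i + (N - K)) * u ^ (i + (N - K)))"
      using dr(2) sum.shift_bounds_cl_nat_ivl[of "\<lambda>n. c n * u ^ n" 0 "N - K" "2 * K"] by (simp add: add.commute)
    then show ?thesis by (simp add: sum_distrib_left power_add mult_ac add.commute atLeast0AtMost)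
  qed
  have P: "norm (\<Sum>i\<le>2 * K. a (N - K + i) * u ^ i) \<le> (1 + ?\<tau>) * M / \<rho> ^ (N - K)" if u: "norm u = norm z" for u
  proof -
    have u': "norm u = \<rho>" using u rho by simp
    have "norm (f u - (\<Sum>n\<in>?W. of_real 1 * a n * u ^ n)) \<le> 1 * ?\<tau> * (norm (a N) * \<rho> ^ N)"
      using f[of u] dr by (intro dominated_tail[OF dom rho(1,2) u']) auto
    also have "\<dots> \<le> ?\<tau> * M" using \<tau> M(2) by (simp add: mult_left_mono)
    finally have "norm (f u - (\<Sum>n\<in>?W. a n * u ^ n)) \<le> ?\<tau> * M" by simp
    then have "norm (\<Sum>n\<in>?W. a n * u ^ n) \<le> M + ?\<tau> * M"
      using M(1)[OF u'] norm_triangle_ineq4[of "f u" "f u - (\<Sum>n\<in>?W. a n * u ^ n)"] by simp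
    then show ?thesis using u' rho unfolding window
      by (simp add: norm_mult norm_power field_simps)
  qed
  have "norm (\<Sum>i\<le>2 * K. of_real (g (N - K + i)) * a (N - K + i) * z ^ i)
    \<le> 2 * (A + real (2 * K) * D) * ((1 + ?\<tau>) * M / \<rho> ^ (N - K))"
    by (rule multiplier_bound[where h="\<lambda>i. g (N - K + i)"])
      (use dr A[of "N - K + _"] D[of "N - K + _"] P in \<open>auto simp: of_nat_diff\<close>)
  then have "norm (\<Sum>n\<in>?W. of_real (g n) * a n * z ^ n) \<le> 2 * (A + real (2 * K) * D) * (1 + ?\<tau>) * M"
    using rho unfolding window by (simp add: norm_mult norm_power field_simps)
  moreover have "norm (s - (\<Sum>n\<in>?W. of_real (g n) * a n * z ^ n)) \<le> B * ?\<tau> * M"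
    using dominated_tail[OF dom rho g s] mult_left_mono[OF M(2), of "B * ?\<tau>"] B \<tau> by simp
  ultimately have "norm s \<le> 2 * (A + real (2 * K) * D) * (1 + ?\<tau>) * M + B * ?\<tau> * M"
    using norm_triangle_ineq[of "s - (\<Sum>n\<in>?W. of_real (g n) * a n * z ^ n)" "\<Sum>n\<in>?W. of_real (g n) * a n * z ^ n"] by simp
  then show ?thesis by (simp add: algebra_simps)
qed

section \<open>Maximum modulus and multiplier bounds\<close>

lemma norm_le_max_modulus:
  assumes "f holomorphic_on UNIV" "norm z = r"
  shows "norm (f z) \<le> max_modulus r f"
  unfolding max_modulus_def
proof (rule cSUP_upper)
  have "compact ((\<lambda>z. norm (f z)) ` sphere 0 r)"
    using assms(1) by (intro compact_continuous_image continuous_on_norm)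
      (auto intro: continuous_on_subset holomorphic_on_imp_continuous_on)
  then show "bdd_above ((\<lambda>z. norm (f z)) ` sphere 0 r)"
    by (intro bounded_imp_bdd_above compact_imp_bounded)
qed (use assms in auto)

lemma coeff_le_max_modulus:
  assumes "f holomorphic_on UNIV" "\<rho> > 0"
  shows "norm (taylor_coeff f n) * \<rho> ^ n \<le> max_modulus \<rho> f"
proof -
  have "norm ((deriv ^^ n) f 0) \<le> fact n * max_modulus \<rho> f / \<rho> ^ n"
    using assms by (intro Cauchy_inequality)
      (auto intro: holomorphic_on_subset continuous_on_subset holomorphic_on_imp_continuous_on norm_le_max_modulus)
  then show ?thesis
    using assms(2) by (simp add: taylor_coeff_def fps_expansion_def norm_divide field_simps)
qed

lemma max_modulus_nonneg:
  assumes "f holomorphic_on UNIV" "r \<ge> 0"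
  shows "max_modulus r f \<ge> 0"
  by (rule order_trans[OF norm_ge_zero norm_le_max_modulus[OF assms(1), of "of_real r"]]) (use assms(2) in simp)

text \<open>Nothing is assumed about the regularity of F, so boundedness of its modulus on the
  circle, without which the supremum is meaningless, is first read off the hypothesis. It serves
  both for dilations of f (c = exp x) and for iterates of the operator (c = 1).\<close>

lemma max_modulus_diff_le:
  assumes f: "f holomorphic_on UNIV" and "r \<ge> 0" "c > 0" "k \<ge> 0"
    and F: "\<And>z. norm z = r \<Longrightarrow> \<bar>norm (F (of_real c * z)) - k * norm (f z)\<bar> \<le> d"
  shows "\<bar>max_modulus (c * r) F - k * max_modulus r f\<bar> \<le> d"
proof -
  have ne: "sphere (0::complex) s \<noteq> {}" if "s \<ge> 0" for s using that by simp
  have cr: "c * r \<ge> 0" using assms by simp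
  have *: "norm (F z) \<le> k * max_modulus r f + d" if z: "norm z = c * r" for z
  proof -
    have "norm (z / of_real c) = r" using z \<open>c > 0\<close> by (simp add: norm_divide)
    then have "\<bar>norm (F z) - k * norm (f (z / of_real c))\<bar> \<le> d" "norm (f (z / of_real c)) \<le> max_modulus r f"
      using F[of "z / of_real c"] \<open>c > 0\<close> norm_le_max_modulus[OF f] by auto
    then show ?thesis using mult_left_mono[of "norm (f (z / of_real c))" "max_modulus r f" k] \<open>k \<ge> 0\<close> by linarith
  qed
  then have upper: "max_modulus (c * r) F \<le> k * max_modulus r f + d"
    unfolding max_modulus_def[of "c * r"] by (intro cSUP_least ne cr) auto
  have bdd: "bdd_above ((\<lambda>z. norm (F z)) ` sphere 0 (c * r))"
    by (rule bdd_aboveI2[where M="k * max_modulus r f + d"]) (use * in auto)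
  have lower: "k * norm (f z) \<le> max_modulus (c * r) F + d" if z: "norm z = r" for z
  proof -
    have "norm (F (of_real c * z)) \<le> max_modulus (c * r) F"
      unfolding max_modulus_def using z \<open>c > 0\<close> by (intro cSUP_upper bdd) (auto simp: norm_mult)
    then show ?thesis using F[OF z] by linarith
  qed
  have "k * max_modulus r f \<le> max_modulus (c * r) F + d"
  proof (cases "k = 0")
    case True
    then show ?thesis using lower[of "of_real r"] \<open>r \<ge> 0\<close> by simp
  next
    case False
    then have k: "k > 0" using \<open>k \<ge> 0\<close> by simp
    have "max_modulus r f \<le> (max_modulus (c * r) F + d) / k"
      unfolding max_modulus_def[of r f] using lower k \<open>r \<ge> 0\<close>
      by (intro cSUP_least ne) (auto simp: field_simps)
    then show ?thesis using k by (simp add: field_simps)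
  qed
  with upper show ?thesis by linarith
qed

section \<open>Bounds for the two multipliers\<close>

lemma powr_le_exp:
  fixes b x :: real
  assumes "b > 0" "x \<ge> 0"
  shows "x powr b \<le> b powr b * exp x"
proof -
  have "x / b \<le> exp (x / b)" using exp_ge_add_one_self[of "x / b"] by linarith
  then have "(x / b) powr b \<le> exp (x / b) powr b" using assms by (intro powr_mono2) auto
  then have "x powr b / b powr b \<le> exp x" using assms by (simp add: powr_divide exp_powr_real)
  then show ?thesis using assms by (simp add: field_simps)
qed

lemma powr_ratio_le:
  fixes x c :: real
  assumes "1 / 2 \<le> x" "x \<le> 2"
  shows "x powr c \<le> 2 powr \<bar>c\<bar>"
proof -
  have "\<bar>ln x\<bar> \<le> ln 2"
  proof -
    have "ln (1 / 2) \<le> ln x" "ln x \<le> ln 2" using assms by (auto simp del: ln_div)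
    then show ?thesis by (simp add: ln_div abs_le_iff)
  qed
  then have "c * ln x \<le> \<bar>c\<bar> * ln 2"
    using mult_left_mono[of "\<bar>ln x\<bar>" "ln 2" "\<bar>c\<bar>"] abs_ge_self[of "c * ln x"] by (simp add: abs_mult)
  then show ?thesis using assms by (simp add: powr_def)
qed

text \<open>The three conclusions supply the growth, size and increment hypotheses of
  \<open>multiplier_estimate\<close>. The size follows from the increments: at n = N the normalised
  factor differs from 1 by O(1/N), and at most K increments of order 1/N lead to any other index of
  the window.\<close>

lemma dgl_multiplier_bounds:
  fixes \<alpha> :: real and j :: nat
  assumes alpha: "\<alpha> > 0" and j: "j \<ge> 1"
  obtains B C n0 where "B \<ge> 0" "C \<ge> 0"
    "\<And>N w n. 1 \<le> N \<Longrightarrow> 1 / real N \<le> w \<Longrightarrow>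
      \<bar>dgl_factor \<alpha> j n / (real N * \<alpha>) powr (real j * \<alpha>) - 1\<bar> \<le> B * exp (w * \<bar>real n - real N\<bar>)"
    "\<And>N K n. n0 \<le> N \<Longrightarrow> 1 \<le> K \<Longrightarrow> 2 * K \<le> N \<Longrightarrow> \<bar>real n - real N\<bar> \<le> real K \<Longrightarrow>
      \<bar>dgl_factor \<alpha> j n / (real N * \<alpha>) powr (real j * \<alpha>) - 1\<bar> \<le> C * (real K / real N)"
    "\<And>N K n. n0 \<le> N \<Longrightarrow> 2 * K \<le> N \<Longrightarrow> \<bar>real n - real N\<bar> \<le> real K \<Longrightarrow>
      \<bar>(dgl_factor \<alpha> j (Suc n) / (real N * \<alpha>) powr (real j * \<alpha>) - 1)
        - (dgl_factor \<alpha> j n / (real N * \<alpha>) powr (real j * \<alpha>) - 1)\<bar> \<le> C / real N"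
proof -
  define \<beta> where "\<beta> = real j * \<alpha>"
  let ?G = "dgl_factor \<alpha> j"
  have \<beta>: "\<beta> > 0" using alpha j by (simp add: \<beta>_def)
  have G0: "?G n \<ge> 0" for n using dgl_factor_nonneg[OF alpha] .
  obtain C1 where C10: "C1 > 0" "\<forall>\<^sub>F n in sequentially. \<bar>?G n - (real n * \<alpha>) powr \<beta>\<bar> \<le> C1 * real n powr (\<beta> - 1)"
    by (rule landau_o.bigE[OF dgl_factor_asymp[OF assms]]) (simp add: \<beta>_def)
  then obtain n1 where C1: "C1 > 0" "\<And>n. n \<ge> n1 \<Longrightarrow> \<bar>?G n - (real n * \<alpha>) powr \<beta>\<bar> \<le> C1 * real n powr (\<beta> - 1)"
    unfolding eventually_sequentially by blast
  obtain C2 where C20: "C2 > 0" "\<forall>\<^sub>F n in sequentially. \<bar>?G (Suc n) - ?G n\<bar> \<le> C2 * real n powr (\<beta> - 1)"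
    by (rule landau_o.bigE[OF dgl_factor_diff[OF assms]]) (simp add: \<beta>_def)
  then obtain n2 where C2: "C2 > 0" "\<And>n. n \<ge> n2 \<Longrightarrow> \<bar>?G (Suc n) - ?G n\<bar> \<le> C2 * real n powr (\<beta> - 1)"
    unfolding eventually_sequentially by blast
  obtain C3 where C30: "C3 > 0" "\<forall>\<^sub>F n in sequentially. \<bar>?G n\<bar> \<le> C3 * real n powr \<beta>"
    by (rule landau_o.bigE[OF dgl_factor_bigo[OF assms]]) (simp add: \<beta>_def)
  then obtain n3 where C3: "C3 > 0" "\<And>n. n \<ge> n3 \<Longrightarrow> \<bar>?G n\<bar> \<le> C3 * real n powr \<beta>"
    unfolding eventually_sequentially by blast
  \<comment> \<open>The sum absorbs the finitely many n below n3. The bound is then stated with n +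
    1, since the power vanishes at n = 0 but the factor need not be small relative to it.\<close>
  define C4 where "C4 = C3 + (\<Sum>n<n3. ?G n)"
  have C4: "C4 > 0" using C3(1) G0 by (simp add: C4_def add_pos_nonneg sum_nonneg)
  have G_le: "?G n \<le> C4 * real (Suc n) powr \<beta>" for n
  proof (cases "n \<ge> n3")
    case True
    have "?G n \<le> C3 * real n powr \<beta>" using C3(2)[OF True] by simp
    also have "\<dots> \<le> C4 * real (Suc n) powr \<beta>"
      using C3(1) \<beta> G0 by (intro mult_mono powr_mono2) (auto simp: C4_def sum_nonneg)
    finally show ?thesis .
  next
    case False
    then have "?G n \<le> (\<Sum>n<n3. ?G n)" using G0 by (intro member_le_sum) auto
    also have "\<dots> \<le> C4 * 1" using C3(1) by (simp add: C4_def)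
    also have "\<dots> \<le> C4 * real (Suc n) powr \<beta>" using C4 \<beta> by (intro mult_left_mono ge_one_powr_ge_zero) auto
    finally show ?thesis .
  qed
  \<comment> \<open>exp 2 comes from (n + 1)/N <= w |n - N| + 2, and the final 1 from the subtracted
    1 in the multiplier.\<close>
  define B where "B = C4 / \<alpha> powr \<beta> * (\<beta> powr \<beta> * exp 2) + 1"
  define D where "D = C2 * 2 powr \<bar>\<beta> - 1\<bar> / \<alpha> powr \<beta>"
  define C where "C = C1 / \<alpha> powr \<beta> + D"
  have D: "D \<ge> 0" using C2(1) by (simp add: D_def)
  have CD: "C \<ge> D" using C1(1) by (simp add: C_def)
  have bound1: "\<bar>?G n / (real N * \<alpha>) powr \<beta> - 1\<bar> \<le> B * exp (w * \<bar>real n - real N\<bar>)"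
    if N: "1 \<le> N" "1 / real N \<le> w" for N w n
  proof -
    define y where "y = real (Suc n) / real N"
    have w: "w > 0" using N by (smt (verit) divide_pos_pos of_nat_0_less_iff less_le_trans zero_less_one)
    have y: "y \<le> w * \<bar>real n - real N\<bar> + 2"
    proof -
      have "y = (real n - real N) / real N + (1 + 1 / real N)" using N by (simp add: y_def field_simps)
      also have "\<dots> \<le> \<bar>real n - real N\<bar> * (1 / real N) + 2"
        using N by (intro add_mono) (auto simp: divide_right_mono)
      also have "\<bar>real n - real N\<bar> * (1 / real N) \<le> \<bar>real n - real N\<bar> * w" using N by (intro mult_left_mono) auto
      finally show ?thesis by (simp add: mult.commute)
    qed
    have "?G n / (real N * \<alpha>) powr \<beta> \<le> C4 * real (Suc n) powr \<beta> / (real N * \<alpha>) powr \<beta>"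
      by (intro divide_right_mono G_le) auto
    also have "\<dots> = C4 / \<alpha> powr \<beta> * y powr \<beta>"
      using N alpha by (simp add: y_def powr_divide powr_mult)
    also have "\<dots> \<le> C4 / \<alpha> powr \<beta> * (\<beta> powr \<beta> * exp y)"
      using C4 \<beta> by (intro mult_left_mono powr_le_exp) (auto simp: y_def)
    also have "\<dots> \<le> C4 / \<alpha> powr \<beta> * (\<beta> powr \<beta> * exp (w * \<bar>real n - real N\<bar> + 2))"
      using C4 y by (intro mult_left_mono) auto
    also have "\<dots> = (B - 1) * exp (w * \<bar>real n - real N\<bar>)" by (simp add: B_def exp_add mult_ac)
    finally have "?G n / (real N * \<alpha>) powr \<beta> \<le> (B - 1) * exp (w * \<bar>real n - real N\<bar>)" .
    moreover have "1 \<le> exp (w * \<bar>real n - real N\<bar>)" using w by simp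
    moreover have "?G n / (real N * \<alpha>) powr \<beta> \<ge> 0" using G0 by simp
    ultimately show ?thesis unfolding left_diff_distrib by linarith
  qed
  have diff: "\<bar>(?G (Suc n) / (real N * \<alpha>) powr \<beta> - 1) - (?G n / (real N * \<alpha>) powr \<beta> - 1)\<bar> \<le> D / real N"
    if N: "2 * (n1 + n2 + 1) \<le> N" "2 * K \<le> N" "\<bar>real n - real N\<bar> \<le> real K" for N K n
  proof -
    \<comment> \<open>A half-width of at most N/2 keeps n within [N/2, 2N]. Powers of n and N are
      then comparable whatever the sign of \<beta> - 1, and n lies beyond the threshold n2.\<close>
    have "real K \<le> real N / 2" using N(2) by linarith
    then have n: "real N / 2 \<le> real n" "real n \<le> 2 * real N" using N(3) by linarith+
    have N1: "real N > 0" using N by simp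
    have "N \<le> 2 * n" using n(1) by linarith
    then have "n2 \<le> n" using N(1) by simp
    have "real n powr (\<beta> - 1) / real N powr (\<beta> - 1) = (real n / real N) powr (\<beta> - 1)"
      by (simp add: powr_divide)
    also have "\<dots> \<le> 2 powr \<bar>\<beta> - 1\<bar>" using n N1 by (intro powr_ratio_le) (auto simp: field_simps)
    finally have le: "real n powr (\<beta> - 1) \<le> 2 powr \<bar>\<beta> - 1\<bar> * real N powr (\<beta> - 1)"
      using N1 by (simp add: field_simps)
    have "\<bar>(?G (Suc n) / (real N * \<alpha>) powr \<beta> - 1) - (?G n / (real N * \<alpha>) powr \<beta> - 1)\<bar>
        = \<bar>?G (Suc n) - ?G n\<bar> / (real N * \<alpha>) powr \<beta>"
      by (simp add: diff_divide_distrib[symmetric] abs_divide)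
    also have "\<dots> \<le> C2 * (2 powr \<bar>\<beta> - 1\<bar> * real N powr (\<beta> - 1)) / (real N * \<alpha>) powr \<beta>"
    proof (intro divide_right_mono)
      show "\<bar>?G (Suc n) - ?G n\<bar> \<le> C2 * (2 powr \<bar>\<beta> - 1\<bar> * real N powr (\<beta> - 1))"
        using C2(2)[OF \<open>n2 \<le> n\<close>] mult_left_mono[OF le, of C2] C2(1) by linarith
    qed simp
    also have "\<dots> = D / real N"
    proof -
      have "real N powr \<beta> \<noteq> 0" using N1 by simp
      moreover have "(real N * \<alpha>) powr \<beta> = real N powr \<beta> * \<alpha> powr \<beta>" using N1 alpha by (simp add: powr_mult)
      moreover have "real N powr (\<beta> - 1) = real N powr \<beta> / real N" using N1 by (simp add: powr_diff)
      ultimately show ?thesis by (simp add: D_def)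
    qed
    finally show ?thesis .
  qed
  have bound2: "\<bar>?G n / (real N * \<alpha>) powr \<beta> - 1\<bar> \<le> C * (real K / real N)"
    if N: "2 * (n1 + n2 + 1) \<le> N" "1 \<le> K" "2 * K \<le> N" "\<bar>real n - real N\<bar> \<le> real K" for N K n
  proof -
    let ?g = "\<lambda>n. ?G n / (real N * \<alpha>) powr \<beta> - 1"
    have N1: "real N > 0" using N by simp
    have gN: "\<bar>?g N\<bar> \<le> C1 / \<alpha> powr \<beta> / real N"
    proof -
      have "\<bar>?g N\<bar> = \<bar>?G N - (real N * \<alpha>) powr \<beta>\<bar> / (real N * \<alpha>) powr \<beta>"
      proof -
        have "(real N * \<alpha>) powr \<beta> \<noteq> 0" using N1 alpha by simp
        then have "?g N = (?G N - (real N * \<alpha>) powr \<beta>) / (real N * \<alpha>) powr \<beta>"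
          by (simp add: diff_divide_distrib)
        then show ?thesis by (simp only: abs_divide abs_of_nonneg[OF powr_ge_zero])
      qed
      also have "\<dots> \<le> C1 * real N powr (\<beta> - 1) / (real N * \<alpha>) powr \<beta>"
      proof -
        have "n1 \<le> N" using N(1) by simp
        then show ?thesis by (intro divide_right_mono C1(2) powr_ge_zero)
      qed
      also have "\<dots> = C1 / \<alpha> powr \<beta> / real N"
      proof -
        have "real N powr \<beta> \<noteq> 0" using N1 by simp
        moreover have "(real N * \<alpha>) powr \<beta> = real N powr \<beta> * \<alpha> powr \<beta>" using N1 alpha by (simp add: powr_mult)
        moreover have "real N powr (\<beta> - 1) = real N powr \<beta> / real N" using N1 by (simp add: powr_diff)
        ultimately show ?thesis by simp
      qed
      finally show ?thesis .
    qed
    have tele: "\<bar>?g q - ?g p\<bar> \<le> real (q - p) * (D / real N)"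
      if "p \<le> q" "\<And>i. p \<le> i \<Longrightarrow> i < q \<Longrightarrow> \<bar>real i - real N\<bar> \<le> real K" for p q
    proof -
      have "?g q - ?g p = (\<Sum>i\<in>{p..<q}. ?g (Suc i) - ?g i)"
        by (rule sum_Suc_diff'[OF that(1), symmetric])
      also have "\<bar>\<dots>\<bar> \<le> (\<Sum>i\<in>{p..<q}. D / real N)"
        by (rule order_trans[OF sum_abs sum_mono]) (rule diff[OF N(1,3)], use that(2) in simp)
      finally show ?thesis by simp
    qed
    have "\<bar>?g n - ?g N\<bar> \<le> real K * (D / real N)"
    proof (cases "N \<le> n")
      case True
      have "\<bar>?g n - ?g N\<bar> \<le> real (n - N) * (D / real N)"
        by (rule tele) (use True N(4) in auto)
      also have "\<dots> \<le> real K * (D / real N)" using True N(4) D by (intro mult_right_mono) auto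
      finally show ?thesis .
    next
      case False
      have "\<bar>?g N - ?g n\<bar> \<le> real (N - n) * (D / real N)"
        by (rule tele) (use False N(4) in auto)
      also have "\<dots> \<le> real K * (D / real N)" using False N(4) D by (intro mult_right_mono) auto
      finally show ?thesis by (simp add: abs_minus_commute)
    qed
    then have "\<bar>?g n\<bar> \<le> C1 / \<alpha> powr \<beta> / real N + real K * (D / real N)" using gN by linarith
    also have "\<dots> \<le> real K * (C1 / \<alpha> powr \<beta> / real N) + real K * (D / real N)"
    proof -
      have "1 * (C1 / \<alpha> powr \<beta> / real N) \<le> real K * (C1 / \<alpha> powr \<beta> / real N)"
        using N(2) C1(1) by (intro mult_right_mono) auto
      then show ?thesis by simp
    qed
    also have "\<dots> = C * (real K / real N)" by (simp add: C_def add_divide_distrib algebra_simps)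
    finally show ?thesis .
  qed
  show ?thesis
  proof (rule that[of B C "2 * (n1 + n2 + 1)", folded \<beta>_def])
    show "B \<ge> 0" using C4 by (simp add: B_def)
    show "C \<ge> 0" using CD D by simp
    show "\<bar>?G n / (real N * \<alpha>) powr \<beta> - 1\<bar> \<le> B * exp (w * \<bar>real n - real N\<bar>)"
      if "1 \<le> N" "1 / real N \<le> w" for N w n
      using that by (rule bound1)
    show "\<bar>?G n / (real N * \<alpha>) powr \<beta> - 1\<bar> \<le> C * (real K / real N)"
      if "2 * (n1 + n2 + 1) \<le> N" "1 \<le> K" "2 * K \<le> N" "\<bar>real n - real N\<bar> \<le> real K" for N K n
      using that by (rule bound2)
    show "\<bar>(?G (Suc n) / (real N * \<alpha>) powr \<beta> - 1) - (?G n / (real N * \<alpha>) powr \<beta> - 1)\<bar> \<le> C / real N"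
      if "2 * (n1 + n2 + 1) \<le> N" "2 * K \<le> N" "\<bar>real n - real N\<bar> \<le> real K" for N K n
      by (rule order_trans[OF diff[OF that] divide_right_mono[OF CD]]) simp
  qed
qed

text \<open>Dilating the variable by exp x multiplies the n-th term by exp(x n); \<open>g\<close> is
  this factor relative to its value at N, minus 1. The condition |x| K <= 1 confines the exponents
  to [-1,1], where |exp y - 1| <= 3 |y|; the 9 is 3 times the bound 3 for e.\<close>

lemma exp_multiplier_bounds:
  fixes x w :: real and N K n :: nat
  defines "g \<equiv> \<lambda>n. exp (x * (real n - real N)) - 1"
  assumes x: "\<bar>x\<bar> \<le> w" "\<bar>x\<bar> * real K \<le> 1" "1 \<le> K"
  shows "\<bar>g n\<bar> \<le> 1 * exp (w * \<bar>real n - real N\<bar>)"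
    and "\<bar>real n - real N\<bar> \<le> real K \<Longrightarrow> \<bar>g n\<bar> \<le> 3 * (\<bar>x\<bar> * real K)"
    and "\<bar>real n - real N\<bar> \<le> real K \<Longrightarrow> \<bar>g (Suc n) - g n\<bar> \<le> 9 * \<bar>x\<bar>"
proof -
  have exp3: "\<bar>exp y - 1\<bar> \<le> 3 * \<bar>y\<bar>" if "\<bar>y\<bar> \<le> 1" for y :: real
  proof (cases "y \<ge> 0")
    case True
    then show ?thesis using exp_bound[of y] that power_le_one[of y 1] mult_left_le[of y y]
      by (simp add: power2_eq_square abs_if)
  next
    case False
    then have "1 + y \<le> exp y" "exp y \<le> 1" using exp_ge_add_one_self[of y] by (linarith, simp)
    then show ?thesis using False by linarith
  qed
  have xd: "x * (real n - real N) \<le> \<bar>x\<bar> * \<bar>real n - real N\<bar>" for n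
    by (metis abs_ge_self abs_mult)
  have "x * (real n - real N) \<le> w * \<bar>real n - real N\<bar>"
    using xd[of n] mult_right_mono[OF x(1), of "\<bar>real n - real N\<bar>"] by linarith
  then have "exp (x * (real n - real N)) \<le> exp (w * \<bar>real n - real N\<bar>)" by simp
  moreover have "1 \<le> exp (w * \<bar>real n - real N\<bar>)" using x(1) by (simp add: order_trans[OF abs_ge_zero])
  ultimately show "\<bar>g n\<bar> \<le> 1 * exp (w * \<bar>real n - real N\<bar>)"
    using exp_gt_zero[of "x * (real n - real N)"] unfolding g_def by linarith
  assume n: "\<bar>real n - real N\<bar> \<le> real K"
  have y: "\<bar>x * (real n - real N)\<bar> \<le> \<bar>x\<bar> * real K"
    using n by (simp add: abs_mult mult_left_mono)
  show gn: "\<bar>g n\<bar> \<le> 3 * (\<bar>x\<bar> * real K)"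
    using exp3[of "x * (real n - real N)"] y x(2) unfolding g_def by linarith
  have "\<bar>x\<bar> \<le> 1" using x(2,3) mult_left_mono[of 1 "real K" "\<bar>x\<bar>"] by simp
  have "g (Suc n) - g n = exp (x * (real n - real N)) * (exp x - 1)"
  proof -
    have "exp (x * (real (Suc n) - real N)) = exp (x * (real n - real N)) * exp x"
      by (simp add: exp_add[symmetric] algebra_simps)
    then show ?thesis by (simp only: g_def) (simp add: algebra_simps)
  qed
  then have "\<bar>g (Suc n) - g n\<bar> = exp (x * (real n - real N)) * \<bar>exp x - 1\<bar>" by (simp add: abs_mult)
  also have "\<dots> \<le> 3 * (3 * \<bar>x\<bar>)"
  proof (intro mult_mono exp3 \<open>\<bar>x\<bar> \<le> 1\<close>)
    have "exp (x * (real n - real N)) \<le> exp 1" using y x(2) by simp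
    then show "exp (x * (real n - real N)) \<le> 3" using exp_le by linarith
  qed auto
  finally show "\<bar>g (Suc n) - g n\<bar> \<le> 9 * \<bar>x\<bar>" by simp
qed

text \<open>A convex sequence lies above its tangents. Strictness to the right of N matters because
  the central index is the largest index attaining the maximal term.\<close>

lemma exponent_pos:
  fixes l :: "nat \<Rightarrow> real" and N n :: nat
  assumes l: "incseq l"
  defines "A i \<equiv> \<Sum>j\<in>{0<..i}. l j"
  shows "A n - A N - (real n - real N) * l N \<ge> 0"
    and "strict_mono l \<Longrightarrow> n > N \<Longrightarrow> A n - A N - (real n - real N) * l N > 0"
proof -
  have Adiff: "A j - A i = (\<Sum>k\<in>{i<..j}. l k)" if "i \<le> j" for i j
  proof -
    have "{0<..j} = {0<..i} \<union> {i<..j}" using that by auto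
    then have "A j = A i + (\<Sum>k\<in>{i<..j}. l k)" unfolding A_def by (simp add: sum.union_disjoint)
    then show ?thesis by simp
  qed
  have up: "A n - A N - (real n - real N) * l N = (\<Sum>k\<in>{N<..n}. l k - l N)" if "N \<le> n"
    using that by (simp add: Adiff sum_subtractf of_nat_diff)
  have down: "A n - A N - (real n - real N) * l N = (\<Sum>k\<in>{n<..N}. l N - l k)" if "n \<le> N"
    using that Adiff[OF that] by (simp add: sum_subtractf of_nat_diff algebra_simps)
  show "A n - A N - (real n - real N) * l N \<ge> 0"
    using up down l by (cases "N \<le> n") (auto intro!: sum_nonneg simp: incseq_def)
  show "A n - A N - (real n - real N) * l N > 0" if "strict_mono l" "n > N"
    using that unfolding up[OF less_imp_le[OF that(2)]] by (intro sum_pos) (auto dest: strict_monoD)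
qed

section \<open>Choice of the window and estimates at normal radii\<close>

lemma ln_ratio_le:
  fixes r \<rho> x :: real
  assumes "r > 0" "0 < x" "x \<le> 1 / 2" "r * (1 - x) < \<rho>" "\<rho> < r * (1 + x)"
  shows "\<bar>ln \<rho> - ln r\<bar> \<le> 2 * x"
proof -
  have r1: "r * (1 - x) > 0" using assms by simp
  then have \<rho>: "\<rho> > 0" using assms(4) by linarith
  have "ln \<rho> - ln r \<le> \<rho> / r - 1"
    using ln_le_minus_one[of "\<rho> / r"] \<rho> assms(1) by (simp add: ln_div)
  also have "\<dots> \<le> x" using assms by (simp add: field_simps)
  finally have 1: "ln \<rho> - ln r \<le> x" .
  have "ln r - ln \<rho> \<le> r / \<rho> - 1"
    using ln_le_minus_one[of "r / \<rho>"] \<rho> assms(1) by (simp add: ln_div)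
  also have "r / \<rho> \<le> r / (r * (1 - x))" using assms r1 \<rho> by (intro divide_left_mono) auto
  also have "\<dots> = 1 / (1 - x)" using assms by simp
  also have "\<dots> \<le> 1 + 2 * x"
  proof -
    have "2 * x * x \<le> x" using mult_right_mono[OF assms(3), of "2 * x"] assms(2) by simp
    then have "1 \<le> (1 + 2 * x) * (1 - x)" by (simp add: algebra_simps)
    then show ?thesis using assms by (simp add: pos_divide_le_eq)
  qed
  finally show ?thesis using 1 assms(2) by simp
qed

lemma class_V_window:
  assumes v: "v \<in> class_V"
  obtains C where "C \<ge> 0" "\<forall>\<^sub>F N in sequentially. v (real (2 * N)) \<le> 4 * v (real N) \<and> (\<exists>K w. 1 \<le> K \<and> 4 * K \<le> N \<and>
    real (2 * K) \<le> 18 * kappa v (real N) \<and> 0 < w \<and> 1 / real N \<le> w \<and> 1 / (20 * kappa v (real N)) \<le> w \<and>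
    tail_bound w (2 * K) \<le> C * (kappa v (real N) / real N) \<and> 4 * w \<le> real K / (8 * v (real N)))"
proof -
  obtain S where S: "S > 0" "\<And>n. real n \<le> S * v (real n)" using class_V_ge_linear[OF v] by blast
  have ev: "\<forall>\<^sub>F N in sequentially. v (real (2 * N)) \<le> 4 * v (real N) \<and> exp 1 \<le> v (real N) \<and>
      1 \<le> kappa v (real N) \<and> kappa v (real N) / real N < 1 / 200 \<and> N > 0"
    using filterlim_at_top[THEN iffD1, OF class_V_at_top[OF v]]
      filterlim_at_top[THEN iffD1, OF class_V_kappa_at_top[OF v]]
    by (intro eventually_conj class_V_doubling[OF v] order_tendstoD(2)[OF class_V_kappa_small[OF v]] eventually_gt_at_top) auto
  show ?thesis
  proof (rule that[of "4 * S"])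
    show "4 * S \<ge> 0" using S by simp
    show "\<forall>\<^sub>F N in sequentially. v (real (2 * N)) \<le> 4 * v (real N) \<and> (\<exists>K w. 1 \<le> K \<and> 4 * K \<le> N \<and>
    real (2 * K) \<le> 18 * kappa v (real N) \<and> 0 < w \<and> 1 / real N \<le> w \<and> 1 / (20 * kappa v (real N)) \<le> w \<and>
    tail_bound w (2 * K) \<le> 4 * S * (kappa v (real N) / real N) \<and> 4 * w \<le> real K / (8 * v (real N)))"
      using ev
    proof eventually_elim
      case (elim N)
      define V where "V = v (real N)"
      define k where "k = kappa v (real N)"
      \<comment> \<open>With this rate \<kappa> = 4 V w and \<kappa> w = 4 ln V. Over a distance of
        order \<kappa> the factor exp(-w |n - N|) is thus a power of 1/V, while the gain in slope at
        that distance, of order \<kappa>/V, is of order w itself.\<close>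
      define w where "w = sqrt (ln V / V)"
      \<comment> \<open>Since 4 w = k / V, the required 4 w <= K / (8 V) means K >= 8 k. The
        half-width of the window is 2K, where the convexity bound starts, and 2K <= 16 k + 2 <= 18
        k.\<close>
      define K where "K = nat \<lceil>8 * k\<rceil>"
      have "exp 1 \<le> V" using elim by (simp add: V_def)
      moreover then have "V > 0" using less_le_trans[OF exp_gt_zero] by blast
      ultimately have V: "exp 1 \<le> V" "V > 0" by auto
      have lnV: "ln V \<ge> 1" using V by (simp add: ln_ge_iff)
      then have lnV0: "ln V > 0" by linarith
      have V1: "V \<ge> 1" using V exp_ge_add_one_self[of 1] by linarith
      have k1: "k \<ge> 1" using elim by (simp add: k_def)
      have N0: "real N > 0" using elim by simp
      have kN: "200 * k \<le> real N" using elim N0 by (simp add: k_def field_simps)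
      have w0: "w > 0" using divide_pos_pos[OF lnV0 V(2)] by (simp add: w_def)
      have w2: "V * w\<^sup>2 = ln V" using lnV0 V by (simp add: w_def)
      have kw: "k = 4 * (V * w)"
      proof -
        have "(V * w)\<^sup>2 = V * (V * w\<^sup>2)" by (simp add: power2_eq_square)
        then have "V * ln V = (V * w)\<^sup>2" by (simp only: w2)
        then have "sqrt (V * ln V) = V * w" using V w0 by simp
        then show ?thesis by (simp add: k_def kappa_def V_def)
      qed
      have "k * w = 4 * (V * w\<^sup>2)" by (simp add: kw power2_eq_square)
      then have kw1: "k * w = 4 * ln V" by (simp only: w2)
      have K: "8 * k \<le> real K" "real K \<le> 8 * k + 1"
        using k1 real_nat_ceiling_ge[of "8 * k"] of_int_ceiling_le_add_one[of "8 * k"] by (auto simp: K_def)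
      have Vw1: "1 \<le> V * w"
      proof -
        have "1 \<le> sqrt (V * ln V)" using mult_mono[OF V1 lnV] V1 by simp
        also have "sqrt (V * ln V) = V * w" using kw by (simp add: k_def kappa_def V_def)
        finally show ?thesis .
      qed
      have le1: "1 \<le> w * real N"
      proof -
        have "200 * (k * w) \<le> w * real N" using mult_left_mono[OF kN, of w] w0 by (simp add: mult_ac)
        then show ?thesis using kw1 lnV by linarith
      qed
      have w1: "w \<le> 1"
      proof -
        have "ln V / V \<le> 1" using ln_le_minus_one[OF V(2)] V by simp
        then show ?thesis by (simp add: w_def)
      qed
      have exp_w: "w / 2 \<le> 1 - exp (- w)"
      proof -
        have "exp (- w) \<le> 1 / (1 + w)"
          using exp_ge_add_one_self[of w] w0 by (simp add: exp_minus inverse_eq_divide frac_le)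
        also have "1 / (1 + w) \<le> 1 - w / 2"
          using w0 w1 mult_left_mono[OF w1, of w] by (simp add: field_simps)
        finally show ?thesis by simp
      qed
      \<comment> \<open>The exponential contributes V^(-2), and division by 1 - exp(-w) >= w/2 costs
        at most 2 V because V w >= 1. What remains is 4 / V, which is O(1/N) by linear growth of
        v.\<close>
      have tail: "tail_bound w (2 * K) \<le> 4 * S * (k / real N)"
      proof -
        have "exp (- real (2 * K) * w) \<le> exp (- (2 * ln V))"
        proof -
          have "2 * ln V \<le> 8 * (k * w)" using kw1 lnV by simp
          also have "\<dots> \<le> real K * w" using mult_right_mono[OF K(1), of w] w0 by simp
          also have "\<dots> \<le> real (2 * K) * w" using w0 by simp
          finally show ?thesis by simp
        qed
        also have "exp (- (2 * ln V)) = 1 / V\<^sup>2"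
          using V by (simp add: exp_minus exp_double power2_eq_square inverse_eq_divide)
        finally have "tail_bound w (2 * K) \<le> 2 * (1 / V\<^sup>2) / (w / 2)"
          unfolding tail_bound_def using exp_w w0 by (intro frac_le) auto
        also have "\<dots> = 4 / (V * (V * w))" by (simp add: power2_eq_square)
        also have "\<dots> \<le> 4 / (V * 1)" using V Vw1 w0 by (intro divide_left_mono mult_left_mono mult_pos_pos) auto
        also have "\<dots> \<le> 4 * S / real N" using S(2)[of N] N0 V by (simp add: V_def field_simps)
        also have "\<dots> \<le> 4 * S * k / real N" using k1 S(1) N0 by (intro divide_right_mono) auto
        finally show ?thesis by simp
      qed
      have "4 * w = 8 * k / (8 * V)" using V by (simp add: kw)
      also have "\<dots> \<le> real K / (8 * V)" using K V by (intro divide_right_mono) auto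
      finally have dec: "4 * w \<le> real K / (8 * V)" .
      have "1 \<le> K" "4 * K \<le> N" "real (2 * K) \<le> 18 * k" using K k1 kN by linarith+
      moreover have "1 / real N \<le> w" using le1 N0 by (simp add: pos_divide_le_eq)
      moreover have "1 / (20 * k) \<le> w"
      proof -
        have "1 \<le> 20 * (k * w)" using kw1 lnV by linarith
        then show ?thesis using k1 by (simp add: pos_divide_le_eq mult_ac)
      qed
      ultimately show ?case using elim w0 tail dec by (auto simp: V_def k_def)
    qed
  qed
qed

text \<open>The index found by \<open>exists_normal_radii\<close> is identified with the central
  index, and its exponential majorant is converted into decay at rate 4 w off a window. E depends on
  f and v only, so that one set serves all \<alpha> and j.\<close>

lemma wiman_valiron:
  assumes v: "v \<in> class_V" and f: "f holomorphic_on UNIV" and inf: "infinite {n. taylor_coeff f n \<noteq> 0}"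
  obtains E C where "finite_log_measure E" "C \<ge> 0"
    "filterlim (\<lambda>r. central_index r f) at_top (inf at_top (principal (- E)))"
    "\<forall>\<^sub>F r in inf at_top (principal (- E)). \<exists>K w.
      dominated (taylor_coeff f) r (central_index r f) K w \<and> 2 * K \<le> central_index r f \<and>
      real K \<le> 18 * kappa v (real (central_index r f)) \<and> 1 / real (central_index r f) \<le> w \<and>
      1 / (20 * kappa v (real (central_index r f))) \<le> w \<and>
      tail_bound w K \<le> C * (kappa v (real (central_index r f)) / real (central_index r f))"
proof -
  define u where "u i = v (real i)" for i :: nat
  define l where "l i = (\<Sum>j<i. 1 / u j)" for i
  define A where "A i = (\<Sum>j\<in>{0<..i}. l j)" for i
  let ?a = "taylor_coeff f" and ?\<nu> = "\<lambda>r. central_index r f"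
  have upos: "u i > 0" and umono: "mono u" for i
    using v by (auto simp: class_V_def u_def mono_on_def intro!: monoI)
  have lstrict: "strict_mono l" unfolding strict_mono_Suc_iff l_def using upos by simp
  then have linc: "incseq l" by (rule strict_mono_mono)
  obtain S where "\<And>i. l i \<le> S" using class_V_sum_bounded[OF v] by (auto simp: l_def u_def)
  moreover have "l i \<ge> 0" for i unfolding l_def using upos less_imp_le by (intro sum_nonneg) auto
  moreover have "summable (\<lambda>n. norm (?a n) * r ^ n)" if "r \<ge> 0" for r
    using sums_taylor_coeff[OF f] that by (intro summable_norm_power_series) (auto simp: sums_iff)
  ultimately obtain E where E: "finite_log_measure E"
    and normal: "\<And>r. r > 0 \<Longrightarrow> r \<notin> E \<Longrightarrow> \<exists>N. ?a N \<noteq> 0 \<and>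
      (\<forall>n. norm (?a n) * r ^ n \<le> norm (?a N) * r ^ N * exp (- (A n - A N - (real n - real N) * l N)))"
    using exists_normal_radii[OF _ inf linc, of S] unfolding A_def by blast
  have key: "?a (?\<nu> r) \<noteq> 0 \<and> (\<forall>n. norm (?a n) * r ^ n \<le>
      norm (?a (?\<nu> r)) * r ^ ?\<nu> r * exp (- (A n - A (?\<nu> r) - (real n - real (?\<nu> r)) * l (?\<nu> r))))"
    if r: "r > 0" "r \<notin> E" for r
  proof -
    obtain N where N: "?a N \<noteq> 0" "\<And>n. norm (?a n) * r ^ n
        \<le> norm (?a N) * r ^ N * exp (- (A n - A N - (real n - real N) * l N))"
      using normal[OF r] by blast
    have pos: "norm (?a N) * r ^ N > 0" using N(1) r by simp
    have "?\<nu> r = N"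
    proof (rule central_index_eqI)
      fix n
      have "exp (- (A n - A N - (real n - real N) * l N)) \<le> 1"
        using exponent_pos(1)[OF linc, of n N] by (simp add: A_def)
      then show "norm (?a n) * r ^ n \<le> norm (?a N) * r ^ N"
        using N(2)[of n] pos mult_left_le[of _ "norm (?a N) * r ^ N"] by (meson less_imp_le order_trans)
      assume "N < n"
      then have "exp (- (A n - A N - (real n - real N) * l N)) < 1"
        using exponent_pos(2)[OF linc lstrict, of N n] by (simp add: A_def)
      then have "norm (?a N) * r ^ N * exp (- (A n - A N - (real n - real N) * l N)) < norm (?a N) * r ^ N * 1"
        using pos by (rule mult_strict_left_mono)
      then show "norm (?a n) * r ^ n < norm (?a N) * r ^ N" using N(2)[of n] by linarith
    qed
    then show ?thesis using N by blast
  qed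
  \<comment> \<open>Infinitely many coefficients are nonzero. For large r the term of such an index
    m > Z beats all lower ones, so the central index is at least m.\<close>
  have lim: "filterlim ?\<nu> at_top (inf at_top (principal (- E)))"
    unfolding filterlim_at_top
  proof
    fix Z
    obtain m where m: "m > Z" "?a m \<noteq> 0" using inf unfolding infinite_nat_iff_unbounded by auto
    have "\<forall>\<^sub>F r in at_top. \<forall>k<m. norm (?a k) * r ^ k < norm (?a m) * r ^ m"
      by (rule eventually_power_dominates) (use m in simp)
    then show "\<forall>\<^sub>F r in inf at_top (principal (- E)). Z \<le> ?\<nu> r"
      unfolding eventually_inf_principal using eventually_gt_at_top[of 0]
    proof eventually_elim
      case (elim r)
      show ?case
      proof
        assume "r \<in> - E"
        then have k: "norm (?a m) * r ^ m \<le> norm (?a (?\<nu> r)) * r ^ ?\<nu> r *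
            exp (- (A m - A (?\<nu> r) - (real m - real (?\<nu> r)) * l (?\<nu> r)))"
          using key[of r] elim by auto
        have "exp (- (A m - A (?\<nu> r) - (real m - real (?\<nu> r)) * l (?\<nu> r))) \<le> 1"
          using exponent_pos(1)[OF linc, of m "?\<nu> r"] by (simp add: A_def)
        then have "norm (?a m) * r ^ m \<le> norm (?a (?\<nu> r)) * r ^ ?\<nu> r"
          using elim by (intro order_trans[OF k mult_left_le]) auto
        then have "\<not> ?\<nu> r < m" using elim(1) by (metis not_less)
        then show "Z \<le> ?\<nu> r" using m by simp
      qed
    qed
  qed
  obtain C where C: "C \<ge> 0" "\<forall>\<^sub>F N in sequentially. v (real (2 * N)) \<le> 4 * v (real N) \<and> (\<exists>K w. 1 \<le> K \<and> 4 * K \<le> N \<and>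
    real (2 * K) \<le> 18 * kappa v (real N) \<and> 0 < w \<and> 1 / real N \<le> w \<and> 1 / (20 * kappa v (real N)) \<le> w \<and>
    tail_bound w (2 * K) \<le> C * (kappa v (real N) / real N) \<and> 4 * w \<le> real K / (8 * v (real N)))"
    by (rule class_V_window[OF v])
  have ev: "\<forall>\<^sub>F r in inf at_top (principal (- E)). r > 0 \<and> r \<notin> E"
    unfolding eventually_inf_principal using eventually_gt_at_top[of 0] by eventually_elim auto
  have "\<forall>\<^sub>F r in inf at_top (principal (- E)). \<exists>K w.
      dominated ?a r (?\<nu> r) K w \<and> 2 * K \<le> ?\<nu> r \<and>
      real K \<le> 18 * kappa v (real (?\<nu> r)) \<and> 1 / real (?\<nu> r) \<le> w \<and>
      1 / (20 * kappa v (real (?\<nu> r))) \<le> w \<and>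
      tail_bound w K \<le> C * (kappa v (real (?\<nu> r)) / real (?\<nu> r))"
    using eventually_compose_filterlim[OF C(2) lim] ev
  proof eventually_elim
    case (elim r)
    define N where "N = ?\<nu> r"
    from elim(1) obtain K w where K: "1 \<le> K" "4 * K \<le> N" and dbl: "u (2 * N) \<le> 4 * u N" and w: "0 < w"
      "4 * w \<le> real K / (8 * u N)"
      and rest: "real (2 * K) \<le> 18 * kappa v (real N)" "1 / real N \<le> w" "1 / (20 * kappa v (real N)) \<le> w"
      "tail_bound w (2 * K) \<le> C * (kappa v (real N) / real N)"
      unfolding N_def u_def by blast
    \<comment> \<open>The window is twice the K of the convexity bound, which becomes effective at
      distance 2K.\<close>
    have "dominated ?a r N (2 * K) w"
      unfolding dominated_def
    proof (intro conjI allI impI)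
      fix n assume n: "real (2 * K) \<le> \<bar>real n - real N\<bar>"
      have "4 * w * \<bar>real n - real N\<bar> \<le> \<bar>real n - real N\<bar> * (real K / (8 * u N))"
        using mult_right_mono[OF w(2), of "\<bar>real n - real N\<bar>"] by (simp add: mult.commute)
      also have "\<dots> \<le> A n - A N - (real n - real N) * l N"
        unfolding A_def l_def using K n by (intro convex_exponent_bound upos umono dbl) auto
      finally have "exp (- (A n - A N - (real n - real N) * l N)) \<le> exp (- 4 * w * \<bar>real n - real N\<bar>)" by simp
      then have "norm (?a N) * r ^ N * exp (- (A n - A N - (real n - real N) * l N))
          \<le> norm (?a N) * r ^ N * exp (- 4 * w * \<bar>real n - real N\<bar>)"
        using elim(2) by (intro mult_left_mono) auto
      then show "norm (?a n) * r ^ n \<le> norm (?a N) * r ^ N * exp (- 4 * w * \<bar>real n - real N\<bar>)"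
        using key[of r] elim(2) unfolding N_def by (meson order_trans)
    qed (use K w elim(2) key[of r] in \<open>auto simp: N_def\<close>)
    then show ?case using K rest unfolding N_def by (intro exI[of _ "2 * K"] exI[of _ w]) auto
  qed
  with E C(1) lim show ?thesis by (intro that)
qed

section \<open>Estimates near a normal radius\<close>

text \<open>Positivity of \<rho> is demanded separately: for r > 0 and 0 < k < 1/40 the lower end of
  the interval is negative.\<close>

definition near_radius :: "real \<Rightarrow> real \<Rightarrow> real \<Rightarrow> bool" where
  "near_radius k r \<rho> \<longleftrightarrow> 0 < \<rho> \<and> r * (1 - 1 / (40 * k)) < \<rho> \<and> \<rho> < r * (1 + 1 / (40 * k))"

lemma near_radius_ln:
  assumes "k \<ge> 1" "r > 0" "near_radius k r \<rho>"
  shows "\<bar>ln \<rho> - ln r\<bar> \<le> 1 / (20 * k)"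
proof -
  have "\<bar>ln \<rho> - ln r\<bar> \<le> 2 * (1 / (40 * k))"
    using assms by (intro ln_ratio_le) (auto simp: near_radius_def field_simps)
  then show ?thesis by simp
qed

abbreviation kappa_at :: "(real \<Rightarrow> real) \<Rightarrow> (complex \<Rightarrow> complex) \<Rightarrow> real \<Rightarrow> real" where
  "kappa_at v f r \<equiv> kappa v (real (central_index r f))"

text \<open>The exceptional set enters only through the filter G. The estimates thus pass to every
  finer filter, in particular to one that also encodes a condition on r.\<close>

locale wiman_valiron_filter =
  fixes v :: "real \<Rightarrow> real" and f :: "complex \<Rightarrow> complex" and G :: "real filter" and C :: real
  assumes v: "v \<in> class_V" and f: "f holomorphic_on UNIV" and C: "C \<ge> 0"
    and lim: "filterlim (\<lambda>r. central_index r f) at_top G"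
    and window: "\<forall>\<^sub>F r in G. \<exists>K w.
      dominated (taylor_coeff f) r (central_index r f) K w \<and> 2 * K \<le> central_index r f \<and>
      real K \<le> 18 * kappa_at v f r \<and> 1 / real (central_index r f) \<le> w \<and>
      1 / (20 * kappa_at v f r) \<le> w \<and>
      tail_bound w K \<le> C * (kappa_at v f r / real (central_index r f))"
begin

lemma kappa_at_top: "filterlim (kappa_at v f) at_top G"
  using filterlim_compose[OF class_V_kappa_at_top[OF v] lim] .

lemma kappa_ratio_tendsto: "((\<lambda>r. kappa_at v f r / real (central_index r f)) \<longlongrightarrow> 0) G"
  using filterlim_compose[OF class_V_kappa_small[OF v] lim] .

lemma eventually_kappa:
  "\<forall>\<^sub>F r in G. kappa_at v f r \<ge> 1 \<and> kappa_at v f r / real (central_index r f) \<le> 1 \<and> central_index r f \<ge> n"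
proof -
  have "\<forall>\<^sub>F r in G. kappa_at v f r \<ge> 1" "\<forall>\<^sub>F r in G. central_index r f \<ge> n"
    using kappa_at_top lim by (auto simp: filterlim_at_top)
  moreover have "\<forall>\<^sub>F r in G. kappa_at v f r / real (central_index r f) < 1"
    using order_tendstoD(2)[OF kappa_ratio_tendsto] by simp
  ultimately show ?thesis by eventually_elim auto
qed

lemma dgl_estimate:
  assumes alpha: "\<alpha> > 0" and j: "j \<ge> 1"
  obtains C' where "\<forall>\<^sub>F r in G. \<forall>z. near_radius (kappa_at v f r) r (norm z) \<longrightarrow>
    norm (z ^ j * (dgl_op \<alpha> ^^ j) f z / of_real ((real (central_index r f) * \<alpha>) powr (real j * \<alpha>)) - f z)
      \<le> C' * (kappa_at v f r / real (central_index r f)) * max_modulus (norm z) f"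
proof -
  obtain B D n0 where B: "B \<ge> 0" and D: "D \<ge> 0"
    and global: "\<And>N w n. 1 \<le> N \<Longrightarrow> 1 / real N \<le> w \<Longrightarrow>
      \<bar>dgl_factor \<alpha> j n / (real N * \<alpha>) powr (real j * \<alpha>) - 1\<bar> \<le> B * exp (w * \<bar>real n - real N\<bar>)"
    and size: "\<And>N K n. n0 \<le> N \<Longrightarrow> 1 \<le> K \<Longrightarrow> 2 * K \<le> N \<Longrightarrow> \<bar>real n - real N\<bar> \<le> real K \<Longrightarrow>
      \<bar>dgl_factor \<alpha> j n / (real N * \<alpha>) powr (real j * \<alpha>) - 1\<bar> \<le> D * (real K / real N)"
    and step: "\<And>N K n. n0 \<le> N \<Longrightarrow> 2 * K \<le> N \<Longrightarrow> \<bar>real n - real N\<bar> \<le> real K \<Longrightarrow>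
      \<bar>(dgl_factor \<alpha> j (Suc n) / (real N * \<alpha>) powr (real j * \<alpha>) - 1)
        - (dgl_factor \<alpha> j n / (real N * \<alpha>) powr (real j * \<alpha>) - 1)\<bar> \<le> D / real N"
    using dgl_multiplier_bounds[OF assms] by metis
  \<comment> \<open>Inside the window the size plus 2K times the increment is 3 D K / N <= 54 D k /
    N, as K <= 18 k; \<open>multiplier_estimate\<close> doubles it, and 1 + C bounds 1 + tail. The
    summand B C stems from the tail.\<close>
  define C' where "C' = 108 * D * (1 + C) + B * C"
  have "\<forall>\<^sub>F r in G. \<forall>z. near_radius (kappa_at v f r) r (norm z) \<longrightarrow>
    norm (z ^ j * (dgl_op \<alpha> ^^ j) f z / of_real ((real (central_index r f) * \<alpha>) powr (real j * \<alpha>)) - f z)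
      \<le> C' * (kappa_at v f r / real (central_index r f)) * max_modulus (norm z) f"
    using window eventually_kappa[of "max 1 n0"]
  proof eventually_elim
    case (elim r)
    define N where "N = central_index r f"
    define k where "k = kappa_at v f r"
    define P where "P = (real N * \<alpha>) powr (real j * \<alpha>)"
    from elim(1) obtain K w where dom: "dominated (taylor_coeff f) r N K w" and K: "2 * K \<le> N" "real K \<le> 18 * k"
      and w: "1 / real N \<le> w" "1 / (20 * k) \<le> w" and tail: "tail_bound w K \<le> C * (k / real N)"
      unfolding N_def k_def by blast
    have k: "k \<ge> 1" "k / real N \<le> 1" and N: "N \<ge> 1" "N \<ge> n0" using elim(2) by (auto simp: N_def k_def)
    have r: "r > 0" and K1: "1 \<le> K" using dom by (auto simp: dominated_def)
    have "norm (z ^ j * (dgl_op \<alpha> ^^ j) f z / of_real P - f z) \<le> C' * (k / real N) * max_modulus (norm z) f"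
      if near: "near_radius k r (norm z)" for z
    proof -
      define \<rho> where "\<rho> = norm z"
      have \<rho>: "\<rho> > 0" "\<bar>ln \<rho> - ln r\<bar> \<le> w"
        using near near_radius_ln[OF k(1) r near] w(2) by (auto simp: \<rho>_def near_radius_def)
      let ?g = "\<lambda>n. dgl_factor \<alpha> j n / P - 1"
      define M where "M = max_modulus \<rho> f"
      have M0: "M \<ge> 0" using max_modulus_nonneg[OF f, of \<rho>] \<rho> by (simp add: M_def)
      have sums: "(\<lambda>n. of_real (?g n) * taylor_coeff f n * z ^ n) sums (z ^ j * (dgl_op \<alpha> ^^ j) f z / of_real P - f z)"
        using sums_diff[OF sums_divide[OF sums_dgl_op_iterate_shifted[OF alpha sums_taylor_coeff[OF f], of j z], of "of_real P"]
          sums_taylor_coeff[OF f, of z]] by (simp add: left_diff_distrib)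
      have "norm (z ^ j * (dgl_op \<alpha> ^^ j) f z / of_real P - f z)
        \<le> (2 * (D * (real K / real N) + real (2 * K) * (D / real N)) * (1 + tail_bound w K) + B * tail_bound w K) * M"
      proof (rule multiplier_estimate[OF dom \<rho> \<rho>_def[symmetric] sums_taylor_coeff[OF f]])
        show "norm (f u) \<le> M" if "norm u = \<rho>" for u
          unfolding M_def using norm_le_max_modulus[OF f that] .
        show "norm (taylor_coeff f N) * \<rho> ^ N \<le> M"
          unfolding M_def using coeff_le_max_modulus[OF f \<rho>(1)] .
        show "\<bar>?g n\<bar> \<le> B * exp (w * \<bar>real n - real N\<bar>)" for n
          unfolding P_def by (rule global[OF N(1) w(1)])
        show "\<bar>?g n\<bar> \<le> D * (real K / real N)" if "\<bar>real n - real N\<bar> \<le> real K" for n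
          unfolding P_def by (rule size[OF N(2) K1 K(1) that])
        show "\<bar>?g (Suc n) - ?g n\<bar> \<le> D / real N" if "\<bar>real n - real N\<bar> \<le> real K" for n
          unfolding P_def by (rule step[OF N(2) K(1) that])
      qed (rule sums)
      also have "\<dots> \<le> C' * (k / real N) * M"
      proof (rule mult_right_mono[OF _ M0])
        have "D * (real K / real N) + real (2 * K) * (D / real N) = 3 * D * (real K / real N)" by simp
        also have "\<dots> \<le> 3 * D * (18 * k / real N)"
          using K D by (intro mult_left_mono divide_right_mono) auto
        finally have 1: "D * (real K / real N) + real (2 * K) * (D / real N) \<le> 54 * D * (k / real N)" by simp
        have "C * (k / real N) \<le> C" using mult_left_mono[OF k(2) C] by simp
        then have 2: "1 + tail_bound w K \<le> 1 + C" using tail by linarith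
        have "0 \<le> tail_bound w K" using dom by (simp add: tail_bound_def dominated_def)
        then have "2 * (D * (real K / real N) + real (2 * K) * (D / real N)) * (1 + tail_bound w K)
            \<le> 2 * (54 * D * (k / real N)) * (1 + C)"
          using D k(1) by (intro mult_mono mult_left_mono 1 2) auto
        moreover have "B * tail_bound w K \<le> B * (C * (k / real N))" using B tail by (rule mult_left_mono[rotated])
        ultimately show "2 * (D * (real K / real N) + real (2 * K) * (D / real N)) * (1 + tail_bound w K)
            + B * tail_bound w K \<le> C' * (k / real N)"
          by (simp only: C'_def ring_distribs) (simp add: algebra_simps)
      qed
      finally show ?thesis by (simp add: M_def \<rho>_def)
    qed
    then show ?case unfolding k_def P_def N_def by blast
  qed
  then show ?thesis by (rule that)
qed

text \<open>f(exp x * z) is compared with exp(x \<nu>) f(z) on the circle of radius r itself,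
  through the multiplier of \<open>exp_multiplier_bounds\<close>. Of the two errors, \<kappa>|x|
  vanishes in the limit when x = o(1/\<kappa>), and \<kappa>/\<nu> always does.\<close>

lemma dilation_estimate:
  obtains C' where "\<forall>\<^sub>F r in G. r > 0 \<and> max_modulus r f > 0 \<and> (\<forall>x. \<bar>x\<bar> \<le> 1 / (20 * kappa_at v f r) \<longrightarrow>
    \<bar>max_modulus (exp x * r) f - exp (x * real (central_index r f)) * max_modulus r f\<bar>
      \<le> C' * (kappa_at v f r * \<bar>x\<bar> + kappa_at v f r / real (central_index r f))
        * (exp (x * real (central_index r f)) * max_modulus r f))"
proof -
  \<comment> \<open>Size plus 2K increments is (3 + 2 * 9) |x| K <= 21 * 18 k |x| = 378 k |x|, which
    \<open>multiplier_estimate\<close> doubles.\<close>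
  define C' where "C' = 756 * (1 + C) + C"
  have "\<forall>\<^sub>F r in G. r > 0 \<and> max_modulus r f > 0 \<and> (\<forall>x. \<bar>x\<bar> \<le> 1 / (20 * kappa_at v f r) \<longrightarrow>
    \<bar>max_modulus (exp x * r) f - exp (x * real (central_index r f)) * max_modulus r f\<bar>
      \<le> C' * (kappa_at v f r * \<bar>x\<bar> + kappa_at v f r / real (central_index r f))
        * (exp (x * real (central_index r f)) * max_modulus r f))"
    using window eventually_kappa[of 1]
  proof eventually_elim
    case (elim r)
    define N where "N = central_index r f"
    define k where "k = kappa_at v f r"
    from elim(1) obtain K w where dom: "dominated (taylor_coeff f) r N K w" and K: "2 * K \<le> N" "real K \<le> 18 * k"
      and w: "1 / real N \<le> w" "1 / (20 * k) \<le> w" and tail: "tail_bound w K \<le> C * (k / real N)"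
      unfolding N_def k_def by blast
    have k: "k \<ge> 1" "k / real N \<le> 1" and N: "N \<ge> 1" using elim(2) by (auto simp: N_def k_def)
    have r: "r > 0" and K1: "1 \<le> K" and w0: "w > 0" using dom by (auto simp: dominated_def)
    define M where "M = max_modulus r f"
    have M: "norm (taylor_coeff f N) * r ^ N \<le> M"
      unfolding M_def using coeff_le_max_modulus[OF f r] .
    moreover have "norm (taylor_coeff f N) * r ^ N > 0" using dom r by (simp add: dominated_def)
    ultimately have M0: "M > 0" by linarith
    have "\<bar>max_modulus (exp x * r) f - exp (x * real N) * M\<bar> \<le> C' * (k * \<bar>x\<bar> + k / real N) * (exp (x * real N) * M)"
      if x: "\<bar>x\<bar> \<le> 1 / (20 * k)" for x
    proof -
      have xw: "\<bar>x\<bar> \<le> w" using x w by linarith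
      have xK: "\<bar>x\<bar> * real K \<le> 1"
      proof -
        have "\<bar>x\<bar> * real K \<le> 1 / (20 * k) * (18 * k)" using x K k by (intro mult_mono) auto
        also have "\<dots> \<le> 1" using k by simp
        finally show ?thesis .
      qed
      let ?g = "\<lambda>n. exp (x * (real n - real N)) - 1"
      note g = exp_multiplier_bounds[OF xw xK K1, of _ N]
      have est: "norm (f (of_real (exp x) * z) - of_real (exp (x * real N)) * f z)
          \<le> C' * (k * \<bar>x\<bar> + k / real N) * (exp (x * real N) * M)" if z: "norm z = r" for z
      proof -
        have terms: "of_real (?g n) * taylor_coeff f n * z ^ n
            = taylor_coeff f n * (of_real (exp x) * z) ^ n / of_real (exp (x * real N)) - taylor_coeff f n * z ^ n" for n
        proof -
          have "complex_of_real (?g n) = of_real (exp x) ^ n / of_real (exp (x * real N)) - 1"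
            by (simp add: right_diff_distrib exp_diff exp_of_nat2_mult del: of_real_exp)
          then show ?thesis by (simp add: power_mult_distrib left_diff_distrib)
        qed
        have sums: "(\<lambda>n. of_real (?g n) * taylor_coeff f n * z ^ n) sums (f (of_real (exp x) * z) / of_real (exp (x * real N)) - f z)"
          unfolding terms by (intro sums_diff sums_divide sums_taylor_coeff f)
        have "norm (f (of_real (exp x) * z) / of_real (exp (x * real N)) - f z)
          \<le> (2 * (3 * (\<bar>x\<bar> * real K) + real (2 * K) * (9 * \<bar>x\<bar>)) * (1 + tail_bound w K) + 1 * tail_bound w K) * M"
        proof (rule multiplier_estimate[OF dom r _ z sums_taylor_coeff[OF f]])
          show "norm (f u) \<le> M" if "norm u = r" for u
            unfolding M_def using norm_le_max_modulus[OF f that] .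
          show "\<bar>ln r - ln r\<bar> \<le> w" using w0 by simp
        qed (rule M g sums | assumption)+
        also have "\<dots> \<le> C' * (k * \<bar>x\<bar> + k / real N) * M"
        proof (rule mult_right_mono)
          have "3 * (\<bar>x\<bar> * real K) + real (2 * K) * (9 * \<bar>x\<bar>) = 21 * \<bar>x\<bar> * real K" by simp
          also have "\<dots> \<le> 21 * \<bar>x\<bar> * (18 * k)" using K by (intro mult_left_mono) auto
          finally have 1: "3 * (\<bar>x\<bar> * real K) + real (2 * K) * (9 * \<bar>x\<bar>) \<le> 378 * (k * \<bar>x\<bar>)" by simp
          have "C * (k / real N) \<le> C" using mult_left_mono[OF k(2) C] by simp
          then have 2: "1 + tail_bound w K \<le> 1 + C" using tail by linarith
          have "0 \<le> tail_bound w K" using dom by (simp add: tail_bound_def dominated_def)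
          then have "2 * (3 * (\<bar>x\<bar> * real K) + real (2 * K) * (9 * \<bar>x\<bar>)) * (1 + tail_bound w K)
              \<le> 2 * (378 * (k * \<bar>x\<bar>)) * (1 + C)"
            using k(1) by (intro mult_mono mult_left_mono 1 2) auto
          also have "\<dots> = 756 * (1 + C) * (k * \<bar>x\<bar>)" by simp
          also have "\<dots> \<le> C' * (k * \<bar>x\<bar>)" using C k by (intro mult_right_mono) (auto simp: C'_def)
          finally have 3: "2 * (3 * (\<bar>x\<bar> * real K) + real (2 * K) * (9 * \<bar>x\<bar>)) * (1 + tail_bound w K) \<le> C' * (k * \<bar>x\<bar>)" .
          have "C * (k / real N) \<le> C' * (k / real N)" using C k by (intro mult_right_mono) (auto simp: C'_def)
          then show "2 * (3 * (\<bar>x\<bar> * real K) + real (2 * K) * (9 * \<bar>x\<bar>)) * (1 + tail_bound w K) + 1 * tail_bound w K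
              \<le> C' * (k * \<bar>x\<bar> + k / real N)" using 3 tail by (simp only: distrib_left)
        qed (use M0 in simp)
        finally have *: "norm (f (of_real (exp x) * z) / of_real (exp (x * real N)) - f z) \<le> C' * (k * \<bar>x\<bar> + k / real N) * M" .
        have "norm (f (of_real (exp x) * z) - of_real (exp (x * real N)) * f z)
          = exp (x * real N) * norm (f (of_real (exp x) * z) / of_real (exp (x * real N)) - f z)"
        proof -
          have "f (of_real (exp x) * z) - of_real (exp (x * real N)) * f z
            = of_real (exp (x * real N)) * (f (of_real (exp x) * z) / of_real (exp (x * real N)) - f z)"
            by (simp add: right_diff_distrib)
          then show ?thesis by (simp only: norm_mult norm_of_real abs_exp_cancel)
        qed
        also have "\<dots> \<le> exp (x * real N) * (C' * (k * \<bar>x\<bar> + k / real N) * M)" by (intro mult_left_mono *) simp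
        finally show ?thesis by (simp only: mult_ac)
      qed
      show ?thesis
        unfolding M_def
      proof (rule max_modulus_diff_le[OF f])
        fix z :: complex assume z: "norm z = r"
        have "\<bar>norm (f (of_real (exp x) * z)) - norm (of_real (exp (x * real N)) * f z)\<bar>
            \<le> norm (f (of_real (exp x) * z) - of_real (exp (x * real N)) * f z)" by (rule norm_triangle_ineq3)
        with est[OF z] show "\<bar>norm (f (of_real (exp x) * z)) - exp (x * real N) * norm (f z)\<bar>
            \<le> C' * (k * \<bar>x\<bar> + k / real N) * (exp (x * real N) * max_modulus r f)"
          by (simp add: norm_mult M_def)
      qed (use r in auto)
    qed
    then show ?case using r M0 unfolding N_def k_def M_def by blast
  qed
  then show ?thesis by (rule that)
qed

end

section \<open>Asymptotics\<close>

text \<open>Makes the O-term explicit: \<eta> is the error relative to M, corrected by the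
  unimodular quotient of \<open>norm z ^ j\<close> and \<open>z ^ j\<close>.\<close>

lemma remainder_form:
  fixes z w b :: complex
  assumes c: "c > 0" and z: "z \<noteq> 0" and M: "M > 0" and le: "norm (z ^ j * w / of_real c - b) \<le> q * M"
  shows "\<exists>\<eta>. norm \<eta> \<le> q \<and> w = of_real c * (b / z ^ j + \<eta> * of_real (M / norm z ^ j))"
proof (intro exI conjI)
  define e where "e = z ^ j * w / of_real c - b"
  let ?\<eta> = "e * of_real (norm z ^ j / M) / z ^ j"
  have "norm ?\<eta> = norm e / M" using z M by (simp add: norm_mult norm_divide norm_power)
  also have "\<dots> \<le> q" using le M by (simp add: e_def field_simps)
  finally show "norm ?\<eta> \<le> q" .
  have "?\<eta> * of_real (M / norm z ^ j) = e / z ^ j" using z M by simp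
  moreover have "w = of_real c * (b / z ^ j + e / z ^ j)"
    using z c by (simp add: e_def add_divide_distrib[symmetric])
  ultimately show "w = of_real c * (b / z ^ j + ?\<eta> * of_real (M / norm z ^ j))" by simp
qed

lemma max_modulus_pos:
  assumes "f holomorphic_on UNIV" "taylor_coeff f n \<noteq> 0" "\<rho> > 0"
  shows "max_modulus \<rho> f > 0"
proof -
  have "0 < norm (taylor_coeff f n) * \<rho> ^ n" using assms by simp
  also have "\<dots> \<le> max_modulus \<rho> f" using assms by (intro coeff_le_max_modulus)
  finally show ?thesis .
qed

lemma max_modulus_asymptotic:
  fixes D f :: "complex \<Rightarrow> complex" and k c \<rho> :: "real \<Rightarrow> real" and N :: "real \<Rightarrow> nat"
  assumes f: "f holomorphic_on UNIV"
    and expansion: "\<forall>\<^sub>F r in F. \<forall>\<rho> z. near_radius (k r) r \<rho> \<longrightarrow> norm z = \<rho> \<longrightarrow>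
      (\<exists>\<eta>::complex. norm \<eta> \<le> C * (k r / real (N r)) \<and>
        D z = of_real (c r) * (f z / z ^ j + \<eta> * of_real (max_modulus \<rho> f / \<rho> ^ j)))"
    and near: "\<forall>\<^sub>F r in F. near_radius (k r) r (\<rho> r)" and c: "\<And>r. c r \<ge> 0"
  shows "\<exists>\<epsilon>\<in>O[F](\<lambda>r. k r / real (N r)). \<forall>\<^sub>F r in F.
    max_modulus (\<rho> r) D = c r / \<rho> r ^ j * (1 + \<epsilon> r) * max_modulus (\<rho> r) f"
proof -
  define L where "L r = c r / \<rho> r ^ j * max_modulus (\<rho> r) f" for r
  \<comment> \<open>Where L r = 0, for instance at central index 0, the estimate \<open>main\<close>
    forces the left maximum to vanish as well, so that any value of \<epsilon> satisfies the
    identity and 0 respects the O-bound.\<close>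
  define \<epsilon> where "\<epsilon> r = (if L r = 0 then 0 else max_modulus (\<rho> r) D / L r - 1)" for r
  have main: "\<forall>\<^sub>F r in F. \<bar>max_modulus (\<rho> r) D - L r\<bar> \<le> C * (k r / real (N r)) * L r \<and> L r \<ge> 0"
    using expansion near
  proof eventually_elim
    case (elim r)
    have \<rho>: "\<rho> r > 0" using elim(2) by (simp add: near_radius_def)
    let ?K = "c r / \<rho> r ^ j" and ?M = "max_modulus (\<rho> r) f" and ?q = "C * (k r / real (N r))"
    have K: "?K \<ge> 0" using c \<rho> by simp
    have M: "?M \<ge> 0" using max_modulus_nonneg[OF f] \<rho> by simp
    have "\<bar>max_modulus (1 * \<rho> r) D - ?K * ?M\<bar> \<le> ?q * (?K * ?M)"
    proof (rule max_modulus_diff_le[OF f])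
      fix z :: complex assume z: "norm z = \<rho> r"
      then obtain \<eta> where \<eta>: "norm \<eta> \<le> ?q" "D z = of_real (c r) * (f z / z ^ j + \<eta> * of_real (?M / \<rho> r ^ j))"
        using elim by blast
      have "\<bar>norm (D z) - norm (of_real (c r) * (f z / z ^ j))\<bar> \<le> norm (D z - of_real (c r) * (f z / z ^ j))"
        by (rule norm_triangle_ineq3)
      also have "D z - of_real (c r) * (f z / z ^ j) = of_real (c r) * (\<eta> * of_real (?M / \<rho> r ^ j))"
        unfolding \<eta>(2) by (simp add: distrib_left)
      also have "norm \<dots> = norm \<eta> * (?K * ?M)" using c[of r] M \<rho> by (simp add: norm_mult norm_divide norm_power)
      also have "\<dots> \<le> ?q * (?K * ?M)" by (rule mult_right_mono[OF \<eta>(1) mult_nonneg_nonneg[OF K M]])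
      finally show "\<bar>norm (D (of_real 1 * z)) - ?K * norm (f z)\<bar> \<le> ?q * (?K * ?M)"
        using z c[of r] by (simp add: norm_mult norm_divide norm_power)
    qed (use K \<rho> in auto)
    then have "\<bar>max_modulus (\<rho> r) D - ?K * ?M\<bar> \<le> ?q * (?K * ?M)" by (simp only: mult_1)
    then show ?case unfolding L_def using mult_nonneg_nonneg[OF K M] by blast
  qed
  have "\<epsilon> \<in> O[F](\<lambda>r. k r / real (N r))"
  proof (rule bigoI[where c="\<bar>C\<bar>"])
    show "\<forall>\<^sub>F r in F. norm (\<epsilon> r) \<le> \<bar>C\<bar> * norm (k r / real (N r))"
      using main
    proof eventually_elim
      case (elim r)
      show ?case
      proof (cases "L r = 0")
        case False
        then have L: "L r > 0" using elim by simp
        have "\<bar>\<epsilon> r\<bar> = \<bar>max_modulus (\<rho> r) D - L r\<bar> / L r"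
        proof -
          have "\<epsilon> r = (max_modulus (\<rho> r) D - L r) / L r" using L by (simp add: \<epsilon>_def diff_divide_distrib)
          then show ?thesis using L by (simp only: abs_divide abs_of_pos)
        qed
        also have "\<dots> \<le> C * (k r / real (N r)) * L r / L r" using L elim by (intro divide_right_mono) auto
        also have "\<dots> = C * (k r / real (N r))" using L by simp
        also have "\<dots> \<le> \<bar>C\<bar> * \<bar>k r / real (N r)\<bar>" by (metis abs_ge_self abs_mult)
        finally show ?thesis by simp
      qed (simp add: \<epsilon>_def)
    qed
  qed
  moreover have "\<forall>\<^sub>F r in F. max_modulus (\<rho> r) D = c r / \<rho> r ^ j * (1 + \<epsilon> r) * max_modulus (\<rho> r) f"
    using main
  proof eventually_elim
    case (elim r)
    have "max_modulus (\<rho> r) D = L r * (1 + \<epsilon> r)" using elim by (cases "L r = 0") (auto simp: \<epsilon>_def)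
    then show ?case by (simp add: L_def)
  qed
  ultimately show ?thesis by blast
qed

lemma tendsto_zero_imp_smallo_one: "(\<delta> \<longlongrightarrow> 0) F \<Longrightarrow> \<delta> \<in> o[F](\<lambda>r. 1 :: real)"
  by (intro smalloI_tendsto) auto

context wiman_valiron_filter
begin

lemma dgl_expansion:
  assumes "\<alpha> > 0" "j \<ge> 1"
  shows "\<exists>C'. \<forall>\<^sub>F r in G. \<forall>\<rho> z. near_radius (kappa_at v f r) r \<rho> \<longrightarrow> norm z = \<rho> \<longrightarrow>
    (\<exists>\<eta>::complex. norm \<eta> \<le> C' * (kappa_at v f r / real (central_index r f)) \<and>
      (dgl_op \<alpha> ^^ j) f z = of_real ((real (central_index r f) * \<alpha>) powr (real j * \<alpha>)) *
        (f z / z ^ j + \<eta> * of_real (max_modulus \<rho> f / \<rho> ^ j)))"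
proof -
  obtain C' where C': "\<forall>\<^sub>F r in G. \<forall>z. near_radius (kappa_at v f r) r (norm z) \<longrightarrow>
    norm (z ^ j * (dgl_op \<alpha> ^^ j) f z / of_real ((real (central_index r f) * \<alpha>) powr (real j * \<alpha>)) - f z)
      \<le> C' * (kappa_at v f r / real (central_index r f)) * max_modulus (norm z) f"
    by (rule dgl_estimate[OF assms])
  have "\<forall>\<^sub>F r in G. \<forall>\<rho> z. near_radius (kappa_at v f r) r \<rho> \<longrightarrow> norm z = \<rho> \<longrightarrow>
    (\<exists>\<eta>::complex. norm \<eta> \<le> C' * (kappa_at v f r / real (central_index r f)) \<and>
      (dgl_op \<alpha> ^^ j) f z = of_real ((real (central_index r f) * \<alpha>) powr (real j * \<alpha>)) *
        (f z / z ^ j + \<eta> * of_real (max_modulus \<rho> f / \<rho> ^ j)))"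
    using C' window eventually_kappa[of 1]
  proof eventually_elim
    case (elim r)
    show ?case
    proof (intro allI impI)
      fix \<rho> and z :: complex
      assume near: "near_radius (kappa_at v f r) r \<rho>" and z: "norm z = \<rho>"
      have \<rho>: "\<rho> > 0" using near by (simp add: near_radius_def)
      have "taylor_coeff f (central_index r f) \<noteq> 0" using elim(2) by (auto simp: dominated_def)
      then have "max_modulus \<rho> f > 0" using f \<rho> by (intro max_modulus_pos)
      moreover have "(real (central_index r f) * \<alpha>) powr (real j * \<alpha>) > 0" using elim(3) assms by simp
      ultimately show "\<exists>\<eta>::complex. norm \<eta> \<le> C' * (kappa_at v f r / real (central_index r f)) \<and>
        (dgl_op \<alpha> ^^ j) f z = of_real ((real (central_index r f) * \<alpha>) powr (real j * \<alpha>)) *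
        (f z / z ^ j + \<eta> * of_real (max_modulus \<rho> f / \<rho> ^ j))"
        using elim(1) near z \<rho> unfolding z[symmetric] by (intro remainder_form) auto
    qed
  qed
  then show ?thesis by blast
qed

text \<open>Smallness of x = ln \<rho> - ln r on the scale 1/\<kappa> controls the error of the
  dilation estimate, but not its main factor exp(x \<nu>) = (\<rho>/r)^\<nu>. Only smallness on the
  scale 1/\<nu> sends that factor to 1.\<close>

lemma max_modulus_radius_change:
  fixes D :: "complex \<Rightarrow> complex"
  assumes FG: "F \<le> G" and near: "\<forall>\<^sub>F r in F. near_radius (kappa_at v f r) r (\<rho> r)"
    and small: "(\<lambda>r. ln (\<rho> r) - ln r) \<in> o[F](\<lambda>r. 1 / kappa_at v f r)"
    and eps: "\<epsilon> \<in> O[F](\<lambda>r. kappa_at v f r / real (central_index r f))"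
    and eq: "\<forall>\<^sub>F r in F. max_modulus (\<rho> r) D = c r / \<rho> r ^ j * (1 + \<epsilon> r) * max_modulus (\<rho> r) f"
  shows "\<exists>\<delta>\<in>o[F](\<lambda>r. 1 :: real). \<forall>\<^sub>F r in F.
      max_modulus (\<rho> r) D = (1 + \<delta> r) * (c r / r ^ j) * ((\<rho> r / r) ^ central_index r f * max_modulus r f)"
    and "(\<lambda>r. ln (\<rho> r) - ln r) \<in> o[F](\<lambda>r. 1 / real (central_index r f)) \<Longrightarrow>
      \<exists>\<delta>\<in>o[F](\<lambda>r. 1 :: real). \<forall>\<^sub>F r in F.
      max_modulus (\<rho> r) D = (1 + \<delta> r) * (c r / r ^ j) * max_modulus r f"
proof -
  define x where "x r = ln (\<rho> r) - ln r" for r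
  let ?k = "kappa_at v f" and ?N = "\<lambda>r. real (central_index r f)" and ?M = "\<lambda>r. max_modulus r f"
  have kN: "((\<lambda>r. ?k r / ?N r) \<longlongrightarrow> 0) F" using tendsto_mono[OF FG kappa_ratio_tendsto] .
  have ktop: "filterlim ?k at_top F" using filterlim_mono[OF kappa_at_top order_refl FG] .
  have kx: "((\<lambda>r. ?k r * \<bar>x r\<bar>) \<longlongrightarrow> 0) F"
  proof -
    have "((\<lambda>r. x r / (1 / ?k r)) \<longlongrightarrow> 0) F" unfolding x_def by (rule smalloD_tendsto[OF small])
    then have "((\<lambda>r. \<bar>?k r * x r\<bar>) \<longlongrightarrow> 0) F" by (intro tendsto_rabs_zero) (simp add: mult.commute)
    then show ?thesis
    proof (rule Lim_transform_eventually)
      show "\<forall>\<^sub>F r in F. \<bar>?k r * x r\<bar> = ?k r * \<bar>x r\<bar>"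
        using filter_leD[OF FG eventually_kappa[of 0]] by eventually_elim (simp add: abs_mult)
    qed
  qed
  obtain C' where C': "\<forall>\<^sub>F r in G. r > 0 \<and> ?M r > 0 \<and> (\<forall>x. \<bar>x\<bar> \<le> 1 / (20 * ?k r) \<longrightarrow>
    \<bar>?M (exp x * r) - exp (x * ?N r) * ?M r\<bar> \<le> C' * (?k r * \<bar>x\<bar> + ?k r / ?N r) * (exp (x * ?N r) * ?M r))"
    by (rule dilation_estimate)
  have base: "\<forall>\<^sub>F r in F. r > 0 \<and> ?M r > 0 \<and> \<rho> r = exp (x r) * r \<and> \<bar>x r\<bar> \<le> 1 / (20 * ?k r) \<and>
      \<bar>?M (\<rho> r) - exp (x r * ?N r) * ?M r\<bar> \<le> C' * (?k r * \<bar>x r\<bar> + ?k r / ?N r) * (exp (x r * ?N r) * ?M r)"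
    using filter_leD[OF FG C'] filter_leD[OF FG eventually_kappa[of 0]] near
  proof eventually_elim
    case (elim r)
    have "\<rho> r > 0" using elim(3) by (simp add: near_radius_def)
    then have "\<rho> r = exp (x r) * r" using elim(1) by (simp add: x_def exp_diff)
    moreover have "\<bar>x r\<bar> \<le> 1 / (20 * ?k r)" unfolding x_def using elim by (intro near_radius_ln) auto
    ultimately show ?case using elim(1) by simp
  qed
  have x0: "(x \<longlongrightarrow> 0) F"
  proof (rule Lim_null_comparison)
    show "\<forall>\<^sub>F r in F. norm (x r) \<le> 1 / (20 * ?k r)" using base by eventually_elim auto
    have "((\<lambda>y::real. 1 / (20 * y)) \<longlongrightarrow> 0) at_top" by real_asymp
    from filterlim_compose[OF this ktop] show "((\<lambda>r. 1 / (20 * ?k r)) \<longlongrightarrow> 0) F" .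
  qed
  define e where "e r = ?M (\<rho> r) / (exp (x r * ?N r) * ?M r) - 1" for r
  have e0: "(e \<longlongrightarrow> 0) F"
  proof (rule Lim_null_comparison)
    show "\<forall>\<^sub>F r in F. norm (e r) \<le> C' * (?k r * \<bar>x r\<bar> + ?k r / ?N r)"
      using base
    proof eventually_elim
      case (elim r)
      let ?B = "exp (x r * ?N r) * ?M r"
      have B: "?B > 0" using elim by simp
      have "?M r \<noteq> 0" using elim by auto
      then have "e r = (?M (\<rho> r) - ?B) / ?B" by (simp add: e_def diff_divide_distrib)
      then have "\<bar>e r\<bar> = \<bar>?M (\<rho> r) - ?B\<bar> / ?B" using B by (simp only: abs_divide abs_of_pos)
      also have "\<dots> \<le> C' * (?k r * \<bar>x r\<bar> + ?k r / ?N r) * ?B / ?B" using B elim by (intro divide_right_mono) auto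
      also have "\<dots> = C' * (?k r * \<bar>x r\<bar> + ?k r / ?N r)"
        by (rule nonzero_mult_div_cancel_right) (use B in linarith)
      finally show ?case by simp
    qed
    have "((\<lambda>r. C' * (?k r * \<bar>x r\<bar> + ?k r / ?N r)) \<longlongrightarrow> C' * (0 + 0)) F"
      by (intro tendsto_intros kx kN)
    then show "((\<lambda>r. C' * (?k r * \<bar>x r\<bar> + ?k r / ?N r)) \<longlongrightarrow> 0) F" by simp
  qed
  have eps0: "(\<epsilon> \<longlongrightarrow> 0) F"
  proof -
    obtain c' where "\<forall>\<^sub>F r in F. norm (\<epsilon> r) \<le> c' * norm (?k r / ?N r)" by (rule landau_o.bigE[OF eps])
    moreover have "((\<lambda>r. c' * norm (?k r / ?N r)) \<longlongrightarrow> 0) F"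
      by (intro tendsto_mult_right_zero tendsto_norm_zero kN)
    ultimately show ?thesis by (rule Lim_null_comparison)
  qed
  \<comment> \<open>Three sources: replacing \<rho>^j by r^j, the error of the expansion on the
    circle of radius \<rho>, and the error of the dilation.\<close>
  define \<delta> where "\<delta> r = exp (- (real j * x r)) * (1 + \<epsilon> r) * (1 + e r) - 1" for r
  have \<delta>: "(\<delta> \<longlongrightarrow> 0) F"
  proof -
    have "(\<delta> \<longlongrightarrow> exp (- (real j * 0)) * (1 + 0) * (1 + 0) - 1) F"
      unfolding \<delta>_def by (intro tendsto_intros x0 eps0 e0)
    then show ?thesis by simp
  qed
  have main: "\<forall>\<^sub>F r in F. max_modulus (\<rho> r) D
      = (1 + \<delta> r) * (c r / r ^ j) * (exp (x r * ?N r) * ?M r) \<and> (\<rho> r / r) ^ central_index r f = exp (x r * ?N r)"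
    using base eq
  proof eventually_elim
    case (elim r)
    have "?M (\<rho> r) = (1 + e r) * (exp (x r * ?N r) * ?M r)" using elim(1) by (simp add: e_def)
    moreover have "c r / \<rho> r ^ j = exp (- (real j * x r)) * (c r / r ^ j)"
    proof -
      have "\<rho> r ^ j = exp (real j * x r) * r ^ j" using elim(1) by (simp add: power_mult_distrib exp_of_nat_mult)
      then show ?thesis using elim(1) by (simp add: exp_minus field_simps)
    qed
    ultimately have "max_modulus (\<rho> r) D = (1 + \<delta> r) * (c r / r ^ j) * (exp (x r * ?N r) * ?M r)"
      unfolding elim(2) by (simp only: \<delta>_def) simp
    moreover have "(\<rho> r / r) ^ central_index r f = exp (x r * ?N r)"
    proof -
      have "\<rho> r / r = exp (x r)" using elim(1) by simp
      then show ?thesis by (simp only: exp_of_nat2_mult)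
    qed
    ultimately show ?case ..
  qed
  show "\<exists>\<delta>\<in>o[F](\<lambda>r. 1 :: real). \<forall>\<^sub>F r in F.
      max_modulus (\<rho> r) D = (1 + \<delta> r) * (c r / r ^ j) * ((\<rho> r / r) ^ central_index r f * ?M r)"
  proof (rule bexI)
    show "\<forall>\<^sub>F r in F. max_modulus (\<rho> r) D = (1 + \<delta> r) * (c r / r ^ j) * ((\<rho> r / r) ^ central_index r f * ?M r)"
      using main by eventually_elim simp
  qed (rule tendsto_zero_imp_smallo_one[OF \<delta>])
  show "\<exists>\<delta>\<in>o[F](\<lambda>r. 1 :: real). \<forall>\<^sub>F r in F. max_modulus (\<rho> r) D = (1 + \<delta> r) * (c r / r ^ j) * ?M r"
    if "(\<lambda>r. ln (\<rho> r) - ln r) \<in> o[F](\<lambda>r. 1 / ?N r)"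
  proof (rule bexI)
    let ?\<delta> = "\<lambda>r. (1 + \<delta> r) * exp (x r * ?N r) - 1"
    have xN: "((\<lambda>r. x r * ?N r) \<longlongrightarrow> 0) F" using smalloD_tendsto[OF that] by (simp add: x_def)
    have "(?\<delta> \<longlongrightarrow> (1 + 0) * exp 0 - 1) F" by (intro tendsto_intros \<delta> xN)
    then show "?\<delta> \<in> o[F](\<lambda>r. 1)" by (intro tendsto_zero_imp_smallo_one) simp
    show "\<forall>\<^sub>F r in F. max_modulus (\<rho> r) D = (1 + ?\<delta> r) * (c r / r ^ j) * ?M r"
      using main by eventually_elim simp
  qed
qed

end

section \<open>Polynomials and the final statement\<close>

lemma finite_support_imp_poly:
  assumes f: "f holomorphic_on UNIV" and fin: "finite {n. taylor_coeff f n \<noteq> 0}"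
  shows "\<exists>p. \<forall>z. f z = poly p z"
proof (intro exI allI)
  fix z
  have "(\<lambda>n. taylor_coeff f n * z ^ n) sums (\<Sum>n\<in>{n. taylor_coeff f n \<noteq> 0}. taylor_coeff f n * z ^ n)"
    by (rule sums_finite[OF fin]) simp
  then show "f z = poly (\<Sum>n\<in>{n. taylor_coeff f n \<noteq> 0}. monom (taylor_coeff f n) n) z"
    using sums_taylor_coeff[OF f, of z] by (simp add: sums_unique2 poly_sum poly_monom)
qed

text \<open>For small central indices \<open>kappa\<close> can vanish or be negative (\<open>sqrt\<close> of a negative number is
  negative); no radius is near \<open>r\<close> then.\<close>

lemma near_radius_imp_pos:
  assumes "near_radius k r \<rho>" "r > 0"
  shows "k > 0"
proof (rule ccontr)
  assume "\<not> k > 0"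
  then have "1 / (40 * k) \<le> 0" by (simp add: divide_nonneg_nonpos)
  then have "r * (1 + 1 / (40 * k)) \<le> r * (1 - 1 / (40 * k))" using assms(2) by (intro mult_left_mono) auto
  then show False using assms(1) by (simp add: near_radius_def)
qed

text \<open>The central index is eventually the degree d, so \<kappa>/\<nu> is constant and the
  claim reduces to boundedness of the remainder relative to the maximum modulus. Cauchy's inequality
  for each of the finitely many terms gives this.\<close>

lemma dgl_expansion_polynomial:
  assumes f: "f holomorphic_on UNIV" and fin: "finite {n. taylor_coeff f n \<noteq> 0}" and alpha: "\<alpha> > 0" and j: "j \<ge> 1"
  shows "\<exists>C. \<forall>\<^sub>F r in at_top. \<forall>\<rho> z. near_radius (kappa_at v f r) r \<rho> \<longrightarrow> norm z = \<rho> \<longrightarrow>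
    (\<exists>\<eta>::complex. norm \<eta> \<le> C * (kappa_at v f r / real (central_index r f)) \<and>
      (dgl_op \<alpha> ^^ j) f z = of_real ((real (central_index r f) * \<alpha>) powr (real j * \<alpha>)) *
        (f z / z ^ j + \<eta> * of_real (max_modulus \<rho> f / \<rho> ^ j)))"
proof -
  let ?a = "taylor_coeff f" and ?D = "(dgl_op \<alpha> ^^ j) f"
  \<comment> \<open>Inserting 0 keeps the maximum defined for the zero function.\<close>
  define d where "d = Max (insert 0 {n. ?a n \<noteq> 0})"
  have above: "?a n = 0" if "n > d" for n
    using that fin Max_ge[of "insert 0 {n. ?a n \<noteq> 0}" n] by (force simp: d_def)
  have sum_D: "z ^ j * ?D z = (\<Sum>n\<le>d. of_real (dgl_factor \<alpha> j n) * ?a n * z ^ n)" for z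
  proof -
    have "(\<lambda>n. of_real (dgl_factor \<alpha> j n) * ?a n * z ^ n) sums (\<Sum>n\<le>d. of_real (dgl_factor \<alpha> j n) * ?a n * z ^ n)"
      by (rule sums_finite) (use above in auto)
    then show ?thesis
      using sums_dgl_op_iterate_shifted[OF alpha sums_taylor_coeff[OF f], of j z] sums_unique2 by blast
  qed
  show ?thesis
  proof (cases "d = 0")
    \<comment> \<open>The witnesses are C = 0 and \<eta> = 0. For a nonzero constant \<nu> = 0 and a
      power of 0 annihilates the right side, while the operator annihilates constants on the
      left.\<close>
    case d0: True
    have D0: "?D z = 0" if "z \<noteq> 0" for z
    proof -
      have "z ^ j * ?D z = 0" using sum_D[of z] d0 j by (simp add: dgl_factor_def)
      then show ?thesis using that by simp
    qed
    have zero: "of_real ((real (central_index r f) * \<alpha>) powr (real j * \<alpha>)) * (f z / z ^ j) = 0"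
      if "r > 0" for r and z :: complex
    \<comment> \<open>For f = 0 every index attains the maximal term, so
      \<open>central_index\<close> is a maximum over an infinite set with no known value; the
      product vanishes through f z.\<close>
    proof (cases "?a 0 = 0")
      case True
      then have "?a n = 0" for n using above[of n] \<open>d = 0\<close> by (cases n) auto
      then have "f z = 0" using sums_taylor_coeff[OF f, of z] by (simp add: sums_unique2[OF _ sums_zero])
      then show ?thesis by simp
    next
      case False
      have "central_index r f = 0"
      proof (rule central_index_eqI)
        have an: "?a n = 0" if "n > 0" for n using above[of n] that \<open>d = 0\<close> by simp
        show "norm (?a n) * r ^ n \<le> norm (?a 0) * r ^ 0" for n using an[of n] by (cases "n = 0") auto
        show "norm (?a n) * r ^ n < norm (?a 0) * r ^ 0" if "0 < n" for n using an[OF that] False by simp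
      qed
      then show ?thesis by simp
    qed
    show ?thesis
    proof (intro exI[of _ 0], use eventually_gt_at_top[of 0] in eventually_elim, intro allI impI exI[of _ 0] conjI)
      fix r \<rho> and z :: complex
      assume "0 < r" "near_radius (kappa_at v f r) r \<rho>" "norm z = \<rho>"
      then have "z \<noteq> 0" by (auto simp: near_radius_def)
      then show "?D z = of_real ((real (central_index r f) * \<alpha>) powr (real j * \<alpha>)) *
          (f z / z ^ j + 0 * of_real (max_modulus \<rho> f / \<rho> ^ j))"
        using D0[of z] zero[OF \<open>0 < r\<close>, of z] by simp
    qed simp
  next
    case False
    then have ad: "?a d \<noteq> 0"
      using Max_in[of "insert 0 {n. ?a n \<noteq> 0}"] fin by (auto simp: d_def)
    define c where "c = (real d * \<alpha>) powr (real j * \<alpha>)"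
    have c: "c > 0" using False alpha by (simp add: c_def)
    define B where "B = (\<Sum>n\<le>d. dgl_factor \<alpha> j n)"
    define k where "k = kappa v (real d)"
    have ci: "\<forall>\<^sub>F r in at_top. central_index r f = d"
    proof -
      have "\<forall>\<^sub>F r in at_top. \<forall>n<d. norm (?a n) * r ^ n < norm (?a d) * r ^ d"
        by (rule eventually_power_dominates) (use ad in simp)
      then show ?thesis using eventually_gt_at_top[of 0]
      proof eventually_elim
        case (elim r)
        have pos: "norm (?a d) * r ^ d > 0" using ad elim by simp
        show ?case
        proof (rule central_index_eqI)
          show "norm (?a n) * r ^ n \<le> norm (?a d) * r ^ d" for n
            using elim above[of n] pos by (cases n d rule: linorder_cases) auto
          show "norm (?a n) * r ^ n < norm (?a d) * r ^ d" if "d < n" for n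
            using above[OF that] pos by simp
        qed
      qed
    qed
    have est: "norm (z ^ j * ?D z / of_real c - f z) \<le> (B / c + 1) * max_modulus (norm z) f" if z: "z \<noteq> 0" for z
    proof -
      have "norm (z ^ j * ?D z) \<le> (\<Sum>n\<le>d. dgl_factor \<alpha> j n * max_modulus (norm z) f)"
        unfolding sum_D
      proof (rule sum_norm_le)
        fix n
        have "norm (of_real (dgl_factor \<alpha> j n) * ?a n * z ^ n) = dgl_factor \<alpha> j n * (norm (?a n) * norm z ^ n)"
          using dgl_factor_nonneg[OF alpha] by (simp add: norm_mult norm_power)
        also have "\<dots> \<le> dgl_factor \<alpha> j n * max_modulus (norm z) f"
          using z by (intro mult_left_mono coeff_le_max_modulus f dgl_factor_nonneg[OF alpha]) auto
        finally show "norm (of_real (dgl_factor \<alpha> j n) * ?a n * z ^ n) \<le> dgl_factor \<alpha> j n * max_modulus (norm z) f" .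
      qed
      then have "norm (z ^ j * ?D z) / c \<le> B * max_modulus (norm z) f / c"
        using c by (intro divide_right_mono) (auto simp: B_def sum_distrib_right)
      then have "norm (z ^ j * ?D z / of_real c) \<le> B / c * max_modulus (norm z) f"
        using c by (simp add: norm_divide)
      then show ?thesis
        using norm_triangle_ineq4[of "z ^ j * ?D z / of_real c" "f z"] norm_le_max_modulus[OF f, of z "norm z"]
        by (simp add: distrib_right)
    qed
    show ?thesis
    \<comment> \<open>The factor d / k cancels \<kappa>/\<nu> = k / d. This is legitimate because
      the existence of a radius near r forces k > 0.\<close>
    proof (intro exI[of _ "(B / c + 1) * (real d / k)"], use ci eventually_gt_at_top[of 0] in eventually_elim, intro allI impI)
      fix r \<rho> and z :: complex
      assume r: "central_index r f = d" "0 < r" and near: "near_radius (kappa_at v f r) r \<rho>" and z: "norm z = \<rho>"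
      have k: "k > 0" using near_radius_imp_pos[OF near r(2)] r by (simp add: k_def)
      have \<rho>: "\<rho> > 0" using near by (simp add: near_radius_def)
      then have z0: "z \<noteq> 0" using z by auto
      have "\<exists>\<eta>. norm \<eta> \<le> B / c + 1 \<and> ?D z = of_real c * (f z / z ^ j + \<eta> * of_real (max_modulus (norm z) f / norm z ^ j))"
        using est[OF z0] max_modulus_pos[OF f ad] \<rho> z by (intro remainder_form c z0) auto
      moreover have "(B / c + 1) * (real d / k) * (k / real d) = B / c + 1" using k False by simp
      ultimately show "\<exists>\<eta>. norm \<eta> \<le> (B / c + 1) * (real d / k) * (kappa_at v f r / real (central_index r f)) \<and>
        ?D z = of_real ((real (central_index r f) * \<alpha>) powr (real j * \<alpha>)) *
          (f z / z ^ j + \<eta> * of_real (max_modulus \<rho> f / \<rho> ^ j))"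
        unfolding r(1) k_def[symmetric] c_def[symmetric] z by simp
    qed
  qed
qed

text \<open>The restrictions on r are carried by the filter \<open>F\<close>, with
  \<open>z0 r\<close> the given point on the circle of radius r; \<eta> and \<epsilon>, \<delta> are
  the O- and o-terms. E is chosen before \<alpha> and j, the constant C after them. The formulas
  with 1 + \<delta> exclude polynomials: for f(z) = z^d the quotient of Gamma values is a constant
  that need not equal (d \<alpha>)^(j \<alpha>).\<close>

theorem theorem1:
  fixes v :: "real \<Rightarrow> real" and f :: "complex \<Rightarrow> complex" and z0 :: "real \<Rightarrow> complex"
  assumes "v \<in> class_V" and "f holomorphic_on UNIV"
  shows "\<exists>E. finite_log_measure E \<and>
    (let \<nu> = (\<lambda>r. central_index r f);
         \<kappa> = (\<lambda>r. kappa v (real (\<nu> r)));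
         near = (\<lambda>r \<rho>. 0 < \<rho> \<and> r * (1 - 1 / (40 * \<kappa> r)) < \<rho> \<and> \<rho> < r * (1 + 1 / (40 * \<kappa> r)));
         F = inf at_top (principal {r. r \<notin> E \<and> norm (z0 r) = r \<and>
               norm (f (z0 r)) \<ge> max_modulus r f / (v (real (\<nu> r)))\<^sup>2})
     in \<forall>\<alpha>::real. \<forall>j::nat. \<alpha> > 0 \<longrightarrow> j \<ge> 1 \<longrightarrow>
       (\<exists>C. \<forall>\<^sub>F r in F. \<forall>\<rho> z. near r \<rho> \<longrightarrow> norm z = \<rho> \<longrightarrow>
          (\<exists>\<eta>::complex. norm \<eta> \<le> C * (\<kappa> r / real (\<nu> r)) \<and>
             (dgl_op \<alpha> ^^ j) f z = of_real ((real (\<nu> r) * \<alpha>) powr (real j * \<alpha>)) *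
               (f z / z ^ j + \<eta> * of_real (max_modulus \<rho> f / \<rho> ^ j)))) \<and>
       (\<forall>\<rho>::real \<Rightarrow> real. (\<forall>\<^sub>F r in F. near r (\<rho> r)) \<longrightarrow>
          (\<lambda>r. ln (\<rho> r) - ln r) \<in> o[F](\<lambda>r. 1 / \<kappa> r) \<longrightarrow>
          (\<exists>\<epsilon>\<in>O[F](\<lambda>r. \<kappa> r / real (\<nu> r)). \<forall>\<^sub>F r in F.
             max_modulus (\<rho> r) ((dgl_op \<alpha> ^^ j) f) =
               (real (\<nu> r) * \<alpha>) powr (real j * \<alpha>) / \<rho> r ^ j * (1 + \<epsilon> r) * max_modulus (\<rho> r) f) \<and>
          (\<not> (\<exists>p. \<forall>z. f z = poly p z) \<longrightarrow>
            (\<exists>\<delta>\<in>o[F](\<lambda>r. 1 :: real). \<forall>\<^sub>F r in F.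
               max_modulus (\<rho> r) ((dgl_op \<alpha> ^^ j) f) =
                 (1 + \<delta> r) * ((real (\<nu> r) * \<alpha>) powr (real j * \<alpha>) / r ^ j) *
                   ((\<rho> r / r) ^ \<nu> r * max_modulus r f)) \<and>
            ((\<lambda>r. ln (\<rho> r) - ln r) \<in> o[F](\<lambda>r. 1 / real (\<nu> r)) \<longrightarrow>
              (\<exists>\<delta>\<in>o[F](\<lambda>r. 1 :: real). \<forall>\<^sub>F r in F.
                 max_modulus (\<rho> r) ((dgl_op \<alpha> ^^ j) f) =
                   (1 + \<delta> r) * ((real (\<nu> r) * \<alpha>) powr (real j * \<alpha>) / r ^ j) * max_modulus r f)))))"
proof -
  let ?inf = "infinite {n. taylor_coeff f n \<noteq> 0}"
  obtain E C where E: "finite_log_measure E"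
    and wv: "?inf \<Longrightarrow> wiman_valiron_filter v f (inf at_top (principal (- E))) C"
  \<comment> \<open>For finitely many nonzero coefficients the central index stays bounded and no
    radius has to be excluded; the second claim is then vacuous.\<close>
  proof (cases ?inf)
    case True
    show ?thesis
      by (rule wiman_valiron[OF assms True]) (intro that wiman_valiron_filter.intro assms)
  next
    case False
    then show ?thesis using finite_log_measure_empty by (intro that[of "{}"]) auto
  qed
  define F where "F = inf at_top (principal {r. r \<notin> E \<and> norm (z0 r) = r \<and>
    norm (f (z0 r)) \<ge> max_modulus r f / (v (real (central_index r f)))\<^sup>2})"
  have FG: "F \<le> inf at_top (principal (- E))" unfolding F_def by (intro inf_mono) auto
  have expansion: "\<exists>C. \<forall>\<^sub>F r in F. \<forall>\<rho> z. near_radius (kappa_at v f r) r \<rho> \<longrightarrow> norm z = \<rho> \<longrightarrow>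
    (\<exists>\<eta>::complex. norm \<eta> \<le> C * (kappa_at v f r / real (central_index r f)) \<and>
      (dgl_op \<alpha> ^^ j) f z = of_real ((real (central_index r f) * \<alpha>) powr (real j * \<alpha>)) *
        (f z / z ^ j + \<eta> * of_real (max_modulus \<rho> f / \<rho> ^ j)))" if "\<alpha> > 0" "j \<ge> 1" for \<alpha> j
  proof (cases ?inf)
    case True
    from wiman_valiron_filter.dgl_expansion[OF wv[OF True] that] filter_leD[OF FG] show ?thesis by blast
  next
    case False
    have "F \<le> at_top" by (simp add: F_def)
    with dgl_expansion_polynomial[OF assms(2) _ that, of v] False filter_leD show ?thesis by blast
  qed
  show ?thesis
    unfolding Let_def
    unfolding near_radius_def[symmetric] F_def[symmetric]
  proof (intro exI[of _ E] conjI E allI impI, unfold F_def[symmetric])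
    fix \<alpha> :: real and j :: nat
    assume aj: "\<alpha> > 0" "j \<ge> 1"
    then show "\<exists>C. \<forall>\<^sub>F r in F. \<forall>\<rho> z. near_radius (kappa_at v f r) r \<rho> \<longrightarrow> norm z = \<rho> \<longrightarrow>
      (\<exists>\<eta>::complex. norm \<eta> \<le> C * (kappa_at v f r / real (central_index r f)) \<and>
        (dgl_op \<alpha> ^^ j) f z = of_real ((real (central_index r f) * \<alpha>) powr (real j * \<alpha>)) *
          (f z / z ^ j + \<eta> * of_real (max_modulus \<rho> f / \<rho> ^ j)))"
      by (rule expansion)
    fix \<rho> :: "real \<Rightarrow> real"
    assume near: "\<forall>\<^sub>F r in F. near_radius (kappa_at v f r) r (\<rho> r)"
      and small: "(\<lambda>r. ln (\<rho> r) - ln r) \<in> o[F](\<lambda>r. 1 / kappa_at v f r)"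
    show asym: "\<exists>\<epsilon>\<in>O[F](\<lambda>r. kappa_at v f r / real (central_index r f)). \<forall>\<^sub>F r in F.
      max_modulus (\<rho> r) ((dgl_op \<alpha> ^^ j) f) =
        (real (central_index r f) * \<alpha>) powr (real j * \<alpha>) / \<rho> r ^ j * (1 + \<epsilon> r) * max_modulus (\<rho> r) f"
      using expansion[OF aj] near assms(2) by (elim exE) (rule max_modulus_asymptotic, auto)
    assume "\<not> (\<exists>p. \<forall>z. f z = poly p z)"
    then have "?inf" using finite_support_imp_poly[OF assms(2)] by blast
    note change = wiman_valiron_filter.max_modulus_radius_change[OF wv[OF this] FG near small]
    from asym obtain \<epsilon> where \<epsilon>: "\<epsilon> \<in> O[F](\<lambda>r. kappa_at v f r / real (central_index r f))"
      "\<forall>\<^sub>F r in F. max_modulus (\<rho> r) ((dgl_op \<alpha> ^^ j) f) =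
        (real (central_index r f) * \<alpha>) powr (real j * \<alpha>) / \<rho> r ^ j * (1 + \<epsilon> r) * max_modulus (\<rho> r) f"
      by blast
    show "\<exists>\<delta>\<in>o[F](\<lambda>r. 1 :: real). \<forall>\<^sub>F r in F.
      max_modulus (\<rho> r) ((dgl_op \<alpha> ^^ j) f) =
        (1 + \<delta> r) * ((real (central_index r f) * \<alpha>) powr (real j * \<alpha>) / r ^ j) *
          ((\<rho> r / r) ^ central_index r f * max_modulus r f)"
      by (rule change(1)[OF \<epsilon>])
    assume "(\<lambda>r. ln (\<rho> r) - ln r) \<in> o[F](\<lambda>r. 1 / real (central_index r f))"
    then show "\<exists>\<delta>\<in>o[F](\<lambda>r. 1 :: real). \<forall>\<^sub>F r in F.
      max_modulus (\<rho> r) ((dgl_op \<alpha> ^^ j) f) =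
        (1 + \<delta> r) * ((real (central_index r f) * \<alpha>) powr (real j * \<alpha>) / r ^ j) * max_modulus r f"
      by (rule change(2)[OF \<epsilon>])
  qed
qed

end
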